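(* A state $\rho$ is quantum Schnorr random if and only if for every computable measure machine $C$, every $\epsilon>0$ and every $d$, there is $n_0$ such that $QK^{\epsilon}_C(\rho_n)>n+d$ for all $n\ge n_0$.
   Context: A computable measure machine is a prefix-free Turing machine $C$ whose domain has computable Lebesgue measure $\sum_{\pi\in\operatorname{dom}(C)}2^{-|\pi|}$. Outputs of machines are interpreted as finite sets of vectors with complex algebraic entries via a fixed canonical effective indexing; $C(\pi)\downarrow=F$ means $C$ on input $\pi$ halts with output the code of $F$. $\mathbb{C}^{2^n}_{alg}$ denotes the vectors in $\mathbb{C}^{2^n}$ with complex algebraic entries. Logarithms are base 2. For a density matrix $\tau$ on $\mathbb{C}^{2^n}$ write $|\tau|=n$, and for $\epsilon>0$ define $QK^{\epsilon}_C(\tau)=\inf\{|\pi|+\log|F| : C(\pi)\downarrow=F,\ F \text{ an orthonormal subset of } \mathbb{C}^{2^{|\tau|}}_{alg},\ \sum_{v\in F}\langle v|\tau|v\rangle>\epsilon\}$, with $\inf\emptyset=\infty$. A state is a sequence $\rho=(\rho_n)_{n\in\mathbb{N}}$ of density matrices $\rho_n$ on $\mathbb{C}^{2^n}$ such that the partial trace of $\rho_n$ over the last qubit equals $\rho_{n-1}$. A special projection is a Hermitian projection matrix with complex algebraic entries. For a special projection $S$ on $\mathbb{C}^{2^n}$ put $\tau(S)=2^{-n}\operatorname{Tr}(S)$ and $\rho(S)=\operatorname{Tr}(\rho_nS)$. A strong Solovay test is a computable sequence $(S^m)_m$ of special projections with $\sum_m\tau(S^m)<\infty$; $\rho$ fails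 it at level $\epsilon>0$ if $\rho(S^m)>\epsilon$ for infinitely many $m$, and passes it if it fails it at no level $\epsilon>0$. A quantum Schnorr test is a strong Solovay test $(S^m)_m$ such that $\sum_m\tau(S^m)$ is a computable real number. A state is quantum Schnorr random if it passes every quantum Schnorr test. *)

theory Defs
  imports "HOL-Analysis.Analysis" "HOL-Library.Nat_Bijection"
    "Jordan_Normal_Form.Schur_Decomposition"
begin

datatype recf = Zero | Succ | Proj nat | Comp recf "recf list"
  | Prec recf recf | Mn recf

inductive evalr :: "recf \<Rightarrow> nat list \<Rightarrow> nat \<Rightarrow> bool" where
  ev_zero: "evalr Zero xs 0"
| ev_succ: "evalr Succ (x # xs) (Suc x)"
| ev_proj: "i < length xs \<Longrightarrow> evalr (Proj i) xs (xs ! i)"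
| ev_comp: "length gs = length ys \<Longrightarrow> (\<forall>i<length gs. evalr (gs ! i) xs (ys ! i))
             \<Longrightarrow> evalr f ys z \<Longrightarrow> evalr (Comp f gs) xs z"
| ev_prec0: "evalr f xs y \<Longrightarrow> evalr (Prec f g) (0 # xs) y"
| ev_precS: "evalr (Prec f g) (n # xs) y \<Longrightarrow> evalr g (y # n # xs) z
             \<Longrightarrow> evalr (Prec f g) (Suc n # xs) z"
| ev_mn: "evalr f (n # xs) 0 \<Longrightarrow> (\<forall>m<n. \<exists>y. evalr f (m # xs) y \<and> y \<noteq> 0)
             \<Longrightarrow> evalr (Mn f) xs n"

definition computable_fun :: "(nat \<Rightarrow> nat) \<Rightarrow> bool" where
  "computable_fun g \<longleftrightarrow> (\<exists>f. \<forall>x y. evalr f [x] y \<longleftrightarrow> g x = y)"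

definition bits_code :: "bool list \<Rightarrow> nat" where
  "bits_code \<sigma> = list_encode (map (\<lambda>b. if b then 1 else 0) \<sigma>)"

definition partial_computable_machine :: "(bool list \<Rightarrow> nat option) \<Rightarrow> bool" where
  "partial_computable_machine C \<longleftrightarrow>
     (\<exists>f. \<forall>\<sigma> y. evalr f [bits_code \<sigma>] y \<longleftrightarrow> C \<sigma> = Some y)"

definition prefix_free_machine :: "(bool list \<Rightarrow> nat option) \<Rightarrow> bool" where
  "prefix_free_machine C \<longleftrightarrow> partial_computable_machine C \<and>
     (\<forall>\<sigma> \<tau> u. \<sigma> \<in> dom C \<longrightarrow> \<tau> \<in> dom C \<longrightarrow> \<tau> = \<sigma> @ u \<longrightarrow> u = [])"

definition rat_of_code :: "nat \<Rightarrow> real" where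
  "rat_of_code c = (case prod_decode c of (a, b) \<Rightarrow> real_of_int (int_decode a) / real (Suc b))"

definition computable_real :: "real \<Rightarrow> bool" where
  "computable_real x \<longleftrightarrow> (\<exists>g. computable_fun g \<and> (\<forall>k. \<bar>x - rat_of_code (g k)\<bar> \<le> (1/2) ^ k))"

definition domain_measure :: "(bool list \<Rightarrow> nat option) \<Rightarrow> real" where
  "domain_measure C = (\<Sum>\<^sub>\<infinity>\<pi>\<in>dom C. (1/2) ^ length \<pi>)"

definition cm_machine :: "(bool list \<Rightarrow> nat option) \<Rightarrow> bool" where
  "cm_machine C \<longleftrightarrow> prefix_free_machine C \<and> computable_real (domain_measure C)"

definition lexless :: "complex \<Rightarrow> complex \<Rightarrow> bool" where
  "lexless z w \<longleftrightarrow> Re z < Re w \<or> (Re z = Re w \<and> Im z < Im w)"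

text \<open>Code (a,k): the k-th root (in lexicographic order of (Re, Im)) of the integer
  polynomial whose coefficient list (lowest degree first) is coded by a; default 0.\<close>
definition alg_of_code :: "nat \<Rightarrow> complex" where
  "alg_of_code c = (case prod_decode c of (a, k) \<Rightarrow>
     (let p = (Poly (map (\<lambda>m. of_int (int_decode m)) (list_decode a)) :: complex poly);
          R = (\<lambda>z. poly p z = 0 \<and> card {w. poly p w = 0 \<and> lexless w z} = k)
      in if p \<noteq> 0 \<and> (\<exists>z. R z) then (THE z. R z) else 0))"

definition lookup0 :: "nat list \<Rightarrow> nat \<Rightarrow> nat" where
  "lookup0 xs i = (if i < length xs then xs ! i else 0)"

definition fset_of_code :: "nat \<Rightarrow> complex vec set" where
  "fset_of_code c = (\<lambda>v. vec_of_list (map alg_of_code (list_decode v))) ` set (list_decode c)"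

definition smat_of_code :: "nat \<Rightarrow> nat \<times> complex mat" where
  "smat_of_code c = (case prod_decode c of (n, e) \<Rightarrow>
     (n, mat (2^n) (2^n) (\<lambda>(i, j). alg_of_code (lookup0 (list_decode (lookup0 (list_decode e) i)) j))))"

definition mtrace :: "complex mat \<Rightarrow> complex" where
  "mtrace A = (\<Sum>i<dim_row A. A $$ (i, i))"

definition density_mat :: "nat \<Rightarrow> complex mat \<Rightarrow> bool" where
  "density_mat n A \<longleftrightarrow> A \<in> carrier_mat (2^n) (2^n) \<and> mat_adjoint A = A \<and>
     (\<forall>v \<in> carrier_vec (2^n). 0 \<le> Re ((A *\<^sub>v v) \<bullet>c v)) \<and> mtrace A = 1"

text \<open>Partial trace over the last qubit (the least significant bit of the basis index).\<close>
definition ptrace_last :: "complex mat \<Rightarrow> complex mat" where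
  "ptrace_last A = mat (dim_row A div 2) (dim_col A div 2)
     (\<lambda>(i, j). A $$ (2*i, 2*j) + A $$ (2*i+1, 2*j+1))"

definition is_state :: "(nat \<Rightarrow> complex mat) \<Rightarrow> bool" where
  "is_state \<rho> \<longleftrightarrow> (\<forall>n. density_mat n (\<rho> n)) \<and> (\<forall>n. ptrace_last (\<rho> (Suc n)) = \<rho> n)"

definition orthonormal_alg :: "nat \<Rightarrow> complex vec set \<Rightarrow> bool" where
  "orthonormal_alg n F \<longleftrightarrow> F \<subseteq> carrier_vec (2^n) \<and>
     (\<forall>v\<in>F. \<forall>i<dim_vec v. algebraic (v $ i)) \<and>
     (\<forall>v\<in>F. \<forall>w\<in>F. v \<bullet>c w = (if v = w then 1 else 0))"

definition QK :: "(bool list \<Rightarrow> nat option) \<Rightarrow> real \<Rightarrow> nat \<Rightarrow> complex mat \<Rightarrow> ereal" where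
  "QK C \<epsilon> n \<tau> = Inf {ereal (real (length \<pi>) + log 2 (real (card F))) | \<pi> c F.
      C \<pi> = Some c \<and> F = fset_of_code c \<and> orthonormal_alg n F \<and>
      Re (\<Sum>v\<in>F. (\<tau> *\<^sub>v v) \<bullet>c v) > \<epsilon>}"

definition special_projection :: "nat \<Rightarrow> complex mat \<Rightarrow> bool" where
  "special_projection n S \<longleftrightarrow> S \<in> carrier_mat (2^n) (2^n) \<and> mat_adjoint S = S \<and>
     S * S = S \<and> (\<forall>i<2^n. \<forall>j<2^n. algebraic (S $$ (i, j)))"

definition tau_meas :: "nat \<times> complex mat \<Rightarrow> real" where
  "tau_meas S = Re (mtrace (snd S)) / 2 ^ fst S"

definition rho_meas :: "(nat \<Rightarrow> complex mat) \<Rightarrow> nat \<times> complex mat \<Rightarrow> real" where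
  "rho_meas \<rho> S = Re (mtrace (\<rho> (fst S) * snd S))"

definition computable_proj_seq :: "(nat \<Rightarrow> nat \<times> complex mat) \<Rightarrow> bool" where
  "computable_proj_seq S \<longleftrightarrow> (\<exists>g. computable_fun g \<and> (\<forall>m. S m = smat_of_code (g m))) \<and>
     (\<forall>m. special_projection (fst (S m)) (snd (S m)))"

definition strong_solovay_test :: "(nat \<Rightarrow> nat \<times> complex mat) \<Rightarrow> bool" where
  "strong_solovay_test S \<longleftrightarrow> computable_proj_seq S \<and> summable (\<lambda>m. tau_meas (S m))"

definition quantum_schnorr_test :: "(nat \<Rightarrow> nat \<times> complex mat) \<Rightarrow> bool" where
  "quantum_schnorr_test S \<longleftrightarrow> strong_solovay_test S \<and> computable_real (\<Sum>m. tau_meas (S m))"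

definition fails_at_level :: "(nat \<Rightarrow> complex mat) \<Rightarrow> (nat \<Rightarrow> nat \<times> complex mat) \<Rightarrow> real \<Rightarrow> bool" where
  "fails_at_level \<rho> S \<epsilon> \<longleftrightarrow> infinite {m. rho_meas \<rho> (S m) > \<epsilon>}"

definition passes_test :: "(nat \<Rightarrow> complex mat) \<Rightarrow> (nat \<Rightarrow> nat \<times> complex mat) \<Rightarrow> bool" where
  "passes_test \<rho> S \<longleftrightarrow> \<not> (\<exists>\<epsilon>>0. fails_at_level \<rho> S \<epsilon>)"

definition q_schnorr_random :: "(nat \<Rightarrow> complex mat) \<Rightarrow> bool" where
  "q_schnorr_random \<rho> \<longleftrightarrow> (\<forall>S. quantum_schnorr_test S \<longrightarrow> passes_test \<rho> S)"

end

theory Submission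
  imports Defs
begin

text \<open>
  A special projection is the sum of \<open>v v\<^sup>*\<close> over an orthonormal family of algebraic vectors, whose
  size is its trace, and conversely. So a family \<open>F\<close> in dimension \<open>2\<^sup>n\<close> described by a word \<open>\<pi>\<close> with
  \<open>|\<pi>| + log |F| \<le> n + d\<close> is a projection with \<open>\<tau>(S) \<le> 2\<^sup>d 2\<^sup>-\<^sup>|\<^sup>\<pi>\<^sup>|\<close>, and the projections read off the
  domain of a machine have computable total weight because they are dominated by the domain measure.
  Conversely, given a test, word lengths about \<open>- log \<tau>(S\<^sup>m)\<close> satisfy the Kraft inequality up to a
  constant, and since the weights have a computable sum the requests of each length form a computable finite
  set, so words can be assigned by increasing length.

  Effectiveness rests on one decision procedure: whether \<open>\<Sum> a\<^sub>i cnj b\<^sub>i = 0\<close> for coded algebraic numbers.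
  Such a sum, scaled to be an algebraic integer, is an eigenvalue of an integer matrix with bounded row sums, so
  it is zero or bounded below by a computable quantity, and rational approximation decides.
  The roots of an integer polynomial are approximated on a grid fine enough for the same bound to settle
  their lexicographic order.
\<close>

section \<open>Total recursive functions\<close>

\<comment> \<open>Apart from the zero test for coded sums, hardly any algorithm is built by hand.
  Whenever a frame or a matrix code has to be a computable function of an index, its existence is
  proved classically, its correctness is a finite conjunction of decidable identities, and unbounded
  search does the rest. Programs stay fixed throughout, so one semidecision procedure per program
  takes the place of a universal machine.

  The constants come from a few sources of slack. A bound \<open>n + d\<close> on an infimum is
  weakened to the strict bound \<open>n + d + 1\<close> for one program, and exponentiation turns
  this into an inequality between natural numbers. Rounding \<open>- log\<close> of a weight to a
  length costs 1. The weights of a test may sum to more than 1, so all word lengths are shifted by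
  some \<open>d0\<close> with the sum at most \<open>2 ^ d0\<close>. Zero projections get no word;
  conversely, programs with useless output contribute the zero projection.

  Outputs are sets, but codes list vectors: one vector may occur under several codes. Cardinalities
  are therefore read off only after the zero test has removed repetitions.\<close>
inductive_simps evalr_Zero: "evalr Zero xs y"
inductive_simps evalr_Succ: "evalr Succ xs y"
inductive_simps evalr_Proj: "evalr (Proj i) xs y"
inductive_simps evalr_Comp: "evalr (Comp f gs) xs y"
inductive_simps evalr_Prec_0: "evalr (Prec f g) (0 # xs) y"
inductive_simps evalr_Prec_Suc: "evalr (Prec f g) (Suc n # xs) y"
inductive_simps evalr_Prec_Nil: "evalr (Prec f g) [] y"
inductive_simps evalr_Mn: "evalr (Mn f) xs y"

text \<open>The equivalence packs termination and single-valuedness into one condition, so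
  determinism of \<open>evalr\<close> is never proved separately. The length of the argument list is
  fixed because \<open>evalr\<close> relates lists of any length.\<close>

definition computes :: "nat \<Rightarrow> recf \<Rightarrow> (nat list \<Rightarrow> nat) \<Rightarrow> bool" where
  "computes n r F \<longleftrightarrow> (\<forall>xs y. length xs = n \<longrightarrow> (evalr r xs y \<longleftrightarrow> y = F xs))"

definition total_rec :: "nat \<Rightarrow> (nat list \<Rightarrow> nat) \<Rightarrow> bool" where
  "total_rec n F \<longleftrightarrow> (\<exists>r. computes n r F)"

lemma total_rec_cong:
  assumes "total_rec n F" "\<And>xs. length xs = n \<Longrightarrow> F xs = G xs"
  shows "total_rec n G"
  using assms unfolding total_rec_def computes_def by metis

lemma total_rec_zero: "total_rec n (\<lambda>xs. 0)"
  unfolding total_rec_def computes_def by (intro exI[of _ Zero]) (auto simp: evalr_Zero)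

lemma total_rec_nth: "i < n \<Longrightarrow> total_rec n (\<lambda>xs. xs ! i)"
  unfolding total_rec_def computes_def by (intro exI[of _ "Proj i"]) (auto simp: evalr_Proj)

lemma computes_Comp:
  assumes f: "computes (length gs) f F"
    and g: "\<And>i. i < length gs \<Longrightarrow> computes n (gs ! i) (G i)"
  shows "computes n (Comp f gs) (\<lambda>xs. F (map (\<lambda>i. G i xs) [0..<length gs]))"
  unfolding computes_def
proof (intro allI impI iffI)
  fix xs z assume n: "length xs = n" and "evalr (Comp f gs) xs z"
  then obtain ys where ys: "length gs = length ys" "\<forall>i<length gs. evalr (gs ! i) xs (ys ! i)"
    "evalr f ys z"
    unfolding evalr_Comp by blast
  have "ys = map (\<lambda>i. G i xs) [0..<length gs]"
    by (rule nth_equalityI) (use ys g n in \<open>auto simp: computes_def\<close>)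
  then show "z = F (map (\<lambda>i. G i xs) [0..<length gs])"
    using f ys unfolding computes_def by simp
next
  fix xs z assume n: "length xs = n" and z: "z = F (map (\<lambda>i. G i xs) [0..<length gs])"
  let ?ys = "map (\<lambda>i. G i xs) [0..<length gs]"
  have "evalr f ?ys z"
    using f z unfolding computes_def by simp
  moreover have "\<forall>i<length gs. evalr (gs ! i) xs (?ys ! i)"
    using g n by (simp add: computes_def)
  moreover have "length gs = length ?ys" by simp
  ultimately show "evalr (Comp f gs) xs z"
    unfolding evalr_Comp by blast
qed

lemma total_rec_comp1:
  assumes "total_rec 1 (\<lambda>xs. f (xs ! 0))" "total_rec n G"
  shows "total_rec n (\<lambda>xs. f (G xs))"
proof -
  from assms obtain r s where "computes 1 r (\<lambda>xs. f (xs ! 0))" "computes n s G"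
    unfolding total_rec_def by blast
  then have "computes n (Comp r [s]) (\<lambda>xs. f (G xs))"
    using computes_Comp[of "[s]" r "\<lambda>xs. f (xs ! 0)" n "\<lambda>_. G"] by simp
  then show ?thesis unfolding total_rec_def by blast
qed

lemma total_rec_comp2:
  assumes "total_rec 2 (\<lambda>xs. f (xs ! 0) (xs ! 1))" "total_rec n G" "total_rec n H"
  shows "total_rec n (\<lambda>xs. f (G xs) (H xs))"
proof -
  from assms obtain r s t where "computes 2 r (\<lambda>xs. f (xs ! 0) (xs ! 1))"
    "computes n s G" "computes n t H"
    unfolding total_rec_def by blast
  moreover from this have "computes n ([s, t] ! i) (if i = 0 then G else H)" if "i < length [s, t]" for i
    using that by (auto simp: less_Suc_eq)
  ultimately have "computes n (Comp r [s, t]) (\<lambda>xs. f (G xs) (H xs))"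
    using computes_Comp[of "[s, t]" r "\<lambda>xs. f (xs ! 0) (xs ! 1)" n "\<lambda>i. if i = 0 then G else H"]
    by (simp add: numeral_2_eq_2)
  then show ?thesis unfolding total_rec_def by blast
qed

lemma total_rec_Suc:
  assumes "total_rec n F"
  shows "total_rec n (\<lambda>xs. Suc (F xs))"
proof (rule total_rec_comp1[OF _ assms])
  have "evalr Succ xs y \<longleftrightarrow> y = Suc (xs ! 0)" if "length xs = 1" for xs y
    using that by (cases xs) (auto simp: evalr_Succ)
  then show "total_rec 1 (\<lambda>xs. Suc (xs ! 0))"
    unfolding total_rec_def computes_def by blast
qed

lemma total_rec_const: "total_rec n (\<lambda>xs. c)"
  by (induction c) (auto intro: total_rec_zero total_rec_Suc)

lemma total_rec_rec_nat:
  assumes "total_rec n F" "total_rec (Suc (Suc n)) G"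
  shows "total_rec (Suc n) (\<lambda>xs. rec_nat (F (tl xs)) (\<lambda>m y. G (y # m # tl xs)) (hd xs))"
proof -
  from assms obtain f g where f: "computes n f F" and g: "computes (Suc (Suc n)) g G"
    unfolding total_rec_def by blast
  have "evalr (Prec f g) (k # xs) y \<longleftrightarrow> y = rec_nat (F xs) (\<lambda>m y. G (y # m # xs)) k"
    if "length xs = n" for k xs y
    using that
  proof (induction k arbitrary: y)
    case 0
    then show ?case using f by (simp add: evalr_Prec_0 computes_def)
  next
    case (Suc k)
    then show ?case using g by (auto simp: evalr_Prec_Suc computes_def)
  qed
  then have "computes (Suc n) (Prec f g)
      (\<lambda>xs. rec_nat (F (tl xs)) (\<lambda>m y. G (y # m # tl xs)) (hd xs))"
    unfolding computes_def by (auto simp: length_Suc_conv)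
  then show ?thesis unfolding total_rec_def by blast
qed

lemma total_rec_Least:
  assumes "total_rec (Suc n) F" and ex: "\<And>xs. length xs = n \<Longrightarrow> \<exists>m. F (m # xs) = 0"
  shows "total_rec n (\<lambda>xs. LEAST m. F (m # xs) = 0)"
proof -
  from assms obtain f where f: "computes (Suc n) f F"
    unfolding total_rec_def by blast
  have "evalr (Mn f) xs y \<longleftrightarrow> y = (LEAST m. F (m # xs) = 0)" if "length xs = n" for xs y
  proof -
    have "evalr (Mn f) xs y \<longleftrightarrow> F (y # xs) = 0 \<and> (\<forall>m<y. F (m # xs) \<noteq> 0)"
      using f that by (auto simp: evalr_Mn computes_def)
    also have "\<dots> \<longleftrightarrow> y = (LEAST m. F (m # xs) = 0)"
    proof
      assume "F (y # xs) = 0 \<and> (\<forall>m<y. F (m # xs) \<noteq> 0)"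
      then show "y = (LEAST m. F (m # xs) = 0)"
        by (intro Least_equality[symmetric]) (auto simp: not_less[symmetric])
    next
      assume "y = (LEAST m. F (m # xs) = 0)"
      then show "F (y # xs) = 0 \<and> (\<forall>m<y. F (m # xs) \<noteq> 0)"
        using LeastI_ex[OF ex[OF that]] not_less_Least by blast
    qed
    finally show ?thesis .
  qed
  then show ?thesis unfolding total_rec_def computes_def by blast
qed

lemma total_rec_rec2:
  assumes "total_rec 1 (\<lambda>xs. f (xs ! 0))" "total_rec 3 (\<lambda>xs. g (xs ! 0) (xs ! 1) (xs ! 2))"
  shows "total_rec 2 (\<lambda>xs. rec_nat (f (xs ! 1)) (\<lambda>m y. g y m (xs ! 1)) (xs ! 0))"
proof -
  have "total_rec (Suc 1) (\<lambda>xs. rec_nat (f (tl xs ! 0))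
      (\<lambda>m y. g ((y # m # tl xs) ! 0) ((y # m # tl xs) ! 1) ((y # m # tl xs) ! 2)) (hd xs))"
    by (rule total_rec_rec_nat) (use assms in \<open>simp_all add: numeral_3_eq_3\<close>)
  then show ?thesis
    unfolding numeral_2_eq_2 One_nat_def[symmetric]
    by (rule total_rec_cong) (auto simp: length_Suc_conv)
qed

section \<open>Arithmetic and pairing as total recursive functions\<close>

lemma total_rec_add: "total_rec n F \<Longrightarrow> total_rec n G \<Longrightarrow> total_rec n (\<lambda>xs. F xs + G xs)"
proof (rule total_rec_comp2[where f = "(+)"])
  have "total_rec 2 (\<lambda>xs. rec_nat (xs ! 1) (\<lambda>m y. Suc y) (xs ! 0))"
    by (rule total_rec_rec2) (intro total_rec_Suc total_rec_nth; simp)+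
  moreover have "rec_nat a (\<lambda>m y. Suc y) b = b + a" for a b :: nat
    by (induction b) auto
  ultimately show "total_rec 2 (\<lambda>xs. xs ! 0 + xs ! 1)" by simp
qed

lemma total_rec_pred: "total_rec n F \<Longrightarrow> total_rec n (\<lambda>xs. F xs - 1)"
proof (rule total_rec_comp1[where f = "\<lambda>x. x - 1"])
  have "total_rec 2 (\<lambda>xs. rec_nat 0 (\<lambda>m y. m) (xs ! 0))"
    by (rule total_rec_rec2[of "\<lambda>_. 0"]) (intro total_rec_zero total_rec_nth; simp)+
  moreover have "rec_nat 0 (\<lambda>m y. m) b = b - 1" for b :: nat
    by (cases b) auto
  ultimately have "total_rec 2 (\<lambda>xs. xs ! 0 - 1)" by simp
  then show "total_rec 1 (\<lambda>xs. xs ! 0 - 1)"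
    by (rule total_rec_comp2[where f = "\<lambda>x y. x - 1" and H = "\<lambda>xs. 0"]) (intro total_rec_zero total_rec_nth; simp)+
qed

lemma total_rec_diff: "total_rec n F \<Longrightarrow> total_rec n G \<Longrightarrow> total_rec n (\<lambda>xs. F xs - G xs)"
proof (rule total_rec_comp2[where f = "(-)"])
  have "total_rec 2 (\<lambda>xs. rec_nat (xs ! 1) (\<lambda>m y. y - 1) (xs ! 0))"
    by (rule total_rec_rec2) (intro total_rec_pred total_rec_nth; simp)+
  moreover have "rec_nat a (\<lambda>m y. y - 1) b = a - b" for a b :: nat
    by (induction b) auto
  ultimately have "total_rec 2 (\<lambda>xs. xs ! 1 - xs ! 0)" by simp
  then show "total_rec 2 (\<lambda>xs. xs ! 0 - xs ! 1)"
    by (rule total_rec_comp2[where f = "\<lambda>x y. y - x"]) (intro total_rec_nth; simp)+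
qed

lemma total_rec_triangle: "total_rec n F \<Longrightarrow> total_rec n (\<lambda>xs. triangle (F xs))"
proof (rule total_rec_comp1[where f = triangle])
  have "total_rec 2 (\<lambda>xs. rec_nat 0 (\<lambda>m y. y + Suc m) (xs ! 0))"
    by (rule total_rec_rec2[of "\<lambda>_. 0"])
      (intro total_rec_zero total_rec_add total_rec_Suc total_rec_nth; simp)+
  moreover have "rec_nat 0 (\<lambda>m y. y + Suc m) b = triangle b" for b :: nat
    by (induction b) auto
  ultimately have "total_rec 2 (\<lambda>xs. triangle (xs ! 0))" by simp
  then show "total_rec 1 (\<lambda>xs. triangle (xs ! 0))"
    by (rule total_rec_comp2[where f = "\<lambda>x y. triangle x" and H = "\<lambda>xs. 0"]) (intro total_rec_zero total_rec_nth; simp)+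
qed

lemma total_rec_prod_encode:
  "total_rec n F \<Longrightarrow> total_rec n G \<Longrightarrow> total_rec n (\<lambda>xs. prod_encode (F xs, G xs))"
  unfolding prod_encode_def split by (intro total_rec_add total_rec_triangle)

text \<open>The code of \<open>(a, b)\<close> lies between \<open>triangle (a + b)\<close> and
  \<open>triangle (Suc (a + b))\<close>, the upper end excluded. So the least \<open>s\<close> with
  the code below \<open>triangle (Suc s)\<close> is the sum of the components; this is how pairing
  is inverted by minimisation.\<close>

lemma Least_triangle: "(LEAST s. Suc (prod_encode (a, b)) - triangle (Suc s) = 0) = a + b"
proof (rule Least_equality)
  fix s assume s: "Suc (prod_encode (a, b)) - triangle (Suc s) = 0"
  show "a + b \<le> s"
  proof (rule ccontr)
    have mono: "triangle i \<le> triangle j" if "i \<le> j" for i j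
      using that by (induction j rule: dec_induct) auto
    assume "\<not> a + b \<le> s"
    then have "triangle (Suc s) \<le> triangle (a + b)" by (intro mono) auto
    with s show False by (simp add: prod_encode_def)
  qed
qed (simp add: prod_encode_def)

lemma total_rec_prod_decode:
  assumes "total_rec n F"
  shows "total_rec n (\<lambda>xs. fst (prod_decode (F xs)))" "total_rec n (\<lambda>xs. snd (prod_decode (F xs)))"
proof -
  let ?S = "\<lambda>x. LEAST s. Suc x - triangle (Suc s) = 0"
  have S: "?S x = fst (prod_decode x) + snd (prod_decode x)" for x
    using Least_triangle[of "fst (prod_decode x)" "snd (prod_decode x)"] by simp
  have "total_rec (Suc 1) (\<lambda>xs. Suc (xs ! 1) - triangle (Suc (xs ! 0)))"
    by (intro total_rec_diff total_rec_Suc total_rec_nth total_rec_triangle) auto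
  then have "total_rec 1 (\<lambda>xs. LEAST m. Suc ((m # xs) ! 1) - triangle (Suc ((m # xs) ! 0)) = 0)"
  proof (rule total_rec_Least)
    fix xs :: "nat list"
    have "Suc n \<le> triangle (Suc n)" for n by (induction n) auto
    then show "\<exists>m. Suc ((m # xs) ! 1) - triangle (Suc ((m # xs) ! 0)) = 0"
      by (intro exI[of _ "xs ! 0"]) (simp del: triangle_Suc)
  qed
  then have T: "total_rec 1 (\<lambda>xs. ?S (xs ! 0))"
    by simp
  have F: "fst (prod_decode x) = x - triangle (?S x)" for x
  proof -
    have "prod_encode (a, b) - triangle (a + b) = a" for a b by (simp add: prod_encode_def)
    from this[of "fst (prod_decode x)" "snd (prod_decode x)"] show ?thesis unfolding S by simp
  qed
  have "total_rec 1 (\<lambda>xs. fst (prod_decode (xs ! 0)))"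
    unfolding F by (intro total_rec_diff total_rec_triangle T total_rec_nth) auto
  then show fst: "total_rec n (\<lambda>xs. fst (prod_decode (F xs)))"
    using assms by (rule total_rec_comp1)
  have "snd (prod_decode x) = ?S x - fst (prod_decode x)" for x
    unfolding S by simp
  then have "total_rec n (\<lambda>xs. ?S (F xs) - fst (prod_decode (F xs)))"
    by (intro total_rec_diff fst total_rec_comp1[OF T assms])
  then show "total_rec n (\<lambda>xs. snd (prod_decode (F xs)))"
    unfolding S by simp
qed

lemma computable_fun_iff_total_rec: "computable_fun g \<longleftrightarrow> total_rec 1 (\<lambda>xs. g (xs ! 0))"
proof -
  have "computes 1 f F \<longleftrightarrow> (\<forall>x y. evalr f [x] y \<longleftrightarrow> F [x] = y)" for f F
  proof
    assume "computes 1 f F"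
    then show "\<forall>x y. evalr f [x] y \<longleftrightarrow> F [x] = y" by (auto simp: computes_def)
  next
    assume *: "\<forall>x y. evalr f [x] y \<longleftrightarrow> F [x] = y"
    show "computes 1 f F"
      unfolding computes_def
    proof (intro allI impI)
      fix xs :: "nat list" and y assume "length xs = 1"
      then obtain x where "xs = [x]" by (cases xs) auto
      with * show "evalr f xs y \<longleftrightarrow> y = F xs" by auto
    qed
  qed
  then show ?thesis unfolding computable_fun_def total_rec_def by simp
qed

lemma computable_fun_total_rec:
  "computable_fun g \<Longrightarrow> total_rec n F \<Longrightarrow> total_rec n (\<lambda>xs. g (F xs))"
  unfolding computable_fun_iff_total_rec by (rule total_rec_comp1[of g n F])

lemma computable_fun_id: "computable_fun (\<lambda>x. x)"
  unfolding computable_fun_iff_total_rec by (rule total_rec_nth) simp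

lemma computable_fun_const: "computable_fun (\<lambda>x. c)"
  unfolding computable_fun_iff_total_rec by (rule total_rec_const)

lemma computable_fun_comp: "computable_fun f \<Longrightarrow> computable_fun g \<Longrightarrow> computable_fun (\<lambda>x. f (g x))"
  unfolding computable_fun_iff_total_rec by (rule total_rec_comp1[of f 1 "\<lambda>xs. g (xs ! 0)"])

lemma computable_fun_pair:
  "computable_fun f \<Longrightarrow> computable_fun g \<Longrightarrow> computable_fun (\<lambda>x. prod_encode (f x, g x))"
  unfolding computable_fun_iff_total_rec by (rule total_rec_prod_encode)

lemma computable_fun_fst: "computable_fun (\<lambda>x. fst (prod_decode x))"
  and computable_fun_snd: "computable_fun (\<lambda>x. snd (prod_decode x))"
  unfolding computable_fun_iff_total_rec by (intro total_rec_prod_decode total_rec_nth; simp)+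

lemma computable_fun_Suc: "computable_fun Suc"
  unfolding computable_fun_iff_total_rec by (intro total_rec_Suc total_rec_nth) simp

lemma computable_fun_rec:
  assumes f: "computable_fun f" and g: "computable_fun g" and n: "computable_fun n"
  shows "computable_fun
    (\<lambda>x. rec_nat (f x) (\<lambda>m y. g (prod_encode (x, prod_encode (m, y)))) (n x))"
proof -
  define R where "R k x = rec_nat (f x) (\<lambda>m y. g (prod_encode (x, prod_encode (m, y)))) k" for k x
  have nth: "total_rec 3 (\<lambda>xs. xs ! 0)" "total_rec 3 (\<lambda>xs. xs ! 1)" "total_rec 3 (\<lambda>xs. xs ! 2)"
    by (rule total_rec_nth; simp)+
  have "total_rec 2 (\<lambda>xs. R (xs ! 0) (xs ! 1))"
    unfolding R_def
    by (rule total_rec_rec2[where f = f and g = "\<lambda>y m x. g (prod_encode (x, prod_encode (m, y)))"])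
      (use f in \<open>simp add: computable_fun_iff_total_rec\<close>,
       intro computable_fun_total_rec[OF g] total_rec_prod_encode nth)
  moreover have "total_rec 1 (\<lambda>xs. n (xs ! 0))" "total_rec 1 (\<lambda>xs. xs ! 0)"
    using n by (simp_all add: computable_fun_iff_total_rec total_rec_nth)
  ultimately have "total_rec 1 (\<lambda>xs. R (n (xs ! 0)) (xs ! 0))"
    by (rule total_rec_comp2[where f = R])
  then show ?thesis unfolding computable_fun_iff_total_rec R_def .
qed

lemma computable_fun_Least:
  assumes g: "computable_fun g" and ex: "\<And>x. \<exists>m. g (prod_encode (x, m)) = 0"
  shows "computable_fun (\<lambda>x. LEAST m. g (prod_encode (x, m)) = 0)"
proof -
  have "total_rec (Suc 1) (\<lambda>xs. g (prod_encode (xs ! 1, xs ! 0)))"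
    by (intro computable_fun_total_rec[OF g] total_rec_prod_encode total_rec_nth) simp_all
  then have "total_rec 1 (\<lambda>xs. LEAST m. g (prod_encode ((m # xs) ! 1, (m # xs) ! 0)) = 0)"
    by (rule total_rec_Least) (use ex in simp)
  then show ?thesis unfolding computable_fun_iff_total_rec by simp
qed

section \<open>Computable functions between coded types\<close>

text \<open>Only injectivity is asked for, which admits types such as \<open>bool\<close> and
  \<open>rat\<close> whose codes do not exhaust the natural numbers. The realiser in
  \<open>computable\<close> is unconstrained off the codes.\<close>

class coded =
  fixes enc :: "'a \<Rightarrow> nat"
  assumes enc_inject: "enc x = enc y \<Longrightarrow> x = y"

lemma enc_eq_iff [simp]: "enc x = enc y \<longleftrightarrow> x = y"
  using enc_inject by blast

instantiation nat :: coded
begin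
definition enc_nat :: "nat \<Rightarrow> nat" where [simp]: "enc_nat x = x"
instance by standard simp
end

instantiation bool :: coded
begin
definition enc_bool :: "bool \<Rightarrow> nat" where "enc_bool b = (if b then 1 else 0)"
instance by standard (simp add: enc_bool_def split: if_splits)
end

instantiation int :: coded
begin
definition enc_int :: "int \<Rightarrow> nat" where "enc_int = int_encode"
instance by standard (simp add: enc_int_def int_encode_eq)
end

instantiation prod :: (coded, coded) coded
begin
definition enc_prod :: "'a \<times> 'b \<Rightarrow> nat" where
  "enc_prod p = prod_encode (enc (fst p), enc (snd p))"
instance by standard (auto simp: enc_prod_def prod_eq_iff)
end

instantiation list :: (coded) coded
begin
definition enc_list :: "'a list \<Rightarrow> nat" where "enc_list xs = list_encode (map enc xs)"
instance by standard (auto simp: enc_list_def list_encode_eq inj_map_eq_map inj_def)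
end

definition computable :: "('a::coded \<Rightarrow> 'b::coded) \<Rightarrow> bool" where
  "computable f \<longleftrightarrow> (\<exists>g. computable_fun g \<and> (\<forall>x. g (enc x) = enc (f x)))"

lemma computable_nat_iff: "computable (f :: nat \<Rightarrow> nat) \<longleftrightarrow> computable_fun f"
proof
  assume "computable f"
  then obtain g where "computable_fun g" "\<forall>x. g x = f x" unfolding computable_def by auto
  then show "computable_fun f" by (metis ext)
qed (auto simp: computable_def)

named_theorems computable_intros

lemma computable_id [computable_intros]: "computable (\<lambda>x. x)"
  unfolding computable_def using computable_fun_id by blast

lemma computable_const [computable_intros]: "computable (\<lambda>x. c)"
  unfolding computable_def using computable_fun_const by blast

lemma computable_compose: "computable f \<Longrightarrow> computable g \<Longrightarrow> computable (\<lambda>x. f (g x))"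
  unfolding computable_def using computable_fun_comp by metis

lemma computable_Pair [computable_intros]:
  assumes "computable f" "computable g"
  shows "computable (\<lambda>x. (f x, g x))"
proof -
  from assms obtain f' g' where "computable_fun f'" "\<And>x. f' (enc x) = enc (f x)"
    "computable_fun g'" "\<And>x. g' (enc x) = enc (g x)" unfolding computable_def by blast
  then show ?thesis unfolding computable_def
    by (intro exI[of _ "\<lambda>x. prod_encode (f' x, g' x)"]) (auto intro: computable_fun_pair simp: enc_prod_def)
qed

lemma computable_fst [computable_intros]: "computable f \<Longrightarrow> computable (\<lambda>x. fst (f x))"
proof (erule computable_compose[rotated])
  show "computable (fst :: 'b \<times> 'c \<Rightarrow> 'b)" unfolding computable_def
    by (intro exI[of _ "\<lambda>x. fst (prod_decode x)"]) (auto simp: computable_fun_fst enc_prod_def)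
qed

lemma computable_snd [computable_intros]: "computable f \<Longrightarrow> computable (\<lambda>x. snd (f x))"
proof (erule computable_compose[rotated])
  show "computable (snd :: 'b \<times> 'c \<Rightarrow> 'c)" unfolding computable_def
    by (intro exI[of _ "\<lambda>x. snd (prod_decode x)"]) (auto simp: computable_fun_snd enc_prod_def)
qed

lemma computable_compose2:
  "computable (\<lambda>p. f (fst p) (snd p)) \<Longrightarrow> computable g \<Longrightarrow> computable h \<Longrightarrow> computable (\<lambda>x. f (g x) (h x))"
  using computable_compose[of "\<lambda>p. f (fst p) (snd p)" "\<lambda>x. (g x, h x)"] by (simp add: computable_Pair)

lemma computable_compose3:
  "computable (\<lambda>p. f (fst p) (fst (snd p)) (snd (snd p))) \<Longrightarrow> computable g \<Longrightarrow> computable h \<Longrightarrow> computable k \<Longrightarrow>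
    computable (\<lambda>x. f (g x) (h x) (k x))"
  using computable_compose[of "\<lambda>p. f (fst p) (fst (snd p)) (snd (snd p))" "\<lambda>x. (g x, h x, k x)"]
  by (simp add: computable_Pair)

text \<open>Computability sees only the codes of the values. A function may therefore be exchanged
  for one into another type with the same codes, which makes \<open>enc\<close> and the decoding
  functions computable at once and lets arithmetic on codes define functions on coded types.\<close>

lemma computable_enc_cong:
  assumes "computable f" "\<And>x. enc (f x) = enc (g x)"
  shows "computable g"
  using assms unfolding computable_def by auto

lemma computable_enc: "computable f \<Longrightarrow> computable (\<lambda>x. enc (f x))"
  by (erule computable_enc_cong) simp

lemma computable_rec_nat [computable_intros]:
  assumes f: "computable f" and g: "computable (\<lambda>p. g (fst p) (fst (snd p)) (snd (snd p)))" and n: "computable n"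
  shows "computable (\<lambda>x. rec_nat (f x) (\<lambda>m y. g x m y) (n x))"
proof -
  from f obtain f' where f': "computable_fun f'" "\<And>x. f' (enc x) = enc (f x)" unfolding computable_def by blast
  from g obtain g' where g': "computable_fun g'"
    "\<And>p. g' (enc p) = enc (g (fst p) (fst (snd p)) (snd (snd p)))" unfolding computable_def by blast
  from n obtain n' where n': "computable_fun n'" "\<And>x. n' (enc x) = enc (n x)" unfolding computable_def by blast
  have "rec_nat (f' (enc x)) (\<lambda>m y. g' (prod_encode (enc x, prod_encode (m, y)))) k
      = enc (rec_nat (f x) (\<lambda>m y. g x m y) k)" for x k
  proof (induction k)
    case (Suc k)
    then show ?case using g'(2)[of "(x, k, rec_nat (f x) (\<lambda>m y. g x m y) k)"]
      by (simp add: enc_prod_def)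
  qed (simp add: f')
  then show ?thesis
    unfolding computable_def
    by (intro exI[of _ "\<lambda>x. rec_nat (f' x) (\<lambda>m y. g' (prod_encode (x, prod_encode (m, y)))) (n' x)"])
      (auto intro!: computable_fun_rec f' g' n' simp: n')
qed

lemma computable_Suc [computable_intros]: "computable f \<Longrightarrow> computable (\<lambda>x. Suc (f x))"
  by (erule computable_compose[rotated]) (simp add: computable_nat_iff computable_fun_Suc)

lemma computable_if [computable_intros]:
  assumes "computable b" "computable f" "computable g"
  shows "computable (\<lambda>x. if b x then f x else g x)"
proof -
  have "computable (\<lambda>x. enc (b x))" using assms(1) by (rule computable_enc)
  \<comment> \<open>The condition has code 0 or 1, so the recursion makes at most one step, and that
    step discards \<open>g x\<close>.\<close>
  then have "computable (\<lambda>x. rec_nat (g x) (\<lambda>m y. f x) (enc (b x)))"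
    by (intro computable_intros assms computable_compose[OF assms(2)])
  then show ?thesis
    by (rule computable_enc_cong) (simp add: enc_bool_def)
qed

section \<open>Connectives, arithmetic of natural numbers and bounded quantifiers\<close>

lemma computable_conj [computable_intros]: "computable P \<Longrightarrow> computable Q \<Longrightarrow> computable (\<lambda>x. P x \<and> Q x)"
  by (rule computable_enc_cong[OF computable_if[of P Q "\<lambda>_. False"]]) (auto intro: computable_const)

lemma computable_not [computable_intros]: "computable P \<Longrightarrow> computable (\<lambda>x. \<not> P x)"
  using computable_if[of P "\<lambda>_. False" "\<lambda>_. True"] by (simp add: computable_const if_bool_eq_conj)

lemma computable_disj [computable_intros]: "computable P \<Longrightarrow> computable Q \<Longrightarrow> computable (\<lambda>x. P x \<or> Q x)"
  by (rule computable_enc_cong[OF computable_if[of P "\<lambda>_. True" Q]]) (auto intro: computable_const)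

lemma computable_imp [computable_intros]: "computable P \<Longrightarrow> computable Q \<Longrightarrow> computable (\<lambda>x. P x \<longrightarrow> Q x)"
  using computable_if[of P Q "\<lambda>_. True"] by (simp add: computable_const if_bool_eq_conj)

lemma computable_add_nat [computable_intros]: "computable f \<Longrightarrow> computable g \<Longrightarrow> computable (\<lambda>x. f x + g x :: nat)"
proof (rule computable_compose2[where f = "(+)"])
  have "computable (\<lambda>p::nat \<times> nat. rec_nat (snd p) (\<lambda>m y. Suc y) (fst p))"
    by (intro computable_intros)
  moreover have "rec_nat a (\<lambda>m y. Suc y) b = b + a" for a b :: nat by (induction b) auto
  ultimately show "computable (\<lambda>p::nat \<times> nat. fst p + snd p)" by simp
qed

lemma computable_mult_nat [computable_intros]: "computable f \<Longrightarrow> computable g \<Longrightarrow> computable (\<lambda>x. f x * g x :: nat)"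
proof (rule computable_compose2[where f = "(*)"])
  have "computable (\<lambda>p::nat \<times> nat. rec_nat 0 (\<lambda>m y. y + snd p) (fst p))"
    by (intro computable_intros)
  moreover have "rec_nat 0 (\<lambda>m y. y + a) b = b * a" for a b :: nat by (induction b) auto
  ultimately show "computable (\<lambda>p::nat \<times> nat. fst p * snd p)" by simp
qed

lemma computable_diff_nat [computable_intros]: "computable f \<Longrightarrow> computable g \<Longrightarrow> computable (\<lambda>x. f x - g x :: nat)"
proof (rule computable_compose2[where f = "(-)"])
  have "computable (\<lambda>p::nat \<times> nat. rec_nat (fst p) (\<lambda>m y. rec_nat 0 (\<lambda>i z. i) y) (snd p))"
    by (intro computable_intros)
  moreover have "rec_nat 0 (\<lambda>i z. i) y = y - 1" for y :: nat by (cases y) auto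
  moreover have "rec_nat a (\<lambda>m y. y - 1) b = a - b" for a b :: nat by (induction b) auto
  ultimately show "computable (\<lambda>p::nat \<times> nat. fst p - snd p)" by simp
qed

lemma computable_eq_0 [computable_intros]:
  assumes "computable f"
  shows "computable (\<lambda>x. f x = (0::nat))"
proof -
  have "computable (\<lambda>x. rec_nat True (\<lambda>i z. False) (f x))" by (intro computable_intros assms)
  moreover have "rec_nat True (\<lambda>i z. False) n = (n = 0)" for n by (cases n) auto
  ultimately show ?thesis by simp
qed

lemma computable_le_nat [computable_intros]: "computable f \<Longrightarrow> computable g \<Longrightarrow> computable (\<lambda>x. f x \<le> (g x :: nat))"
  using computable_eq_0[of "\<lambda>x. f x - g x"] by (simp add: computable_diff_nat)

lemma computable_less_nat [computable_intros]: "computable f \<Longrightarrow> computable g \<Longrightarrow> computable (\<lambda>x. f x < (g x :: nat))"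
  using computable_le_nat[of "\<lambda>x. Suc (f x)" g] by (simp add: computable_Suc Suc_le_eq)

lemma computable_eq [computable_intros]:
  assumes "computable f" "computable g"
  shows "computable (\<lambda>x. f x = g x)"
proof -
  have "computable (\<lambda>x. enc (f x) \<le> enc (g x) \<and> enc (g x) \<le> enc (f x))"
    by (intro computable_intros computable_enc assms)
  then show ?thesis by (simp add: order_eq_iff[symmetric])
qed

lemma computable_power_nat [computable_intros]: "computable f \<Longrightarrow> computable g \<Longrightarrow> computable (\<lambda>x. f x ^ g x :: nat)"
proof (rule computable_compose2[where f = "(^)"])
  have "computable (\<lambda>p::nat \<times> nat. rec_nat 1 (\<lambda>m y. fst p * y) (snd p))"
    by (intro computable_intros)
  moreover have "rec_nat 1 (\<lambda>m y. a * y) b = a ^ b" for a b :: nat by (induction b) auto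
  ultimately show "computable (\<lambda>p::nat \<times> nat. fst p ^ snd p)" by simp
qed

lemma computable_all_less [computable_intros]:
  fixes P :: "'a::coded \<Rightarrow> nat \<Rightarrow> bool"
  assumes "computable b" "computable (\<lambda>p. P (fst p) (snd p))"
  shows "computable (\<lambda>x. \<forall>i < b x. P x i)"
proof -
  have "computable (\<lambda>x. rec_nat True (\<lambda>m y. y \<and> P x m) (b x))"
    by (intro computable_intros assms(1) computable_compose2[OF assms(2)])
  moreover have "rec_nat True (\<lambda>m y. y \<and> P x m) n = (\<forall>i<n. P x i)" for x n
    by (induction n) (auto simp: less_Suc_eq)
  ultimately show ?thesis by simp
qed

lemma computable_ex_less [computable_intros]:
  fixes P :: "'a::coded \<Rightarrow> nat \<Rightarrow> bool"
  assumes "computable b" "computable (\<lambda>p. P (fst p) (snd p))"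
  shows "computable (\<lambda>x. \<exists>i < b x. P x i)"
  using computable_not[OF computable_all_less[OF assms(1) computable_not[OF assms(2)]]] by simp

text \<open>Minimisation gives a total recursive function only if the search ends on every number.
  When every number is a code, a search that succeeds for each object ends on every input.\<close>

class coded_onto = coded +
  assumes enc_onto: "\<exists>x. enc x = n"

instance nat :: coded_onto
  by standard simp

instance int :: coded_onto
  by standard (metis enc_int_def int_decode_inverse)

instance prod :: (coded_onto, coded_onto) coded_onto
proof
  fix n
  obtain a :: 'a and b :: 'b where "enc a = fst (prod_decode n)" "enc b = snd (prod_decode n)"
    using enc_onto by meson
  then show "\<exists>x::'a \<times> 'b. enc x = n"
    by (intro exI[of _ "(a, b)"]) (simp add: enc_prod_def)
qed

instance list :: (coded_onto) coded_onto
proof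
  fix n
  define d :: "nat \<Rightarrow> 'a" where "d n = (SOME x. enc x = n)" for n
  have "enc (d n) = n" for n
    unfolding d_def by (rule someI_ex) (rule enc_onto)
  then have "map enc (map d (list_decode n)) = list_decode n"
    by (simp add: o_def)
  then show "\<exists>x::'a list. enc x = n"
    unfolding enc_list_def by (intro exI[of _ "map d (list_decode n)"]) simp
qed

lemma computable_Least:
  fixes P :: "'a::coded_onto \<Rightarrow> nat \<Rightarrow> bool"
  assumes P: "computable (\<lambda>p. P (fst p) (snd p))" and ex: "\<And>x. \<exists>m. P x m"
  shows "computable (\<lambda>x. LEAST m. P x m)"
proof -
  have "computable (\<lambda>p. if P (fst p) (snd p) then 0 else 1 :: nat)"
    by (intro computable_intros P)
  then obtain g where g: "computable_fun g" "\<And>p. g (enc p) = enc (if P (fst p) (snd p) then 0 else 1 :: nat)"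
    unfolding computable_def by blast
  have *: "g (prod_encode (enc x, m)) = 0 \<longleftrightarrow> P x m" for x m
    using g(2)[of "(x, m)"] by (auto simp: enc_prod_def)
  have "\<exists>m. g (prod_encode (n, m)) = 0" for n
    using enc_onto[where 'a = 'a, of n] ex * by metis
  then have "computable_fun (\<lambda>n. LEAST m. g (prod_encode (n, m)) = 0)"
    by (intro computable_fun_Least g)
  then show ?thesis unfolding computable_def using * by auto
qed

text \<open>The form in which search is applied later: a decidable relation together with a
  classical proof of existence yields a computable choice of witnesses.\<close>

lemma computable_choice:
  fixes P :: "'a::coded_onto \<Rightarrow> nat \<Rightarrow> bool"
  assumes P: "computable (\<lambda>p. P (fst p) (snd p))" and ex: "\<And>x. \<exists>m. P x m"
  shows "\<exists>h. computable h \<and> (\<forall>x. P x (h x))"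
  using computable_Least[OF assms] LeastI_ex[OF ex] by auto

section \<open>Lists, integers and rational numbers\<close>

lemma computable_prod_decode [computable_intros]: "computable f \<Longrightarrow> computable (\<lambda>x. prod_decode (f x))"
  by (erule computable_enc_cong) (simp add: enc_prod_def)

lemma computable_list_decode [computable_intros]: "computable f \<Longrightarrow> computable (\<lambda>x. list_decode (f x))"
  by (erule computable_enc_cong) (simp add: enc_list_def enc_nat_def[abs_def])

lemma computable_int_decode [computable_intros]: "computable f \<Longrightarrow> computable (\<lambda>x. int_decode (f x))"
  by (erule computable_enc_cong) (simp add: enc_int_def)

lemma computable_funpow [computable_intros]:
  fixes F :: "'a::coded \<Rightarrow> 'b::coded \<Rightarrow> 'b"
  assumes "computable n" "computable (\<lambda>p. F (fst p) (snd p))" "computable s"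
  shows "computable (\<lambda>x. (F x ^^ n x) (s x))"
proof -
  have "computable (\<lambda>x. rec_nat (s x) (\<lambda>m y. F x y) (n x))"
    by (intro computable_intros assms computable_compose2[OF assms(2)])
  moreover have "rec_nat a (\<lambda>m y. f y) k = (f ^^ k) a" for a :: 'b and f k
    by (induction k) auto
  ultimately show ?thesis by simp
qed

section \<open>Computable operations on lists\<close>

lemma computable_Cons [computable_intros]:
  assumes "computable f" "computable g"
  shows "computable (\<lambda>x. f x # g x)"
proof -
  have "computable (\<lambda>x. Suc (enc (f x, g x)))" by (intro computable_intros computable_enc assms)
  then show ?thesis by (rule computable_enc_cong) (simp add: enc_list_def enc_prod_def)
qed

lemma computable_hd_dflt:
  assumes "computable f" "computable d"
  shows "computable (\<lambda>x. if f x = [] then d x else hd (f x))"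
proof -
  have "computable (\<lambda>x. if f x = [] then enc (d x) else fst (prod_decode (enc (f x) - 1)))"
    by (intro computable_intros computable_enc assms)
  then show ?thesis
    by (rule computable_enc_cong) (auto simp: enc_list_def neq_Nil_conv)
qed

lemma computable_tl [computable_intros]:
  assumes "computable f"
  shows "computable (\<lambda>x. tl (f x))"
proof -
  have "computable (\<lambda>x. if f x = [] then 0 else snd (prod_decode (enc (f x) - 1)))"
    by (intro computable_intros computable_enc assms)
  then show ?thesis
    by (rule computable_enc_cong) (auto simp: enc_list_def neq_Nil_conv)
qed

text \<open>Provides the number of iterations for folding: a step repeated as often as the code of
  the list says has consumed the whole list.\<close>

lemma length_le_list_encode: "length xs \<le> list_encode xs"
proof (induction xs)
  case (Cons a xs)
  then show ?case using le_prod_encode_2[of "list_encode xs" a] by simp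
qed simp

lemma computable_foldl [computable_intros]:
  assumes F: "computable (\<lambda>p. F (fst p) (fst (snd p)) (snd (snd p)))" and a: "computable a" and l: "computable l"
  shows "computable (\<lambda>x. foldl (\<lambda>b y. F x b y) (a x) (l x))"
proof -
  \<comment> \<open>The state holds the accumulator and the rest of the list. Once the rest is empty
    further steps change nothing, so any number of steps from the length onwards gives the
    fold.\<close>
  define step where "step x p = (if snd p = [] then p else (F x (fst p) (hd (snd p)), tl (snd p)))" for x p
  have iter: "(step x ^^ n) (a, l) = (foldl (F x) a l, [])" if "length l \<le> n" for x n a l
    using that
  proof (induction n arbitrary: a l)
    case (Suc n)
    show ?case
    proof (cases l)
      case Nil
      then show ?thesis using Suc.IH[of l a] by (simp add: step_def)
    next
      case (Cons y ys)
      then show ?thesis using Suc by (simp add: step_def funpow_Suc_right del: funpow.simps)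
    qed
  qed simp
  \<comment> \<open>\<open>hd\<close> is unspecified on the empty list, so computability is shown
    for a guarded head; the outer test hides the arbitrary default \<open>d\<close>.\<close>
  have "computable (\<lambda>q. if snd (snd q) = [] then snd q else
      (if snd (snd q) = [] then fst (snd q)
       else F (fst q) (fst (snd q)) (if snd (snd q) = [] then d else hd (snd (snd q))), tl (snd (snd q))))" for d
    by (intro computable_intros computable_hd_dflt computable_compose3[OF F])
  then have "computable (\<lambda>q. step (fst q) (snd q))"
    by (rule computable_enc_cong) (auto simp: step_def)
  then have "computable (\<lambda>x. fst ((step x ^^ enc (l x)) (a x, l x)))"
    by (intro computable_intros computable_enc a l)
  moreover have "length (l x) \<le> enc (l x)" for x
    using length_le_list_encode[of "map enc (l x)"] by (simp add: enc_list_def)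
  ultimately show ?thesis by (simp add: iter)
qed

lemma computable_rev [computable_intros]:
  assumes "computable l"
  shows "computable (\<lambda>x. rev (l x))"
proof -
  have "computable (\<lambda>x. foldl (\<lambda>b y. y # b) [] (l x))" by (intro computable_intros assms)
  moreover have "foldl (\<lambda>b y. y # b) acc l = rev l @ acc" for l acc :: "'b list"
    by (induction l arbitrary: acc) auto
  ultimately show ?thesis by simp
qed

lemma computable_foldr [computable_intros]:
  assumes F: "computable (\<lambda>p. F (fst p) (fst (snd p)) (snd (snd p)))" and a: "computable a" and l: "computable l"
  shows "computable (\<lambda>x. foldr (\<lambda>y b. F x y b) (l x) (a x))"
  unfolding foldr_conv_foldl by (intro computable_intros computable_compose3[OF F] a l)

lemma computable_append [computable_intros]:
  assumes "computable f" "computable g"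
  shows "computable (\<lambda>x. f x @ g x)"
proof -
  have "computable (\<lambda>x. foldr (#) (f x) (g x))" by (intro computable_intros assms)
  moreover have "foldr (#) xs ys = xs @ ys" for xs ys :: "'b list" by (induction xs) auto
  ultimately show ?thesis by simp
qed

lemma computable_length [computable_intros]:
  assumes "computable l"
  shows "computable (\<lambda>x. length (l x))"
proof -
  have "computable (\<lambda>x. foldr (\<lambda>y b. Suc b) (l x) 0)" by (intro computable_intros assms)
  moreover have "foldr (\<lambda>y b. Suc b) l 0 = length l" for l :: "'b list" by (induction l) auto
  ultimately show ?thesis by simp
qed

lemma computable_map [computable_intros]:
  assumes "computable (\<lambda>p. F (fst p) (snd p))" "computable l"
  shows "computable (\<lambda>x. map (\<lambda>y. F x y) (l x))"
proof -
  have "computable (\<lambda>x. foldr (\<lambda>y b. F x y # b) (l x) [])"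
    by (intro computable_intros assms(2) computable_compose2[OF assms(1)])
  moreover have "foldr (\<lambda>y b. F x y # b) l [] = map (F x) l" for x l by (induction l) auto
  ultimately show ?thesis by simp
qed

lemma computable_filter [computable_intros]:
  assumes "computable (\<lambda>p. P (fst p) (snd p))" "computable l"
  shows "computable (\<lambda>x. filter (\<lambda>y. P x y) (l x))"
proof -
  have "computable (\<lambda>x. foldr (\<lambda>y b. if P x y then y # b else b) (l x) [])"
    by (intro computable_intros assms(2) computable_compose2[OF assms(1)])
  moreover have "foldr (\<lambda>y b. if P x y then y # b else b) l [] = filter (P x) l" for x l
    by (induction l) auto
  ultimately show ?thesis by simp
qed

lemma computable_upt [computable_intros]:
  assumes "computable n"
  shows "computable (\<lambda>x. [0..<n x])"
proof -
  have "computable (\<lambda>x. rec_nat [] (\<lambda>m y. y @ [m]) (n x))" by (intro computable_intros assms)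
  moreover have "rec_nat [] (\<lambda>m y. y @ [m]) k = [0..<k]" for k by (induction k) auto
  ultimately show ?thesis by simp
qed

text \<open>List access with a default in place of the unspecified values of \<open>xs ! i\<close>
  beyond the end, about whose computability nothing can be said.\<close>

definition nth_dflt :: "'a \<Rightarrow> 'a list \<Rightarrow> nat \<Rightarrow> 'a" where
  "nth_dflt d xs i = (if i < length xs then xs ! i else d)"

lemma nth_dflt_nth [simp]: "i < length xs \<Longrightarrow> nth_dflt d xs i = xs ! i"
  by (simp add: nth_dflt_def)

lemma computable_nth_dflt [computable_intros]:
  assumes "computable d" "computable l" "computable i"
  shows "computable (\<lambda>x. nth_dflt (d x) (l x) (i x))"
proof -
  have "computable (\<lambda>x. if (tl ^^ i x) (l x) = [] then d x else hd ((tl ^^ i x) (l x)))"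
    by (intro computable_hd_dflt computable_funpow computable_intros assms)
  moreover have "(if (tl ^^ i) l = [] then d else hd ((tl ^^ i) l)) = nth_dflt d l i" for i l and d :: 'b
  proof -
    have "(tl ^^ i) l = drop i l" by (induction i) (auto simp: drop_Suc tl_drop)
    then show ?thesis by (simp add: nth_dflt_def hd_drop_conv_nth)
  qed
  ultimately show ?thesis by simp
qed

lemma computable_div [computable_intros]:
  assumes "computable f" "computable g"
  shows "computable (\<lambda>x. f x div g x :: nat)"
proof -
  \<comment> \<open>The disjunct \<open>snd p = 0\<close> stops the search at 0, the value of
    division by zero.\<close>
  have "computable (\<lambda>p::nat \<times> nat. LEAST q. snd p = 0 \<or> fst p < snd p * Suc q)"
  proof (rule computable_Least, intro computable_intros)
    fix x :: "nat \<times> nat"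
    show "\<exists>m. snd x = 0 \<or> fst x < snd x * Suc m"
      by (cases "snd x") (auto intro!: exI[of _ "fst x"])
  qed
  moreover have "(LEAST q. b = 0 \<or> a < b * Suc q) = a div b" for a b :: nat
  proof (cases "b = 0")
    case False
    then show ?thesis
    proof (intro Least_equality)
      show "b = 0 \<or> a < b * Suc (a div b)"
        using False by (simp add: dividend_less_times_div)
      show "a div b \<le> q" if "b = 0 \<or> a < b * Suc q" for q
        using that False less_mult_imp_div_less[of a "Suc q" b] by (simp add: mult.commute)
    qed
  qed (auto intro!: Least_equality)
  ultimately have "computable (\<lambda>p::nat \<times> nat. fst p div snd p)" by simp
  then show ?thesis
    by (rule computable_compose2[where f = "(div)"]) (rule assms)+
qed

lemma computable_mod [computable_intros]:
  assumes "computable f" "computable g"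
  shows "computable (\<lambda>x. f x mod g x :: nat)"
proof -
  have "computable (\<lambda>x. f x - g x * (f x div g x))"
    by (intro computable_intros assms)
  then show ?thesis by (simp add: minus_mult_div_eq_mod)
qed

lemma computable_even:
  assumes "computable f"
  shows "computable (\<lambda>x. even (f x :: nat))"
proof -
  have "computable (\<lambda>x. f x mod 2 = 0)" by (intro computable_intros assms)
  then show ?thesis by (simp add: even_iff_mod_2_eq_zero)
qed

section \<open>Arithmetic of coded integers\<close>

lemma enc_int_eq: "enc i = (if 0 \<le> i then 2 * nat i else Suc (2 * nat (- i - 1)))"
  by (simp add: enc_int_def int_encode_def sum_encode_def)

lemma computable_nat [computable_intros]:
  assumes "computable f"
  shows "computable (\<lambda>x. nat (f x))"
proof -
  have "computable (\<lambda>x. if even (enc (f x)) then enc (f x) div 2 else 0)"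
    by (intro computable_intros computable_even computable_enc assms)
  then show ?thesis
    by (rule computable_enc_cong) (auto simp: enc_int_eq)
qed

lemma computable_nat_uminus:
  assumes "computable f"
  shows "computable (\<lambda>x. nat (- f x))"
proof -
  have "computable (\<lambda>x. if even (enc (f x)) then 0 else Suc (enc (f x) div 2))"
    by (intro computable_intros computable_even computable_enc assms)
  then show ?thesis
    by (rule computable_enc_cong) (auto simp: enc_int_eq)
qed

lemma computable_int_diff_nat:
  assumes "computable f" "computable g"
  shows "computable (\<lambda>x. int (f x) - int (g x))"
proof -
  have "computable (\<lambda>x. if g x \<le> f x then 2 * (f x - g x) else Suc (2 * (g x - f x - 1)))"
    by (intro computable_intros assms)
  then show ?thesis
    by (rule computable_enc_cong) (auto simp: enc_int_eq)
qed

lemma computable_int [computable_intros]: "computable f \<Longrightarrow> computable (\<lambda>x. int (f x))"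
  using computable_int_diff_nat[of f "\<lambda>_. 0"] by (simp add: computable_const)

lemma computable_add_int [computable_intros]:
  assumes "computable f" "computable g"
  shows "computable (\<lambda>x. f x + g x :: int)"
proof -
  have "computable (\<lambda>x. int (nat (f x) + nat (g x)) - int (nat (- f x) + nat (- g x)))"
    by (intro computable_intros computable_nat_uminus computable_int_diff_nat assms)
  moreover have "int (nat a + nat b) - int (nat (- a) + nat (- b)) = a + b" for a b by simp
  ultimately show ?thesis by simp
qed

lemma computable_uminus_int [computable_intros]:
  assumes "computable f"
  shows "computable (\<lambda>x. - f x :: int)"
proof -
  have "computable (\<lambda>x. int (nat (- f x)) - int (nat (f x)))"
    by (intro computable_intros computable_nat_uminus computable_int_diff_nat assms)
  moreover have "int (nat (- a)) - int (nat a) = - a" for a by simp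
  ultimately show ?thesis by simp
qed

lemma computable_mult_int [computable_intros]:
  assumes "computable f" "computable g"
  shows "computable (\<lambda>x. f x * g x :: int)"
proof -
  have "computable (\<lambda>x. int (nat (f x) * nat (g x) + nat (- f x) * nat (- g x))
      - int (nat (f x) * nat (- g x) + nat (- f x) * nat (g x)))"
    by (intro computable_intros computable_nat_uminus computable_int_diff_nat assms)
  moreover have "int (nat a * nat b + nat (- a) * nat (- b)) - int (nat a * nat (- b) + nat (- a) * nat b) = a * b"
    for a b by (cases "a \<ge> 0"; cases "b \<ge> 0") auto
  ultimately show ?thesis by simp
qed

lemma computable_le_int [computable_intros]:
  assumes "computable f" "computable g"
  shows "computable (\<lambda>x. f x \<le> (g x :: int))"
proof -
  have "computable (\<lambda>x. nat (f x + - g x) = 0)" by (intro computable_intros assms)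
  then show ?thesis by simp
qed

lemma computable_less_int [computable_intros]:
  assumes "computable f" "computable g"
  shows "computable (\<lambda>x. f x < (g x :: int))"
  using computable_not[OF computable_le_int[OF assms(2,1)]] by (simp add: not_le)

lemma computable_abs_int [computable_intros]:
  assumes "computable f"
  shows "computable (\<lambda>x. \<bar>f x :: int\<bar>)"
proof -
  have "computable (\<lambda>x. if f x \<le> 0 then - f x else f x)"
    by (intro computable_intros assms)
  then show ?thesis by (rule computable_enc_cong) auto
qed

section \<open>Rational numbers, coded by their reduced fractions\<close>

instantiation rat :: coded
begin
definition enc_rat :: "rat \<Rightarrow> nat" where "enc_rat r = enc (quotient_of r)"
instance by standard (simp add: enc_rat_def quotient_of_inject)
end

lemma computable_quotient_of [computable_intros]: "computable f \<Longrightarrow> computable (\<lambda>x. quotient_of (f x))"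
  by (erule computable_enc_cong) (simp add: enc_rat_def)

text \<open>Common divisors of \<open>c\<close> and a positive \<open>d\<close> are at most
  \<open>d\<close>, so coprimality is a bounded check. The value \<open>k = 0\<close> does no harm,
  because \<open>nat d mod 0\<close> is positive.\<close>

lemma coprime_iff_nat_mod:
  assumes "d > 0"
  shows "coprime c d \<longleftrightarrow> (\<forall>k < Suc (nat d). nat \<bar>c\<bar> mod k = 0 \<and> nat d mod k = 0 \<longrightarrow> k = 1)"
proof
  assume "coprime c d"
  then have "coprime (nat \<bar>c\<bar>) (nat d)"
    using assms by (simp add: coprime_int_iff[symmetric])
  from coprime_common_divisor[OF this] show
    "\<forall>k < Suc (nat d). nat \<bar>c\<bar> mod k = 0 \<and> nat d mod k = 0 \<longrightarrow> k = 1"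
    by (simp add: mod_eq_0_iff_dvd)
next
  assume *: "\<forall>k < Suc (nat d). nat \<bar>c\<bar> mod k = 0 \<and> nat d mod k = 0 \<longrightarrow> k = 1"
  let ?g = "gcd (nat \<bar>c\<bar>) (nat d)"
  have "?g \<le> nat d" by (rule dvd_imp_le[OF gcd_dvd2]) (use assms in simp)
  moreover have "nat \<bar>c\<bar> mod ?g = 0" "nat d mod ?g = 0"
    by (simp_all only: mod_eq_0_iff_dvd gcd_dvd1 gcd_dvd2)
  ultimately have "?g = 1" using *[rule_format, of ?g] by (simp only: less_Suc_eq_le)
  then have "coprime (nat \<bar>c\<bar>) (nat d)" by (simp only: coprime_iff_gcd_eq_1)
  then show "coprime c d"
    using assms by (simp add: coprime_int_iff[symmetric])
qed

lemma computable_coprime: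
  assumes "computable f" "computable g"
  shows "computable (\<lambda>x. g x > 0 \<and> coprime (f x) (g x :: int))"
proof -
  have "computable (\<lambda>x. g x > 0 \<and>
      (\<forall>k < Suc (nat (g x)). nat \<bar>f x\<bar> mod k = 0 \<and> nat (g x) mod k = 0 \<longrightarrow> k = 1))"
    by (intro computable_intros assms computable_compose[OF assms(1)] computable_compose[OF assms(2)])
  then show ?thesis
    by (rule computable_enc_cong) (rule arg_cong[where f = enc], rule conj_cong[OF refl],
        rule coprime_iff_nat_mod[symmetric])
qed

text \<open>Reduction to lowest terms is done by search: the reduced pair is the only one with
  positive denominator, coprime entries and the right quotient, and all three conditions are
  decidable.\<close>

lemma computable_Fract [computable_intros]:
  assumes "computable f" "computable g"
  shows "computable (\<lambda>x. Rat.Fract (f x) (g x))"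
proof -
  define num den where "num m = int_decode (fst (prod_decode m))"
    and "den m = int_decode (snd (prod_decode m))" for m
  have nd: "enc (num m, den m) = m" for m
    by (simp add: num_def den_def enc_prod_def enc_int_def)
  \<comment> \<open>A fraction with denominator 0 is the rational 0. There the numerator 0 and
    coprimality force the reduced pair \<open>(0, 1)\<close>.\<close>
  define P where "P p m \<longleftrightarrow> (den m > 0 \<and> coprime (num m) (den m))
     \<and> (if snd p = 0 then num m = 0 else num m * snd p = fst p * den m)" for p :: "int \<times> int" and m
  have P_iff: "P p m \<longleftrightarrow> quotient_of (Rat.Fract (fst p) (snd p)) = (num m, den m)" for p m
  proof
    assume P: "P p m"
    then have pos: "den m > 0" "coprime (num m) (den m)" by (simp_all add: P_def)
    have "Rat.Fract (fst p) (snd p) = Rat.Fract (num m) (den m)"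
    proof (cases "snd p = 0")
      case True
      then show ?thesis using P pos by (simp add: P_def Fract_of_int_quotient)
    next
      case False
      then show ?thesis using P pos by (simp add: P_def eq_rat)
    qed
    then show "quotient_of (Rat.Fract (fst p) (snd p)) = (num m, den m)"
      using pos by (simp add: quotient_of_Fract normalize_stable)
  next
    assume q: "quotient_of (Rat.Fract (fst p) (snd p)) = (num m, den m)"
    have eq: "Rat.Fract (fst p) (snd p) = Rat.Fract (num m) (den m)"
      using quotient_of_div[OF q] by (simp only: Fract_of_int_quotient[of "num m"])
    note pos = quotient_of_denom_pos[OF q] quotient_of_coprime[OF q]
    show "P p m"
    proof (cases "snd p = 0")
      case True
      then show ?thesis using eq pos by (simp add: P_def Fract_of_int_quotient)
    next
      case False
      then show ?thesis using eq pos by (simp add: P_def eq_rat)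
    qed
  qed
  have ex: "\<exists>m. P p m" for p
    unfolding P_iff num_def den_def
    by (intro exI[of _ "enc (quotient_of (Rat.Fract (fst p) (snd p)))"]) (simp add: enc_prod_def enc_int_def)
  have cP: "computable (\<lambda>p. P (fst p) (snd p))"
    unfolding P_def num_def den_def
    by (intro computable_conj computable_coprime) (intro computable_intros)+
  obtain h where h: "computable h" "\<forall>p. P p (h p)"
    using computable_choice[of P, OF cP ex] by auto
  have "computable (\<lambda>p. Rat.Fract (fst p) (snd p))"
  proof (rule computable_enc_cong[OF h(1)])
    fix p :: "int \<times> int"
    have "quotient_of (Rat.Fract (fst p) (snd p)) = (num (h p), den (h p))"
      using h(2) unfolding P_iff by auto
    then show "enc (h p) = enc (Rat.Fract (fst p) (snd p))"
      unfolding enc_rat_def by (simp only: nd enc_nat_def)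
  qed
  then show ?thesis
    by (rule computable_compose2[where f = Rat.Fract, OF _ assms])
qed

lemma Fract_quotient_of: "Rat.Fract (fst (quotient_of r)) (snd (quotient_of r)) = r"
  using quotient_of_div[of r "fst (quotient_of r)" "snd (quotient_of r)"] by (simp add: Fract_of_int_quotient)

lemma snd_quotient_of_pos: "snd (quotient_of r) > 0"
  using quotient_of_denom_pos[of r] by (cases "quotient_of r") auto

text \<open>The formulas \<open>N\<close> and \<open>D\<close> may give an unreduced fraction, and
  for division by zero a denominator 0; \<open>computable_Fract\<close> normalises all of these to
  the right value.\<close>

lemma computable_rat_binary:
  assumes "computable f" "computable g"
    and "\<And>a b c d. b > 0 \<Longrightarrow> d > 0 \<Longrightarrow> op (Rat.Fract a b) (Rat.Fract c d) = Rat.Fract (N a b c d) (D a b c d)"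
    and "computable (\<lambda>x. N (fst (quotient_of (f x))) (snd (quotient_of (f x)))
        (fst (quotient_of (g x))) (snd (quotient_of (g x))))"
    and "computable (\<lambda>x. D (fst (quotient_of (f x))) (snd (quotient_of (f x)))
        (fst (quotient_of (g x))) (snd (quotient_of (g x))))"
  shows "computable (\<lambda>x. op (f x) (g x))"
  by (rule computable_enc_cong[OF computable_Fract[OF assms(4,5)]])
    (simp add: assms(3)[symmetric] snd_quotient_of_pos Fract_quotient_of)

lemma computable_add_rat [computable_intros]:
  "computable f \<Longrightarrow> computable g \<Longrightarrow> computable (\<lambda>x. f x + g x :: rat)"
  by (rule computable_rat_binary[where op = "(+)" and N = "\<lambda>a b c d. a * d + c * b" and D = "\<lambda>a b c d. b * d"])
    (assumption | simp | intro computable_intros)+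

lemma computable_mult_rat [computable_intros]:
  "computable f \<Longrightarrow> computable g \<Longrightarrow> computable (\<lambda>x. f x * g x :: rat)"
  by (rule computable_rat_binary[where op = "(*)" and N = "\<lambda>a b c d. a * c" and D = "\<lambda>a b c d. b * d"])
    (assumption | simp | intro computable_intros)+

lemma computable_divide_rat [computable_intros]:
  "computable f \<Longrightarrow> computable g \<Longrightarrow> computable (\<lambda>x. f x / g x :: rat)"
  by (rule computable_rat_binary[where op = "(/)" and N = "\<lambda>a b c d. a * d" and D = "\<lambda>a b c d. b * c"])
    (assumption | simp | intro computable_intros)+

lemma computable_uminus_rat [computable_intros]:
  "computable f \<Longrightarrow> computable (\<lambda>x. - f x :: rat)"
  using computable_mult_rat[of "\<lambda>_. - 1" f] by (simp add: computable_const)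

lemma computable_diff_rat [computable_intros]:
  "computable f \<Longrightarrow> computable g \<Longrightarrow> computable (\<lambda>x. f x - g x :: rat)"
  using computable_add_rat[of f "\<lambda>x. - g x"] by (simp add: computable_uminus_rat)

lemma computable_le_rat [computable_intros]:
  assumes "computable f" "computable g"
  shows "computable (\<lambda>x. f x \<le> (g x :: rat))"
proof -
  have "computable (\<lambda>x. fst (quotient_of (f x)) * snd (quotient_of (g x))
      \<le> fst (quotient_of (g x)) * snd (quotient_of (f x)))"
    by (intro computable_intros assms)
  moreover have "fst (quotient_of p) * snd (quotient_of q) \<le> fst (quotient_of q) * snd (quotient_of p) \<longleftrightarrow> p \<le> q" for p q
    by (simp add: rat_less_eq_code case_prod_unfold Let_def mult.commute[of "snd (quotient_of p)"])
  ultimately show ?thesis by simp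
qed

lemma computable_less_rat [computable_intros]:
  "computable f \<Longrightarrow> computable g \<Longrightarrow> computable (\<lambda>x. f x < (g x :: rat))"
  using computable_not[OF computable_le_rat[of g f]] by (simp add: not_le)

lemma computable_abs_rat [computable_intros]:
  assumes "computable f"
  shows "computable (\<lambda>x. \<bar>f x :: rat\<bar>)"
proof -
  have "computable (\<lambda>x. if f x \<le> 0 then - f x else f x)"
    by (intro computable_intros assms)
  then show ?thesis by (rule computable_enc_cong) auto
qed

lemma computable_rat_of_nat [computable_intros]:
  assumes "computable f"
  shows "computable (\<lambda>x. rat_of_nat (f x))"
proof -
  have "computable (\<lambda>x. Rat.Fract (int (f x)) 1)" by (intro computable_intros assms)
  then show ?thesis by (simp add: of_int_rat[symmetric])
qed

lemma computable_rat_of_int [computable_intros]: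
  assumes "computable f"
  shows "computable (\<lambda>x. rat_of_int (f x))"
proof -
  have "computable (\<lambda>x. Rat.Fract (f x) 1)" by (intro computable_intros assms)
  then show ?thesis by (simp add: of_int_rat[symmetric])
qed

lemma computable_power_rat [computable_intros]:
  assumes "computable f" "computable g"
  shows "computable (\<lambda>x. f x ^ g x :: rat)"
proof -
  have "computable (\<lambda>x. rec_nat 1 (\<lambda>m y. f x * y) (g x))"
    by (intro computable_intros assms computable_compose[OF assms(1)])
  moreover have "rec_nat 1 (\<lambda>m y. a * y) b = a ^ b" for a :: rat and b by (induction b) auto
  ultimately show ?thesis by simp
qed

lemma computable_sum_rat [computable_intros]:
  fixes F :: "'a::coded \<Rightarrow> nat \<Rightarrow> rat"
  assumes "computable (\<lambda>p. F (fst p) (snd p))" "computable n"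
  shows "computable (\<lambda>x. \<Sum>i<n x. F x i)"
proof -
  have "computable (\<lambda>x. rec_nat 0 (\<lambda>m y. y + F x m) (n x))"
    by (intro computable_intros assms computable_compose2[OF assms(1)])
  moreover have "rec_nat 0 (\<lambda>m y. y + F x m) k = (\<Sum>i<k. F x i)" for x k by (induction k) auto
  ultimately show ?thesis by simp
qed

lemma computable_sum_list_rat [computable_intros]:
  assumes "computable l"
  shows "computable (\<lambda>x. sum_list (l x) :: rat)"
proof -
  have "computable (\<lambda>x. foldr (+) (l x) 0)"
    by (intro computable_intros assms)
  moreover have "foldr (+) l 0 = sum_list l" for l :: "rat list" by (induction l) auto
  ultimately show ?thesis by simp
qed

lemma computable_sum_list_nat [computable_intros]:
  assumes "computable l"
  shows "computable (\<lambda>x. sum_list (l x) :: nat)"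
proof -
  have "computable (\<lambda>x. foldr (+) (l x) 0)"
    by (intro computable_intros assms)
  moreover have "foldr (+) l 0 = sum_list l" for l :: "nat list" by (induction l) auto
  ultimately show ?thesis by simp
qed

section \<open>Semidecidable predicates and enumeration of computations\<close>

definition semidecidable :: "('a::coded \<Rightarrow> bool) \<Rightarrow> bool" where
  "semidecidable P \<longleftrightarrow> (\<exists>R :: 'a \<times> nat \<Rightarrow> bool. computable R \<and> (\<forall>x. P x \<longleftrightarrow> (\<exists>w. R (x, w))))"

lemma semidecidableI:
  fixes R :: "'a::coded \<times> nat \<Rightarrow> bool"
  assumes "computable R" "\<And>x. P x \<longleftrightarrow> (\<exists>w. R (x, w))"
  shows "semidecidable P"
  using assms unfolding semidecidable_def by blast

lemma semidecidable_computable: "computable P \<Longrightarrow> semidecidable P"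
  by (rule semidecidableI[of "\<lambda>p. P (fst p)"]) (auto intro!: computable_compose[of P] computable_intros)

lemma semidecidable_compose:
  assumes "semidecidable P" "computable g"
  shows "semidecidable (\<lambda>x. P (g x))"
proof -
  from assms obtain R :: "_ \<times> nat \<Rightarrow> bool" where R: "computable R" "\<forall>x. P x \<longleftrightarrow> (\<exists>w. R (x, w))"
    unfolding semidecidable_def by blast
  have "computable (\<lambda>p. R (g (fst p), snd p))"
    by (intro computable_compose[OF R(1)] computable_compose[OF assms(2)] computable_intros)
  then show ?thesis by (rule semidecidableI) (use R(2) in simp)
qed

lemma semidecidable_compose2:
  "semidecidable (\<lambda>p. P (fst p) (snd p)) \<Longrightarrow> computable g \<Longrightarrow> computable h \<Longrightarrow> semidecidable (\<lambda>x. P (g x) (h x))"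
  using semidecidable_compose[of "\<lambda>p. P (fst p) (snd p)" "\<lambda>x. (g x, h x)"] by (simp add: computable_Pair)

lemma semidecidable_conj:
  assumes "semidecidable P" "semidecidable Q"
  shows "semidecidable (\<lambda>x. P x \<and> Q x)"
proof -
  from assms obtain R S :: "_ \<times> nat \<Rightarrow> bool" where R: "computable R" "\<forall>x. P x \<longleftrightarrow> (\<exists>w. R (x, w))"
    and S: "computable S" "\<forall>x. Q x \<longleftrightarrow> (\<exists>w. S (x, w))"
    unfolding semidecidable_def by blast
  have "computable (\<lambda>p. R (fst p, fst (prod_decode (snd p))) \<and> S (fst p, snd (prod_decode (snd p))))"
    by (intro computable_intros computable_compose[OF R(1)] computable_compose[OF S(1)])
  then show ?thesis
  proof (rule semidecidableI)
    fix x
    show "P x \<and> Q x \<longleftrightarrow> (\<exists>w. R (fst (x, w), fst (prod_decode (snd (x, w))))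
        \<and> S (fst (x, w), snd (prod_decode (snd (x, w)))))"
    proof
      assume "P x \<and> Q x"
      then obtain v w where "R (x, v)" "S (x, w)" using R(2) S(2) by blast
      then show "\<exists>w. R (fst (x, w), fst (prod_decode (snd (x, w))))
        \<and> S (fst (x, w), snd (prod_decode (snd (x, w))))"
        by (intro exI[of _ "prod_encode (v, w)"]) simp
    qed (auto simp: R(2) S(2))
  qed
qed

lemma semidecidable_ex:
  fixes P :: "'a::coded \<Rightarrow> nat \<Rightarrow> bool"
  assumes "semidecidable (\<lambda>p. P (fst p) (snd p))"
  shows "semidecidable (\<lambda>x. \<exists>y. P x y)"
proof -
  from assms obtain R :: "_ \<times> nat \<Rightarrow> bool" where R: "computable R" "\<forall>p. P (fst p) (snd p) \<longleftrightarrow> (\<exists>w. R (p, w))"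
    unfolding semidecidable_def by blast
  have R2: "P x y \<longleftrightarrow> (\<exists>w. R ((x, y), w))" for x y
    using R(2)[rule_format, of "(x, y)"] by simp
  have "computable (\<lambda>p. R ((fst p, fst (prod_decode (snd p))), snd (prod_decode (snd p))))"
    by (intro computable_intros computable_compose[OF R(1)])
  then show ?thesis
  proof (rule semidecidableI)
    fix x
    show "(\<exists>y. P x y) \<longleftrightarrow> (\<exists>w. R ((fst (x, w), fst (prod_decode (snd (x, w)))), snd (prod_decode (snd (x, w)))))"
    proof
      assume "\<exists>y. P x y"
      then obtain y v where "R ((x, y), v)" unfolding R2 by blast
      then show "\<exists>w. R ((fst (x, w), fst (prod_decode (snd (x, w)))), snd (prod_decode (snd (x, w))))"
        by (intro exI[of _ "prod_encode (y, v)"]) simp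
    qed (auto simp: R2)
  qed
qed

text \<open>The finitely many witnesses are packed into one coded list, so a bounded universal
  quantifier still asks for a single witness.\<close>

lemma semidecidable_all_less:
  fixes P :: "'a::coded \<Rightarrow> nat \<Rightarrow> bool"
  assumes "semidecidable (\<lambda>p. P (fst p) (snd p))" and b: "computable b"
  shows "semidecidable (\<lambda>x. \<forall>i<b x. P x i)"
proof -
  from assms obtain R :: "_ \<times> nat \<Rightarrow> bool" where R: "computable R" "\<forall>p. P (fst p) (snd p) \<longleftrightarrow> (\<exists>w. R (p, w))"
    unfolding semidecidable_def by blast
  have R2: "P x y \<longleftrightarrow> (\<exists>w. R ((x, y), w))" for x y
    using R(2)[rule_format, of "(x, y)"] by simp
  have "computable (\<lambda>p. \<forall>i < b (fst p). R ((fst p, i), nth_dflt 0 (list_decode (snd p)) i))"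
    by (intro computable_intros computable_compose[OF R(1)] computable_compose[OF b])
  then show ?thesis
  proof (rule semidecidableI)
    fix x
    show "(\<forall>i<b x. P x i) \<longleftrightarrow>
      (\<exists>w. \<forall>i < b (fst (x, w)). R ((fst (x, w), i), nth_dflt 0 (list_decode (snd (x, w))) i))"
    proof
      assume "\<forall>i<b x. P x i"
      then have "\<forall>i. \<exists>w. i < b x \<longrightarrow> R ((x, i), w)" unfolding R2 by blast
      from choice[OF this] obtain w where "\<forall>i<b x. R ((x, i), w i)" by blast
      then show "\<exists>w. \<forall>i < b (fst (x, w)). R ((fst (x, w), i), nth_dflt 0 (list_decode (snd (x, w))) i)"
        by (intro exI[of _ "list_encode (map w [0..<b x])"]) simp
    qed (auto simp: R2)
  qed
qed

text \<open>Unlike above, \<open>P i\<close> may depend on \<open>i\<close> in a non-uniform way,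
  since \<open>n\<close> is a constant. This fits the argument programs \<open>gs ! i\<close> of a
  composition.\<close>

lemma semidecidable_all_fixed:
  fixes n :: nat
  assumes "\<And>i. i < n \<Longrightarrow> semidecidable (P i)"
  shows "semidecidable (\<lambda>x. \<forall>i<n. P i x)"
  using assms
proof (induction n)
  case 0
  then show ?case by (simp add: semidecidable_computable computable_const)
next
  case (Suc n)
  then have "semidecidable (\<lambda>x. (\<forall>i<n. P i x) \<and> P n x)"
    by (intro semidecidable_conj) auto
  moreover have "(\<forall>i<n. P i x) \<and> P n x \<longleftrightarrow> (\<forall>i<Suc n. P i x)" for x
    by (auto simp: less_Suc_eq)
  ultimately show ?case by simp
qed

text \<open>Listing all intermediate values replaces the recursion by one existential quantifier
  over a list, with conditions that mention only the programs \<open>f\<close> and \<open>g\<close>.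
  That is the shape an induction on programs can handle.\<close>

lemma evalr_Prec_iff_trace:
  "evalr (Prec f g) (n # xs) y \<longleftrightarrow> (\<exists>L. length L = Suc n \<and> evalr f xs (L ! 0) \<and>
     (\<forall>i<n. evalr g (L ! i # i # xs) (L ! Suc i)) \<and> L ! n = y)"
proof (induction n arbitrary: y)
  case 0
  show ?case
    by (auto simp: evalr_Prec_0 length_Suc_conv intro: exI[of _ "[y]"])
next
  case (Suc n)
  show ?case
  proof
    assume "evalr (Prec f g) (Suc n # xs) y"
    then obtain z where z: "evalr (Prec f g) (n # xs) z" "evalr g (z # n # xs) y"
      by (auto simp: evalr_Prec_Suc)
    then obtain L where L: "length L = Suc n" "evalr f xs (L ! 0)"
      "\<forall>i<n. evalr g (L ! i # i # xs) (L ! Suc i)" "L ! n = z"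
      using Suc by blast
    then show "\<exists>L. length L = Suc (Suc n) \<and> evalr f xs (L ! 0) \<and>
     (\<forall>i<Suc n. evalr g (L ! i # i # xs) (L ! Suc i)) \<and> L ! Suc n = y"
      using z(2) by (intro exI[of _ "L @ [y]"]) (auto simp: nth_append less_Suc_eq)
  next
    assume "\<exists>L. length L = Suc (Suc n) \<and> evalr f xs (L ! 0) \<and>
     (\<forall>i<Suc n. evalr g (L ! i # i # xs) (L ! Suc i)) \<and> L ! Suc n = y"
    then obtain L where L: "length L = Suc (Suc n)" "evalr f xs (L ! 0)"
      "\<forall>i<Suc n. evalr g (L ! i # i # xs) (L ! Suc i)" "L ! Suc n = y" by blast
    then have "evalr (Prec f g) (n # xs) (L ! n)"
      by (subst Suc) (auto intro!: exI[of _ "take (Suc n) L"])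
    then show "evalr (Prec f g) (Suc n # xs) y"
      using L by (auto simp: evalr_Prec_Suc)
  qed
qed

lemma ex_list_iff: "(\<exists>l. Q l) \<longleftrightarrow> (\<exists>c. Q (list_decode c))"
proof
  assume "\<exists>l. Q l"
  then obtain l where "Q l" ..
  then show "\<exists>c. Q (list_decode c)" by (intro exI[of _ "list_encode l"]) simp
qed blast

text \<open>Induction on the program: each constructor asks only for a finite trace of evaluations
  of its components. The procedure obtained depends on \<open>f\<close>, which is enough to
  enumerate the domain of one given machine.\<close>

lemma semidecidable_evalr: "semidecidable (\<lambda>p. evalr f (fst p) (snd p))"
proof (induction f)
  case Zero
  show ?case
    unfolding evalr_Zero by (intro semidecidable_computable computable_intros)
next
  case Succ
  have "computable (\<lambda>p. fst p \<noteq> [] \<and> snd p = Suc (nth_dflt 0 (fst p) 0))"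
    by (intro computable_intros)
  moreover have "evalr Succ xs y \<longleftrightarrow> xs \<noteq> [] \<and> y = Suc (nth_dflt 0 xs 0)" for xs y
    by (cases xs) (auto simp: evalr_Succ)
  ultimately show ?case by (simp add: semidecidable_computable)
next
  case (Proj i)
  have "computable (\<lambda>p :: nat list \<times> nat. i < length (fst p) \<and> snd p = nth_dflt 0 (fst p) i)"
    by (intro computable_intros)
  moreover have "evalr (Proj i) xs y \<longleftrightarrow> i < length xs \<and> y = nth_dflt 0 xs i" for xs y
    by (auto simp: evalr_Proj)
  ultimately show ?case by (simp only: semidecidable_computable)
next
  case (Comp f gs)
  have "evalr (Comp f gs) xs y \<longleftrightarrow> (\<exists>c. length (list_decode c) = length gs
      \<and> (\<forall>i<length gs. evalr (gs ! i) xs (nth_dflt 0 (list_decode c) i)) \<and> evalr f (list_decode c) y)" for xs y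
  proof
    assume "evalr (Comp f gs) xs y"
    then obtain ys where "length gs = length ys" "\<forall>i<length gs. evalr (gs ! i) xs (ys ! i)" "evalr f ys y"
      unfolding evalr_Comp by blast
    then show "\<exists>c. length (list_decode c) = length gs
      \<and> (\<forall>i<length gs. evalr (gs ! i) xs (nth_dflt 0 (list_decode c) i)) \<and> evalr f (list_decode c) y"
      by (intro exI[of _ "list_encode ys"]) auto
  next
    assume "\<exists>c. length (list_decode c) = length gs
      \<and> (\<forall>i<length gs. evalr (gs ! i) xs (nth_dflt 0 (list_decode c) i)) \<and> evalr f (list_decode c) y"
    then obtain c where c: "length (list_decode c) = length gs"
      "\<forall>i<length gs. evalr (gs ! i) xs (nth_dflt 0 (list_decode c) i)" "evalr f (list_decode c) y"
      by blast
    then have "\<forall>i<length gs. evalr (gs ! i) xs (list_decode c ! i)" by simp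
    with c show "evalr (Comp f gs) xs y"
      unfolding evalr_Comp by (intro exI[of _ "list_decode c"]) simp
  qed
  moreover have "semidecidable (\<lambda>p. \<exists>c. length (list_decode c) = length gs
      \<and> (\<forall>i<length gs. evalr (gs ! i) (fst p) (nth_dflt 0 (list_decode c) i)) \<and> evalr f (list_decode c) (snd p))"
  proof (intro semidecidable_ex semidecidable_conj semidecidable_all_fixed)
    show "semidecidable (\<lambda>q :: (nat list \<times> nat) \<times> nat. length (list_decode (snd q)) = length gs)"
      by (intro semidecidable_computable computable_intros)
    show "semidecidable (\<lambda>q :: (nat list \<times> nat) \<times> nat. evalr f (list_decode (snd q)) (snd (fst q)))"
      by (rule semidecidable_compose2[OF Comp.IH(1)]) (intro computable_intros)+
    fix i assume "i < length gs"
    then have "semidecidable (\<lambda>p. evalr (gs ! i) (fst p) (snd p))"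
      using Comp.IH(2) by simp
    then show "semidecidable (\<lambda>q :: (nat list \<times> nat) \<times> nat. evalr (gs ! i) (fst (fst q)) (nth_dflt 0 (list_decode (snd q)) i))"
      by (rule semidecidable_compose2) (intro computable_intros)+
  qed
  ultimately show ?case by simp
next
  case (Prec f g)
  have "evalr (Prec f g) xs y \<longleftrightarrow> xs \<noteq> [] \<and> (\<exists>c. length (list_decode c) = Suc (nth_dflt 0 xs 0)
      \<and> evalr f (tl xs) (nth_dflt 0 (list_decode c) 0)
      \<and> (\<forall>i < nth_dflt 0 xs 0. evalr g (nth_dflt 0 (list_decode c) i # i # tl xs) (nth_dflt 0 (list_decode c) (Suc i)))
      \<and> nth_dflt 0 (list_decode c) (nth_dflt 0 xs 0) = y)" for xs y
  proof (cases xs)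
    case Nil
    then show ?thesis by (simp add: evalr_Prec_Nil)
  next
    case (Cons n ys)
    have "(\<exists>L. length L = Suc n \<and> evalr f ys (L ! 0) \<and> (\<forall>i<n. evalr g (L ! i # i # ys) (L ! Suc i)) \<and> L ! n = y)
      \<longleftrightarrow> (\<exists>c. length (list_decode c) = Suc n \<and> evalr f ys (list_decode c ! 0)
        \<and> (\<forall>i<n. evalr g (list_decode c ! i # i # ys) (list_decode c ! Suc i)) \<and> list_decode c ! n = y)"
      by (rule ex_list_iff)
    also have "\<dots> \<longleftrightarrow> (\<exists>c. length (list_decode c) = Suc n \<and> evalr f ys (nth_dflt 0 (list_decode c) 0)
      \<and> (\<forall>i<n. evalr g (nth_dflt 0 (list_decode c) i # i # ys) (nth_dflt 0 (list_decode c) (Suc i)))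
      \<and> nth_dflt 0 (list_decode c) n = y)"
      by (intro arg_cong[where f = Ex] ext) (auto simp: nth_dflt_def)
    finally show ?thesis using Cons by (simp add: evalr_Prec_iff_trace)
  qed
  moreover have "semidecidable (\<lambda>p. fst p \<noteq> [] \<and> (\<exists>c. length (list_decode c) = Suc (nth_dflt 0 (fst p) 0)
      \<and> evalr f (tl (fst p)) (nth_dflt 0 (list_decode c) 0)
      \<and> (\<forall>i < nth_dflt 0 (fst p) 0. evalr g (nth_dflt 0 (list_decode c) i # i # tl (fst p)) (nth_dflt 0 (list_decode c) (Suc i)))
      \<and> nth_dflt 0 (list_decode c) (nth_dflt 0 (fst p) 0) = snd p))"
  proof (intro semidecidable_conj semidecidable_ex semidecidable_all_less)
    show "semidecidable (\<lambda>q :: (nat list \<times> nat) \<times> nat. evalr f (tl (fst (fst q))) (nth_dflt 0 (list_decode (snd q)) 0))"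
      by (rule semidecidable_compose2[OF Prec.IH(1)]) (intro computable_intros)+
    show "semidecidable (\<lambda>q :: ((nat list \<times> nat) \<times> nat) \<times> nat.
        evalr g (nth_dflt 0 (list_decode (snd (fst q))) (snd q) # snd q # tl (fst (fst (fst q))))
          (nth_dflt 0 (list_decode (snd (fst q))) (Suc (snd q))))"
      by (rule semidecidable_compose2[OF Prec.IH(2)]) (intro computable_intros)+
  qed (intro semidecidable_computable computable_intros)+
  ultimately show ?case by simp
next
  case (Mn f)
  have "semidecidable (\<lambda>p :: nat list \<times> nat. evalr f (snd p # fst p) 0 \<and>
      (\<forall>m < snd p. \<exists>v. evalr f (m # fst p) v \<and> v \<noteq> 0))"
  proof (intro semidecidable_conj semidecidable_ex semidecidable_all_less)
    show "semidecidable (\<lambda>p :: nat list \<times> nat. evalr f (snd p # fst p) 0)"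
      by (rule semidecidable_compose2[OF Mn.IH]) (intro computable_intros)+
    show "semidecidable (\<lambda>q :: ((nat list \<times> nat) \<times> nat) \<times> nat. evalr f (snd (fst q) # fst (fst (fst q))) (snd q))"
      by (rule semidecidable_compose2[OF Mn.IH]) (intro computable_intros)+
  qed (intro semidecidable_computable computable_intros)+
  then show ?case by (simp add: evalr_Mn)
qed

section \<open>Separation of sums of products of algebraic numbers\<close>

text \<open>Splits off the zeros. The coefficient of degree \<open>k\<close> of the whole product is
  then the constant coefficient of the second factor, the product of the negated nonzero
  numbers.\<close>

lemma prod_list_linear_factors:
  fixes as :: "complex list"
  shows "\<exists>k. (\<Prod>a\<leftarrow>as. [:- a, 1:]) = monom 1 k * (\<Prod>a\<leftarrow>filter (\<lambda>a. a \<noteq> 0) as. [:- a, 1:])"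
proof (induction as)
  case Nil
  show ?case by (intro exI[of _ 0]) simp
next
  case (Cons a as)
  then obtain k where k: "(\<Prod>a\<leftarrow>as. [:- a, 1:]) = monom 1 k * (\<Prod>a\<leftarrow>filter (\<lambda>a. a \<noteq> 0) as. [:- a, 1:])"
    by blast
  show ?case
  proof (cases "a = 0")
    case True
    then show ?thesis by (intro exI[of _ "Suc k"]) (simp add: k monom_Suc)
  next
    case False
    then show ?thesis by (intro exI[of _ k]) (simp add: k mult.left_commute)
  qed
qed

lemma prod_list_le_power:
  fixes xs :: "real list"
  assumes "\<And>x. x \<in> set xs \<Longrightarrow> 0 \<le> x \<and> x \<le> K" "1 \<le> K"
  shows "0 \<le> prod_list xs \<and> prod_list xs \<le> K ^ length xs"
  using assms(1)
proof (induction xs)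
  case (Cons x xs)
  then show ?case using assms(2) by (auto intro!: mult_mono)
qed simp

lemma prod_list_le_mem_power:
  fixes xs :: "real list"
  assumes "\<And>x. x \<in> set xs \<Longrightarrow> 0 \<le> x \<and> x \<le> K" "1 \<le> K" "y \<in> set xs"
  shows "prod_list xs \<le> y * K ^ length xs"
  using assms(1,3)
proof (induction xs)
  case (Cons x xs)
  have x: "0 \<le> x" "x \<le> K" and y: "0 \<le> y" using Cons.prems by auto
  have P: "0 \<le> prod_list xs" "prod_list xs \<le> K ^ length xs"
    using prod_list_le_power[of xs K] Cons.prems assms(2) by auto
  show ?case
  proof (cases "y \<in> set xs")
    case True
    with Cons have "prod_list xs \<le> y * K ^ length xs" by auto
    with x P have "x * prod_list xs \<le> K * (y * K ^ length xs)" by (intro mult_mono) auto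
    then show ?thesis by (simp add: ac_simps)
  next
    case False
    then have "y = x" using Cons.prems by simp
    have "K ^ length xs \<le> K * K ^ length xs" using assms(2) by simp
    then have "prod_list xs \<le> K * K ^ length xs" using P by linarith
    then show ?thesis using x \<open>y = x\<close> by (simp add: mult_left_mono)
  qed
qed simp

text \<open>Evaluate the eigenvector equation at a coordinate of largest modulus: the right-hand
  side is at most the row sum times that modulus, which can be cancelled.\<close>

lemma eigenvalue_norm_le_row_sum:
  fixes A :: "complex mat"
  assumes A: "A \<in> carrier_mat n n" and ev: "eigenvalue A a"
    and K: "\<And>i. i < n \<Longrightarrow> (\<Sum>j<n. norm (A $$ (i, j))) \<le> K"
  shows "norm a \<le> K"
proof -
  from ev obtain u where u: "u \<in> carrier_vec n" "u \<noteq> 0\<^sub>v n" "A *\<^sub>v u = a \<cdot>\<^sub>v u"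
    using A unfolding eigenvalue_def eigenvector_def by auto
  have "n > 0"
    using u(1,2) by (cases n) auto
  define m where "m = Max ((\<lambda>j. norm (u $ j)) ` {..<n})"
  have "m \<in> (\<lambda>j. norm (u $ j)) ` {..<n}"
    unfolding m_def using \<open>n > 0\<close> by (intro Max_in) auto
  then obtain i where i: "i < n" "m = norm (u $ i)" by auto
  have le: "norm (u $ j) \<le> norm (u $ i)" if "j < n" for j
    unfolding i(2)[symmetric] m_def using that by (intro Max_ge) auto
  have pos: "norm (u $ i) > 0"
  proof (rule ccontr)
    assume "\<not> norm (u $ i) > 0"
    then have "u $ j = 0" if "j < n" for j using le[OF that] by simp
    then have "u = 0\<^sub>v n" using u(1) by (intro eq_vecI) auto
    with u(2) show False by simp
  qed
  have "a * u $ i = (A *\<^sub>v u) $ i" using u i by simp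
  also have "\<dots> = (\<Sum>j<n. A $$ (i, j) * u $ j)"
    using A u(1) i(1) by (simp add: scalar_prod_def lessThan_atLeast0)
  finally have "norm a * norm (u $ i) = norm (\<Sum>j<n. A $$ (i, j) * u $ j)"
    by (simp add: norm_mult[symmetric])
  also have "\<dots> \<le> (\<Sum>j<n. norm (A $$ (i, j)) * norm (u $ i))"
    by (rule order_trans[OF norm_sum sum_mono]) (simp add: norm_mult le mult_left_mono)
  also have "\<dots> = (\<Sum>j<n. norm (A $$ (i, j))) * norm (u $ i)"
    by (simp add: sum_distrib_right)
  also have "\<dots> \<le> K * norm (u $ i)"
    using K[OF i(1)] by (intro mult_right_mono) auto
  finally show ?thesis using pos by simp
qed

text \<open>If \<open>y\<close> acts on the span of finitely many numbers through an integer matrix, then \<open>y\<close> is an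
  eigenvalue of it, and the product of all nonzero eigenvalues is, up to sign, the lowest nonzero
  coefficient of the characteristic polynomial, hence an integer.\<close>

lemma integer_matrix_multiplier:
  fixes w :: "'e \<Rightarrow> complex" and M :: "'e \<Rightarrow> 'e \<Rightarrow> int" and K :: int
  assumes E: "finite E" and e0: "e0 \<in> E" "w e0 \<noteq> 0"
    and y: "\<And>e. e \<in> E \<Longrightarrow> y * w e = (\<Sum>f\<in>E. of_int (M e f) * w f)"
    and K: "\<And>e. e \<in> E \<Longrightarrow> (\<Sum>f\<in>E. \<bar>M e f\<bar>) \<le> K" "1 \<le> K"
  shows "algebraic_int y" "y = 0 \<or> 1 \<le> norm y * of_int K ^ card E"
proof -
  define n where "n = card E"
  obtain h where h: "bij_betw h {0..<n} E"
    using ex_bij_betw_nat_finite[OF E] unfolding n_def by blast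
  then have hE: "h i \<in> E" if "i < n" for i using that by (auto simp: bij_betw_def)
  have reindex: "(\<Sum>f\<in>E. g f) = (\<Sum>j<n. g (h j))" for g :: "'e \<Rightarrow> 'c::comm_monoid_add"
    using sum.reindex_bij_betw[OF h, of g] by (simp add: lessThan_atLeast0)
  define A :: "int mat" where "A = mat n n (\<lambda>(i, j). M (h i) (h j))"
  define C :: "complex mat" where "C = map_mat of_int A"
  have A: "A \<in> carrier_mat n n" and C: "C \<in> carrier_mat n n"
    by (simp_all add: A_def C_def)
  define v where "v = vec n (\<lambda>i. w (h i))"
  have "C *\<^sub>v v = y \<cdot>\<^sub>v v"
  proof (rule eq_vecI)
    fix i assume "i < dim_vec (y \<cdot>\<^sub>v v)"
    then have i: "i < n" by (simp add: v_def)
    have "(C *\<^sub>v v) $ i = (\<Sum>j<n. of_int (M (h i) (h j)) * w (h j))"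
      using i by (simp add: C_def A_def v_def scalar_prod_def lessThan_atLeast0)
    also have "\<dots> = y * w (h i)" using y[OF hE[OF i]] by (simp add: reindex)
    finally show "(C *\<^sub>v v) $ i = (y \<cdot>\<^sub>v v) $ i" using i by (simp add: v_def)
  qed (simp add: C_def A_def v_def)
  moreover have "v \<noteq> 0\<^sub>v n"
  proof
    assume v0: "v = 0\<^sub>v n"
    from e0 h obtain i where "i < n" "h i = e0" by (auto simp: bij_betw_def)
    then have "v $ i = w e0" by (simp add: v_def)
    with v0 \<open>i < n\<close> e0 show False by simp
  qed
  ultimately have "eigenvalue C y"
    unfolding eigenvalue_def eigenvector_def using C by (intro exI[of _ v]) (auto simp: v_def)
  then have root: "poly (char_poly C) y = 0"
    using eigenvalue_root_char_poly[OF C] by simp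
  have CA: "char_poly C = map_poly of_int (char_poly A)"
    unfolding C_def by (rule of_int_hom.char_poly_hom[OF A])
  show "algebraic_int y"
    unfolding algebraic_int_altdef_ipoly
    using root degree_monic_char_poly[OF A] by (auto simp: CA)
  show "y = 0 \<or> 1 \<le> norm y * of_int K ^ card E"
  proof (rule disjCI)
    assume "\<not> 1 \<le> norm y * of_int K ^ card E"
    show "y = 0"
    proof (rule ccontr)
      assume "y \<noteq> 0"
      obtain as where as: "char_poly C = (\<Prod>a\<leftarrow>as. [:- a, 1:])" "length as = n"
        using char_poly_factorized[OF C] by blast
      obtain k where k: "char_poly C = monom 1 k * (\<Prod>a\<leftarrow>filter (\<lambda>a. a \<noteq> 0) as. [:- a, 1:])"
        using prod_list_linear_factors[of as] as(1) by auto
      define bs where "bs = filter (\<lambda>a. a \<noteq> 0) as"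
      have "coeff (char_poly C) k = coeff (\<Prod>a\<leftarrow>bs. [:- a, 1:]) 0"
        unfolding k bs_def by (simp add: coeff_monom_mult)
      also have "\<dots> = (\<Prod>a\<leftarrow>bs. - a)"
        by (simp add: poly_0_coeff_0[symmetric] poly_prod_list o_def)
      finally have ck: "of_int (coeff (char_poly A) k) = (\<Prod>a\<leftarrow>bs. - a)"
        by (simp add: CA)
      have "(\<Prod>a\<leftarrow>bs. - a) \<noteq> 0"
        by (auto simp: bs_def prod_list_zero_iff)
      with ck have "coeff (char_poly A) k \<noteq> 0" by auto
      then have "1 \<le> \<bar>coeff (char_poly A) k\<bar>" by linarith
      then have "1 \<le> norm (of_int (coeff (char_poly A) k) :: complex)"
        by (simp del: of_int_abs add: of_int_abs[symmetric])
      also have "\<dots> = (\<Prod>a\<leftarrow>bs. norm a)"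
        unfolding ck by (induction bs) (auto simp: norm_mult)
      \<comment> \<open>All eigenvalues are at most \<open>K\<close> in modulus by the row sums, so
        a product of modulus at least 1 with \<open>y\<close> among its factors keeps
        \<open>y\<close> away from 0.\<close>
      also have "\<dots> \<le> norm y * of_int K ^ length (map norm bs)"
      proof (rule prod_list_le_mem_power)
        fix x assume "x \<in> set (map norm bs)"
        then obtain a where a: "a \<in> set as" "x = norm a" by (auto simp: bs_def)
        then have "poly (char_poly C) a = 0"
          unfolding as(1) by (auto simp: poly_prod_list prod_list_zero_iff)
        then have "eigenvalue C a" using eigenvalue_root_char_poly[OF C] by simp
        then have "norm a \<le> of_int K"
        proof (rule eigenvalue_norm_le_row_sum[OF C])
          fix i assume i: "i < n"
          have "(\<Sum>j<n. norm (C $$ (i, j))) = of_int (\<Sum>j<n. \<bar>M (h i) (h j)\<bar>)"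
            using i by (simp add: C_def A_def)
          also have "(\<Sum>j<n. \<bar>M (h i) (h j)\<bar>) \<le> K"
            using K(1)[OF hE[OF i]] by (simp add: reindex)
          finally show "(\<Sum>j<n. norm (C $$ (i, j))) \<le> of_int K" by simp
        qed
        then show "0 \<le> x \<and> x \<le> of_int K" using a by simp
      next
        show "1 \<le> real_of_int K" using K(2) by simp
        have "poly (\<Prod>a\<leftarrow>as. [:- a, 1:]) y = 0" using root as(1) by simp
        then have "y \<in> set as" by (auto simp: poly_prod_list prod_list_zero_iff)
        then show "norm y \<in> set (map norm bs)" using \<open>y \<noteq> 0\<close> by (auto simp: bs_def)
      qed
      also have "\<dots> \<le> norm y * of_int K ^ card E"
      proof (intro mult_left_mono power_increasing)
        show "length (map norm bs) \<le> card E"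
          using as(2) length_filter_le[of _ as] by (simp add: bs_def n_def)
      qed (use K(2) in auto)
      finally show False using \<open>\<not> 1 \<le> norm y * of_int K ^ card E\<close> by simp
    qed
  qed
qed

text \<open>Multiplication by \<open>x\<close> maps the integer span of the numbers
  \<open>w e\<close> to itself, by an integer matrix whose maximal absolute row sum is at most
  \<open>K\<close>. Such row sums are subadditive and submultiplicative, so \<open>K\<close> can be
  followed through sums and products of numbers \<open>x\<close> acting on the same span.\<close>

definition mult_bounded :: "'e set \<Rightarrow> ('e \<Rightarrow> complex) \<Rightarrow> int \<Rightarrow> complex \<Rightarrow> bool" where
  "mult_bounded E w K x \<longleftrightarrow> (\<forall>e\<in>E. \<exists>c :: 'e \<Rightarrow> int.
     x * w e = (\<Sum>f\<in>E. of_int (c f) * w f) \<and> (\<Sum>f\<in>E. \<bar>c f\<bar>) \<le> K)"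

lemma mult_bounded_0: "mult_bounded E w 0 0"
  unfolding mult_bounded_def by (intro ballI exI[of _ "\<lambda>_. 0"]) simp

lemma mult_bounded_mono: "mult_bounded E w K x \<Longrightarrow> K \<le> K' \<Longrightarrow> mult_bounded E w K' x"
  unfolding mult_bounded_def by (meson order_trans)

lemma mult_bounded_add:
  assumes "mult_bounded E w K x" "mult_bounded E w L y"
  shows "mult_bounded E w (K + L) (x + y)"
  unfolding mult_bounded_def
proof
  fix e assume "e \<in> E"
  with assms obtain c d where c: "x * w e = (\<Sum>f\<in>E. of_int (c f) * w f)" "(\<Sum>f\<in>E. \<bar>c f\<bar>) \<le> K"
    and d: "y * w e = (\<Sum>f\<in>E. of_int (d f) * w f)" "(\<Sum>f\<in>E. \<bar>d f\<bar>) \<le> L"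
    unfolding mult_bounded_def by meson
  have "(x + y) * w e = (\<Sum>f\<in>E. of_int (c f + d f) * w f)"
    by (simp add: distrib_right c d sum.distrib)
  moreover have "(\<Sum>f\<in>E. \<bar>c f + d f\<bar>) \<le> (\<Sum>f\<in>E. \<bar>c f\<bar> + \<bar>d f\<bar>)"
    by (rule sum_mono) (rule abs_triangle_ineq)
  then have "(\<Sum>f\<in>E. \<bar>c f + d f\<bar>) \<le> K + L"
    using c(2) d(2) by (simp add: sum.distrib)
  ultimately show "\<exists>c. (x + y) * w e = (\<Sum>f\<in>E. of_int (c f) * w f) \<and> (\<Sum>f\<in>E. \<bar>c f\<bar>) \<le> K + L"
    by (intro exI[of _ "\<lambda>f. c f + d f"] conjI)
qed

lemma mult_bounded_mult:
  assumes x: "mult_bounded E w K x" and y: "mult_bounded E w L y" and "0 \<le> K"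
  shows "mult_bounded E w (K * L) (x * y)"
  unfolding mult_bounded_def
proof
  fix e assume "e \<in> E"
  with y obtain d where d: "y * w e = (\<Sum>f\<in>E. of_int (d f) * w f)" "(\<Sum>f\<in>E. \<bar>d f\<bar>) \<le> L"
    unfolding mult_bounded_def by meson
  from x have "\<forall>f. \<exists>c. f \<in> E \<longrightarrow> x * w f = (\<Sum>g\<in>E. of_int (c g) * w g) \<and> (\<Sum>g\<in>E. \<bar>c g\<bar>) \<le> K"
    unfolding mult_bounded_def by blast
  from choice[OF this] obtain c where c: "\<And>f. f \<in> E \<Longrightarrow> x * w f = (\<Sum>g\<in>E. of_int (c f g) * w g)"
    "\<And>f. f \<in> E \<Longrightarrow> (\<Sum>g\<in>E. \<bar>c f g\<bar>) \<le> K" by blast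
  have "x * y * w e = (\<Sum>f\<in>E. of_int (d f) * (x * w f))"
    using d(1) by (simp add: mult.assoc sum_distrib_left mult.left_commute)
  also have "\<dots> = (\<Sum>f\<in>E. \<Sum>g\<in>E. of_int (d f * c f g) * w g)"
    by (intro sum.cong refl) (simp add: c(1) sum_distrib_left mult.assoc)
  also have "\<dots> = (\<Sum>g\<in>E. of_int (\<Sum>f\<in>E. d f * c f g) * w g)"
    by (subst sum.swap) (simp add: sum_distrib_right)
  finally have "x * y * w e = (\<Sum>g\<in>E. of_int (\<Sum>f\<in>E. d f * c f g) * w g)" .
  moreover have "(\<Sum>g\<in>E. \<bar>\<Sum>f\<in>E. d f * c f g\<bar>) \<le> K * L"
  proof -
    have "(\<Sum>g\<in>E. \<bar>\<Sum>f\<in>E. d f * c f g\<bar>) \<le> (\<Sum>g\<in>E. \<Sum>f\<in>E. \<bar>d f\<bar> * \<bar>c f g\<bar>)"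
      by (intro sum_mono order_trans[OF sum_abs]) (simp add: abs_mult)
    also have "\<dots> = (\<Sum>f\<in>E. \<bar>d f\<bar> * (\<Sum>g\<in>E. \<bar>c f g\<bar>))"
      by (subst sum.swap) (simp add: sum_distrib_left)
    also have "\<dots> \<le> (\<Sum>f\<in>E. \<bar>d f\<bar> * K)"
      by (intro sum_mono mult_left_mono c(2)) auto
    also have "\<dots> = (\<Sum>f\<in>E. \<bar>d f\<bar>) * K" by (simp add: sum_distrib_right)
    also have "\<dots> \<le> L * K" using d(2) assms(3) by (intro mult_right_mono) auto
    finally show ?thesis by (simp add: mult.commute)
  qed
  ultimately show "\<exists>c. x * y * w e = (\<Sum>f\<in>E. of_int (c f) * w f) \<and> (\<Sum>f\<in>E. \<bar>c f\<bar>) \<le> K * L"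
    by (intro exI[of _ "\<lambda>g. \<Sum>f\<in>E. d f * c f g"] conjI)
qed

text \<open>Multiplying a monomial by \<open>x z\<close> raises one exponent. Either the result is
  again a monomial of the family, a row with a single 1, or the exponent has reached
  \<open>B\<close> and the monic relation for \<open>x z\<close> rewrites it, a row made of the
  coefficients \<open>c\<close>.\<close>

lemma mult_bounded_monomials:
  fixes x :: "'z \<Rightarrow> complex"
  assumes Z: "finite Z" "z \<in> Z" and B: "1 \<le> K"
    and rel: "x z ^ B = (\<Sum>j<B. of_int (c j) * x z ^ j)" "(\<Sum>j<B. \<bar>c j\<bar>) \<le> K"
  shows "mult_bounded (PiE Z (\<lambda>_. {..<B})) (\<lambda>e. \<Prod>u\<in>Z. x u ^ e u) K (x z)"
  unfolding mult_bounded_def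
proof
  let ?E = "PiE Z (\<lambda>_. {..<B})" and ?w = "\<lambda>e. \<Prod>u\<in>Z. x u ^ e u"
  fix e assume e: "e \<in> ?E"
  have fin: "finite ?E" using Z by (intro finite_PiE) auto
  obtain d where d: "x z ^ Suc (e z) = (\<Sum>j<B. of_int (d j) * x z ^ j)" "(\<Sum>j<B. \<bar>d j\<bar>) \<le> K"
  proof (cases "Suc (e z) < B")
    case True
    show ?thesis
    proof (rule that[of "\<lambda>j. if j = Suc (e z) then 1 else 0"])
      have "(\<Sum>j<B. of_int (if j = Suc (e z) then 1 else 0) * x z ^ j) = (\<Sum>j<B. if j = Suc (e z) then x z ^ j else 0)"
        by (intro sum.cong) auto
      then show "x z ^ Suc (e z) = (\<Sum>j<B. of_int (if j = Suc (e z) then 1 else 0) * x z ^ j)"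
        using True by simp
      have "(\<Sum>j<B. \<bar>if j = Suc (e z) then 1 else 0 :: int\<bar>) = (\<Sum>j<B. if j = Suc (e z) then 1 else 0)"
        by (intro sum.cong) auto
      then show "(\<Sum>j<B. \<bar>if j = Suc (e z) then 1 else 0\<bar>) \<le> K"
        using True B by simp
    qed
  next
    case False
    moreover have "e z < B" using e Z by auto
    ultimately have "Suc (e z) = B" by simp
    with rel show ?thesis by (intro that[of c]) auto
  qed
  define R where "R = (\<Prod>u\<in>Z - {z}. x u ^ e u)"
  have w_upd: "?w (e(z := j)) = x z ^ j * R" for j
  proof -
    have "(\<Prod>u\<in>Z - {z}. x u ^ (e(z := j)) u) = R" unfolding R_def by (intro prod.cong) auto
    then show ?thesis unfolding prod.remove[OF Z] by simp
  qed
  have w: "?w e = x z ^ e z * R"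
    using w_upd[of "e z"] by simp
  define G where "G = (\<lambda>j. e(z := j)) ` {..<B}"
  have G: "G \<subseteq> ?E" unfolding G_def using e Z by (auto simp: PiE_iff extensional_def)
  have inj: "inj_on (\<lambda>j. e(z := j)) {..<B}"
    by (rule inj_onI) (metis fun_upd_same)
  define c' where "c' f = (if f \<in> G then d (f z) else 0)" for f
  have "(\<Sum>f\<in>?E. of_int (c' f) * ?w f) = (\<Sum>f\<in>G. of_int (d (f z)) * ?w f)"
    using G fin by (intro sum.mono_neutral_cong_right) (auto simp: c'_def)
  also have "\<dots> = (\<Sum>j<B. of_int (d j) * (x z ^ j * R))"
    unfolding G_def by (subst sum.reindex[OF inj]) (simp only: o_def fun_upd_same w_upd)
  also have "\<dots> = (\<Sum>j<B. of_int (d j) * x z ^ j) * R"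
    by (simp add: sum_distrib_right mult.assoc)
  also have "\<dots> = x z * ?w e"
    unfolding w d(1)[symmetric] by simp
  finally have 1: "x z * ?w e = (\<Sum>f\<in>?E. of_int (c' f) * ?w f)" by simp
  have "(\<Sum>f\<in>?E. \<bar>c' f\<bar>) = (\<Sum>f\<in>G. \<bar>d (f z)\<bar>)"
    using G fin by (intro sum.mono_neutral_cong_right) (auto simp: c'_def)
  also have "\<dots> = (\<Sum>j<B. \<bar>d j\<bar>)"
    unfolding G_def by (subst sum.reindex[OF inj]) simp
  finally have "(\<Sum>f\<in>?E. \<bar>c' f\<bar>) \<le> K" using d(2) by simp
  with 1 show "\<exists>c. x z * ?w e = (\<Sum>f\<in>?E. of_int (c f) * ?w f) \<and> (\<Sum>f\<in>?E. \<bar>c f\<bar>) \<le> K"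
    by blast
qed

text \<open>One number bounds both the length of the coefficient list and the coefficients, so
  finitely many algebraic numbers always share a bound. The degree of the polynomial is below
  \<open>B\<close>.\<close>

definition small_root :: "nat \<Rightarrow> complex \<Rightarrow> bool" where
  "small_root B z \<longleftrightarrow> (\<exists>as :: int list. length as \<le> B \<and> (\<forall>a\<in>set as. \<bar>a\<bar> \<le> int B) \<and>
     (Poly (map of_int as) :: complex poly) \<noteq> 0 \<and> poly (Poly (map of_int as)) z = 0)"

lemma small_root_pos: "small_root B z \<Longrightarrow> B > 0"
  unfolding small_root_def by (cases B) auto

lemma small_root_mono:
  assumes "small_root B z" "B \<le> C"
  shows "small_root C z"
proof -
  from assms(1) obtain as :: "int list" where "length as \<le> B" "\<forall>a\<in>set as. \<bar>a\<bar> \<le> int B"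
    "(Poly (map of_int as) :: complex poly) \<noteq> 0" "poly (Poly (map of_int as)) z = 0"
    unfolding small_root_def by blast
  then show ?thesis
    unfolding small_root_def using assms(2) by (intro exI[of _ as]) force
qed

definition lead_mult :: "nat \<Rightarrow> nat" where
  "lead_mult B = fact B"

text \<open>There are \<open>B\<close> coefficients, each at most
  \<open>B * lead_mult B ^ B\<close>; the successor keeps the bound at least 1, as
  \<open>mult_bounded_monomials\<close> demands.\<close>

definition row_bound :: "nat \<Rightarrow> nat" where
  "row_bound B = Suc (B * (B * lead_mult B ^ B))"

text \<open>The factor \<open>lead_mult B\<close> is divisible by every possible leading coefficient, so it turns
  each root into an algebraic integer.\<close>

lemma small_root_integral_relation:
  assumes "small_root B z"
  obtains c :: "nat \<Rightarrow> int"
  where "(of_nat (lead_mult B) * z) ^ B = (\<Sum>j<B. of_int (c j) * (of_nat (lead_mult B) * z) ^ j)"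
    "(\<Sum>j<B. \<bar>c j\<bar>) \<le> int (row_bound B)"
proof -
  from assms obtain as :: "int list" where as: "length as \<le> B" "\<forall>a\<in>set as. \<bar>a\<bar> \<le> int B"
    "(Poly (map of_int as) :: complex poly) \<noteq> 0" "poly (Poly (map of_int as)) z = 0"
    unfolding small_root_def by blast
  define p :: "complex poly" where "p = Poly (map of_int as)"
  define d where "d = degree p"
  define a where "a i = (if i < length as then as ! i else 0)" for i
  have coeff_p: "coeff p i = of_int (a i)" for i
    by (simp add: p_def a_def nth_default_def)
  have a_le: "\<bar>a i\<bar> \<le> int B" for i using as(2) by (auto simp: a_def)
  have ad: "a d \<noteq> 0"
    using as(3) coeff_p[of d] by (auto simp: d_def p_def[symmetric])
  then have dB: "d < B" using as(1) by (auto simp: a_def split: if_splits)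
  define A where "A = int (lead_mult B)"
  have "nat \<bar>a d\<bar> dvd fact B"
    using ad a_le[of d] by (intro dvd_fact) auto
  then have "int (nat \<bar>a d\<bar>) dvd A"
    unfolding A_def lead_mult_def by (subst int_dvd_int_iff)
  then have dvd: "a d dvd A" by simp
  have A1: "1 \<le> A" unfolding A_def lead_mult_def using fact_ge_1[of B, where 'a = int] by simp
  \<comment> \<open>Multiply \<open>a d * z ^ d = - (...)\<close> by
    \<open>A ^ B * z ^ (B - d) / a d\<close> and collect powers of \<open>A * z\<close>. For
    \<open>j < B\<close> at least one factor \<open>A\<close> is left over in
    \<open>A ^ (B - j)\<close>, so the division by \<open>a d\<close> is exact.\<close>
  define c where "c j = (if j < B - d then 0 else - a (j - (B - d)) * (A ^ (B - j) div a d))" for j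
  show thesis
  proof (rule that[of c])
    have lead: "of_int (a d) * z ^ d = - (\<Sum>i<d. of_int (a i) * z ^ i)"
    proof -
      have "0 = (\<Sum>i\<le>d. coeff p i * z ^ i)"
        using as(4) by (simp add: poly_altdef d_def p_def[symmetric])
      also have "\<dots> = (\<Sum>i<d. of_int (a i) * z ^ i) + of_int (a d) * z ^ d"
        by (simp add: coeff_p lessThan_Suc_atMost[symmetric])
      finally show ?thesis by (simp add: eq_neg_iff_add_eq_0 add.commute)
    qed
    let ?q = "of_int (A ^ B) / of_int (a d) :: complex"
    have tm: "of_int (c j) * (of_int A * z) ^ j = - (?q * z ^ (B - d) * (of_int (a (j - (B - d))) * z ^ (j - (B - d))))"
      if j: "B - d \<le> j" "j < B" for j
    proof -
      have "a d dvd A ^ (B - j)" using j by (intro dvd_trans[OF dvd dvd_power]) auto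
      then have "of_int (A ^ (B - j) div a d) = (of_int (A ^ (B - j)) / of_int (a d) :: complex)"
        by (rule of_int_div)
      then have "of_int (c j) = - (of_int (a (j - (B - d))) * (of_int A ^ (B - j) / of_int (a d)) :: complex)"
        using j by (simp add: c_def)
      moreover have "(of_int A :: complex) ^ B = of_int A ^ (B - j) * of_int A ^ j"
        using j by (simp add: power_add[symmetric])
      moreover have "z ^ j = z ^ (B - d) * z ^ (j - (B - d))"
        using j by (simp add: power_add[symmetric])
      ultimately show ?thesis by (simp add: power_mult_distrib)
    qed
    have "(\<Sum>j<B. of_int (c j) * (of_int A * z) ^ j) = (\<Sum>j\<in>{B - d..<B}. of_int (c j) * (of_int A * z) ^ j)"
      by (intro sum.mono_neutral_right) (auto simp: c_def)
    also have "\<dots> = (\<Sum>j\<in>{B - d..<B}. - (?q * z ^ (B - d) * (of_int (a (j - (B - d))) * z ^ (j - (B - d)))))"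
      by (intro sum.cong refl tm) auto
    also have "\<dots> = (\<Sum>i<d. - (?q * z ^ (B - d) * (of_int (a i) * z ^ i)))"
      by (rule sum.reindex_bij_witness[of _ "\<lambda>i. i + (B - d)" "\<lambda>j. j - (B - d)"]) (use dB in auto)
    also have "\<dots> = ?q * z ^ (B - d) * - (\<Sum>i<d. of_int (a i) * z ^ i)"
      by (simp add: sum_distrib_left sum_negf)
    also have "\<dots> = ?q * z ^ (B - d) * (of_int (a d) * z ^ d)" unfolding lead ..
    also have "\<dots> = of_int (A ^ B) * (z ^ (B - d) * z ^ d)" using ad by simp
    also have "\<dots> = (of_int A * z) ^ B"
      using dB by (simp add: power_add[symmetric] power_mult_distrib)
    finally show "(of_nat (lead_mult B) * z) ^ B = (\<Sum>j<B. of_int (c j) * (of_nat (lead_mult B) * z) ^ j)"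
      by (simp add: A_def)
    have "\<bar>c j\<bar> \<le> int B * A ^ B" if "j < B" for j
    proof -
      have "a d dvd A ^ (B - j)" using that by (intro dvd_trans[OF dvd dvd_power]) auto
      then obtain q where q: "A ^ (B - j) = a d * q" ..
      have "1 * \<bar>q\<bar> \<le> \<bar>a d\<bar> * \<bar>q\<bar>" using ad by (intro mult_right_mono) auto
      then have "\<bar>A ^ (B - j) div a d\<bar> \<le> \<bar>A ^ (B - j)\<bar>"
        unfolding q abs_mult using ad by simp
      also have "\<dots> \<le> A ^ B" using A1 by (simp add: power_increasing)
      finally show ?thesis
        using a_le[of "j - (B - d)"] A1 by (auto simp: c_def abs_mult intro!: mult_mono)
    qed
    then have "(\<Sum>j<B. \<bar>c j\<bar>) \<le> (\<Sum>j<B. int B * A ^ B)" by (intro sum_mono) auto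
    then show "(\<Sum>j<B. \<bar>c j\<bar>) \<le> int (row_bound B)"
      by (simp add: row_bound_def A_def)
  qed
qed

text \<open>The square of \<open>lead_mult B\<close> clears denominators in products of two numbers,
  \<open>N * row_bound B ^ 2 + 1\<close> bounds the row sums of a sum of \<open>N\<close> products,
  and at most \<open>2 * N\<close> numbers with exponents below \<open>B\<close> give at most
  \<open>B ^ (2 * N)\<close> monomials, the size of the matrix.\<close>

definition sep_bound :: "nat \<Rightarrow> nat \<Rightarrow> nat" where
  "sep_bound B N = lead_mult B ^ 2 * Suc (N * row_bound B ^ 2) ^ (B ^ (2 * N))"

lemma sum_products_integral:
  assumes L: "\<And>a b. (a, b) \<in> set L \<Longrightarrow> small_root B a \<and> small_root B b"
  defines "s \<equiv> (\<Sum>(a, b)\<leftarrow>L. a * b)" and "A \<equiv> of_nat (lead_mult B) :: complex"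
  shows "algebraic_int (A\<^sup>2 * s)" "s = 0 \<or> 1 \<le> norm s * sep_bound B (length L)"
proof -
  define Z where "Z = set (map fst L) \<union> set (map snd L)"
  define K where "K = int (row_bound B)"
  have K: "1 \<le> K" by (simp add: K_def row_bound_def)
  have Z: "finite Z" by (simp add: Z_def)
  define E where "E = PiE Z (\<lambda>_. {..<B})"
  define w where "w e = (\<Prod>u\<in>Z. (A * u) ^ e u)" for e
  have base: "mult_bounded E w K (A * z)" if "z \<in> Z" for z
  proof -
    have "small_root B z" using that L by (auto simp: Z_def)
    then obtain c where "(A * z) ^ B = (\<Sum>j<B. of_int (c j) * (A * z) ^ j)" "(\<Sum>j<B. \<bar>c j\<bar>) \<le> K"
      unfolding A_def K_def by (rule small_root_integral_relation)
    from mult_bounded_monomials[where x = "\<lambda>u. A * u", OF Z that K this] show ?thesis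
      unfolding E_def w_def .
  qed
  have "mult_bounded E w (int (length L') * K\<^sup>2) (A\<^sup>2 * (\<Sum>(a, b)\<leftarrow>L'. a * b))" if "set L' \<subseteq> set L" for L'
    using that
  proof (induction L')
    case Nil
    then show ?case by (simp add: mult_bounded_0)
  next
    case (Cons p L')
    obtain a b where p: "p = (a, b)" by (cases p)
    with Cons.prems have "(a, b) \<in> set L" by auto
    then have "a \<in> Z" "b \<in> Z" by (force simp: Z_def)+
    then have "mult_bounded E w (K * K) ((A * a) * (A * b))"
      using K by (intro mult_bounded_mult base) auto
    with Cons have "mult_bounded E w (K * K + int (length L') * K\<^sup>2)
        ((A * a) * (A * b) + A\<^sup>2 * (\<Sum>(a, b)\<leftarrow>L'. a * b))"
      by (intro mult_bounded_add) auto
    then show ?case by (simp add: p power2_eq_square algebra_simps)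
  qed
  \<comment> \<open>The added 1 keeps the row bound at least 1 for the empty list.\<close>
  from this[OF subset_refl] have "mult_bounded E w (int (length L) * K\<^sup>2 + 1) (A\<^sup>2 * s)"
    unfolding s_def by (rule mult_bounded_mono) simp
  then have "\<forall>e. \<exists>c. e \<in> E \<longrightarrow> A\<^sup>2 * s * w e = (\<Sum>f\<in>E. of_int (c f) * w f) \<and> (\<Sum>f\<in>E. \<bar>c f\<bar>) \<le> int (length L) * K\<^sup>2 + 1"
    unfolding mult_bounded_def by blast
  from choice[OF this] obtain M where M: "\<And>e. e \<in> E \<Longrightarrow> A\<^sup>2 * s * w e = (\<Sum>f\<in>E. of_int (M e f) * w f)"
    "\<And>e. e \<in> E \<Longrightarrow> (\<Sum>f\<in>E. \<bar>M e f\<bar>) \<le> int (length L) * K\<^sup>2 + 1" by blast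
  show "algebraic_int (A\<^sup>2 * s)" and "s = 0 \<or> 1 \<le> norm s * sep_bound B (length L)"
  proof -
    \<comment> \<open>Any number with \<open>small_root B\<close> forces \<open>B > 0\<close>. So
      \<open>B = 0\<close> leaves only the empty list, and then the one monomial is the empty
      product.\<close>
    have "B > 0 \<or> Z = {}"
      using L by (cases L) (auto dest!: small_root_pos simp: Z_def)
    then have e0: "restrict (\<lambda>_. 0) Z \<in> E" by (auto simp: E_def)
    have w0: "w (restrict (\<lambda>_. 0) Z) \<noteq> 0" by (simp add: w_def)
    have finE: "finite E" using Z by (auto simp: E_def intro: finite_PiE)
    have K1: "1 \<le> int (length L) * K\<^sup>2 + 1" by simp
    note * = integer_matrix_multiplier[where M = M and y = "A\<^sup>2 * s", OF finE e0 w0 M K1]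
    show "algebraic_int (A\<^sup>2 * s)" by (rule *(1))
    show "s = 0 \<or> 1 \<le> norm s * sep_bound B (length L)"
    proof (cases "s = 0")
      case False
      have A0: "A \<noteq> 0" by (simp add: A_def lead_mult_def)
      have "1 \<le> norm (A\<^sup>2 * s) * of_int (int (length L) * K\<^sup>2 + 1) ^ card E"
        using *(2) False A0 by auto
      also have "of_int (int (length L) * K\<^sup>2 + 1) = real (Suc (length L * row_bound B ^ 2))"
        by (simp add: K_def)
      also have "norm (A\<^sup>2 * s) * real (Suc (length L * row_bound B ^ 2)) ^ card E
         \<le> norm (A\<^sup>2 * s) * real (Suc (length L * row_bound B ^ 2)) ^ (B ^ (2 * length L))"
      proof (intro mult_left_mono power_increasing)
        have "card Z \<le> length L + length L"
          unfolding Z_def using card_Un_le[of "set (map fst L)" "set (map snd L)"]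
            card_length[of "map fst L"] card_length[of "map snd L"] by simp
        then have "B ^ card Z \<le> B ^ (2 * length L) \<or> B = 0" by (cases "B = 0") (auto intro!: power_increasing)
        moreover have "B = 0 \<Longrightarrow> Z = {}" using \<open>B > 0 \<or> Z = {}\<close> by simp
        moreover have "B = 0 \<Longrightarrow> L = []" using \<open>B > 0 \<or> Z = {}\<close> by (auto simp: Z_def)
        ultimately show "card E \<le> B ^ (2 * length L)"
          using Z by (auto simp: E_def card_PiE)
      qed auto
      also have "\<dots> = norm s * sep_bound B (length L)"
        by (simp add: sep_bound_def norm_mult norm_power A_def)
      finally show ?thesis ..
    qed simp
  qed
qed

section \<open>Closure of the complex algebraic numbers under field operations\<close>

lemma algebraic_small_root:
  assumes "algebraic z"
  obtains B where "small_root B z"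
proof -
  from assms obtain p where p: "\<forall>i. coeff p i \<in> \<int>" "p \<noteq> 0" "poly p z = 0"
    unfolding algebraic_def by blast
  then have "\<forall>i. \<exists>k::int. coeff p i = of_int k" by (auto elim: Ints_cases)
  from choice[OF this] obtain a where a: "\<And>i. coeff p i = of_int (a i)" by blast
  define as where "as = map a [0..<Suc (degree p)]"
  have "Poly (map of_int as) = p"
    by (rule poly_eqI) (auto simp: as_def nth_default_def a[symmetric] coeff_eq_0 simp del: upt_Suc)
  moreover define B where "B = length as + sum_list (map (\<lambda>a. nat \<bar>a\<bar>) as)"
  have "\<bar>x\<bar> \<le> int B" if "x \<in> set as" for x
    using member_le_sum_list[of "nat \<bar>x\<bar>" "map (\<lambda>a. nat \<bar>a\<bar>) as"] that by (auto simp: B_def)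
  ultimately have "small_root B z"
    unfolding small_root_def using p by (intro exI[of _ as]) (auto simp: B_def)
  then show thesis by (rule that)
qed

lemma algebraic_of_int_mult:
  fixes s :: complex
  assumes "algebraic_int (of_nat k * s)" "k \<noteq> 0"
  shows "algebraic s"
proof -
  obtain p :: "int poly" where p: "poly (map_poly of_int p) (of_nat k * s) = 0" "lead_coeff p = 1"
    using assms(1) unfolding algebraic_int_altdef_ipoly by blast
  define q :: "int poly" where "q = pcompose p [:0, int k:]"
  have "q \<noteq> 0" unfolding q_def using p(2) assms(2) by (subst pcompose_eq_0_iff) auto
  show ?thesis
  proof (rule algebraicI[of "map_poly of_int q"])
    show "map_poly of_int q \<noteq> (0 :: complex poly)" using \<open>q \<noteq> 0\<close> by simp
    show "poly (map_poly of_int q) s = 0"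
      using p(1) by (simp add: q_def of_int_hom.map_poly_pcompose poly_pcompose of_int_hom.map_poly_pCons_hom mult.commute)
  qed simp
qed

text \<open>Closure under addition and multiplication comes out of the separation argument: finitely
  many algebraic numbers share a bound \<open>B\<close>, and \<open>lead_mult B ^ 2\<close> times
  the sum is an algebraic integer.\<close>

lemma algebraic_sum_list_products:
  assumes "\<And>a b. (a, b) \<in> set L \<Longrightarrow> algebraic a \<and> algebraic (b :: complex)"
  shows "algebraic (\<Sum>(a, b)\<leftarrow>L. a * b)"
proof -
  have "\<exists>B. \<forall>(a, b)\<in>set L'. small_root B a \<and> small_root B b" if "set L' \<subseteq> set L" for L'
    using that
  proof (induction L')
    case (Cons p L')
    obtain a b where p: "p = (a, b)" by (cases p)
    with assms Cons.prems have "algebraic a" "algebraic b" by auto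
    then obtain C D where CD: "small_root C a" "small_root D b" by (metis algebraic_small_root)
    from Cons obtain B where "\<forall>(a, b)\<in>set L'. small_root B a \<and> small_root B b" by auto
    with CD show ?case
      by (intro exI[of _ "max B (max C D)"]) (fastforce simp: p elim: small_root_mono)
  qed simp
  then obtain B where "\<forall>(a, b)\<in>set L. small_root B a \<and> small_root B b" by blast
  from sum_products_integral(1)[of L B] this
  have "algebraic_int (of_nat (lead_mult B ^ 2) * (\<Sum>(a, b)\<leftarrow>L. a * b))" by auto
  then show ?thesis by (rule algebraic_of_int_mult) (simp add: lead_mult_def)
qed

lemma algebraic_mult [intro]: "algebraic a \<Longrightarrow> algebraic b \<Longrightarrow> algebraic (a * b :: complex)"
  using algebraic_sum_list_products[of "[(a, b)]"] by simp

lemma algebraic_add [intro]: "algebraic a \<Longrightarrow> algebraic b \<Longrightarrow> algebraic (a + b :: complex)"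
  using algebraic_sum_list_products[of "[(a, 1), (b, 1)]"] by (auto simp: rat_imp_algebraic)

lemma algebraic_diff [intro]: "algebraic a \<Longrightarrow> algebraic b \<Longrightarrow> algebraic (a - b :: complex)"
  using algebraic_add[of a "- b"] by auto

lemma algebraic_divide [intro]: "algebraic a \<Longrightarrow> algebraic b \<Longrightarrow> algebraic (a / b :: complex)"
  unfolding divide_inverse by auto

section \<open>Approximating coded algebraic numbers\<close>

abbreviation ipoly :: "int list \<Rightarrow> complex poly" where
  "ipoly as \<equiv> Poly (map of_int as)"

definition abs_sum :: "int list \<Rightarrow> nat" where
  "abs_sum as = sum_list (map (\<lambda>a. nat \<bar>a\<bar>) as)"

lemma abs_sum_simps [simp]: "abs_sum [] = 0" "abs_sum (a # as) = nat \<bar>a\<bar> + abs_sum as"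
  by (simp_all add: abs_sum_def)

lemma poly_ipoly_simps [simp]:
  "poly (ipoly []) z = 0" "poly (ipoly (a # as)) z = of_int a + z * poly (ipoly as) z"
  by simp_all

lemma poly_ipoly_cnj: "poly (ipoly as) (cnj z) = cnj (poly (ipoly as) z)"
  by (induction as) simp_all

lemma norm_poly_ipoly_le:
  fixes r :: real
  assumes "norm z \<le> r" "1 \<le> r"
  shows "norm (poly (ipoly as) z) \<le> abs_sum as * r ^ length as"
proof (induction as)
  case (Cons a as)
  have "norm (poly (ipoly (a # as)) z) \<le> norm (of_int a :: complex) + norm z * norm (poly (ipoly as) z)"
    by (simp add: norm_triangle_mono norm_mult)
  also have "\<dots> \<le> \<bar>of_int a\<bar> * r ^ Suc (length as) + r * (abs_sum as * r ^ length as)"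
  proof (intro add_mono mult_mono Cons assms)
    show "norm (of_int a :: complex) \<le> \<bar>of_int a\<bar> * r ^ Suc (length as)"
      using one_le_power[OF assms(2), of "Suc (length as)"] by (simp add: mult_le_cancel_left1 del: power_Suc)
  qed (use assms in auto)
  also have "\<dots> = abs_sum (a # as) * r ^ length (a # as)"
    by (simp add: algebra_simps)
  finally show ?case .
qed simp

text \<open>Horner's scheme with \<open>q p(q) - z p(z) = q (p(q) - p(z)) + (q - z) p(z)\<close>;
  each coefficient contributes one more term of the second kind, whence the factor
  \<open>length as\<close>.\<close>

lemma poly_ipoly_Lipschitz:
  fixes r :: real
  assumes "norm z \<le> r" "norm q \<le> r" "1 \<le> r"
  shows "norm (poly (ipoly as) q - poly (ipoly as) z) \<le> length as * abs_sum as * r ^ length as * norm (q - z)"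
proof (induction as)
  case (Cons a as)
  let ?p = "poly (ipoly as)" and ?S = "real (abs_sum as)" and ?n = "length as"
  have "poly (ipoly (a # as)) q - poly (ipoly (a # as)) z = q * (?p q - ?p z) + (q - z) * ?p z"
    by (simp add: algebra_simps)
  also have "norm \<dots> \<le> norm q * norm (?p q - ?p z) + norm (q - z) * norm (?p z)"
    by (metis norm_mult norm_triangle_ineq)
  also have "\<dots> \<le> r * (?n * ?S * r ^ ?n * norm (q - z)) + norm (q - z) * (?S * r ^ ?n)"
    by (intro add_mono mult_mono Cons[unfolded of_nat_mult] norm_poly_ipoly_le assms order_refl) (use assms in auto)
  also have "\<dots> \<le> r * (?n * ?S * r ^ ?n * norm (q - z)) + norm (q - z) * (?S * (r * r ^ ?n))"
    using assms(3) by (intro add_left_mono mult_left_mono) (auto simp: mult_le_cancel_right1)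
  also have "\<dots> = Suc ?n * ?S * r ^ Suc ?n * norm (q - z)"
    by (simp add: algebra_simps)
  also have "\<dots> \<le> real (Suc ?n) * real (abs_sum (a # as)) * r ^ Suc ?n * norm (q - z)"
  proof -
    have "?S \<le> real (abs_sum (a # as))" by simp
    then show ?thesis using assms(3) by (intro mult_right_mono mult_left_mono) auto
  qed
  finally show ?case by (simp only: of_nat_mult length_Cons)
qed simp

definition int_coeff :: "int list \<Rightarrow> nat \<Rightarrow> int" where
  "int_coeff as i = (if i < length as then as ! i else 0)"

lemma coeff_ipoly: "coeff (ipoly as) i = of_int (int_coeff as i)"
  by (simp add: int_coeff_def nth_default_def)

lemma degree_ipoly_less: "ipoly as \<noteq> 0 \<Longrightarrow> degree (ipoly as) < length as"
  using coeff_ipoly[of as "degree (ipoly as)"]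
  by (auto simp: int_coeff_def simp del: coeff_Poly_eq split: if_splits)

lemma norm_lead_coeff_ipoly_ge_1:
  assumes "ipoly as \<noteq> 0"
  shows "1 \<le> norm (lead_coeff (ipoly as))"
proof -
  have "int_coeff as (degree (ipoly as)) \<noteq> 0"
    using assms coeff_ipoly[of as "degree (ipoly as)"] by (auto simp del: coeff_Poly_eq)
  then have "1 \<le> \<bar>int_coeff as (degree (ipoly as))\<bar>" by linarith
  then show ?thesis
    unfolding coeff_ipoly by (simp del: of_int_abs add: of_int_abs[symmetric])
qed

text \<open>A bound of Cauchy's type. The leading coefficient is a nonzero integer and so has
  modulus at least 1; for a root outside the unit disc the top term is balanced by lower terms of
  total size at most \<open>abs_sum as\<close> times one power less.\<close>

lemma root_norm_le:
  assumes p: "ipoly as \<noteq> 0" and z: "poly (ipoly as) z = 0"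
  shows "norm z \<le> Suc (abs_sum as)"
proof (cases "norm z \<le> 1")
  case False
  define d where "d = degree (ipoly as)"
  define c where "c i = coeff (ipoly as) i" for i
  have sum0: "(\<Sum>i<d. c i * z ^ i) + c d * z ^ d = 0"
    using z by (simp add: poly_altdef d_def c_def lessThan_Suc_atMost[symmetric])
  have lead: "1 \<le> norm (c d)" using norm_lead_coeff_ipoly_ge_1[OF p] by (simp add: c_def d_def)
  have "d \<noteq> 0" using sum0 lead by (intro notI) auto
  have S: "(\<Sum>i<d. norm (c i)) \<le> abs_sum as"
  proof -
    have "(\<Sum>i<d. norm (c i)) \<le> (\<Sum>i<length as. norm (c i))"
      using degree_ipoly_less[OF p] by (intro sum_mono2) (auto simp: d_def)
    also have "\<dots> = real (\<Sum>i<length as. nat \<bar>as ! i\<bar>)"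
      by (simp add: c_def coeff_ipoly int_coeff_def del: coeff_Poly_eq)
    also have "(\<Sum>i<length as. nat \<bar>as ! i\<bar>) = abs_sum as"
      by (simp add: abs_sum_def sum_list_sum_nth atLeast0LessThan)
    finally show ?thesis .
  qed
  have "norm z * norm z ^ (d - 1) = norm z ^ d" using \<open>d \<noteq> 0\<close> by (cases d) auto
  also have "\<dots> \<le> norm (c d) * norm z ^ d" using lead by (simp add: mult_le_cancel_right1)
  also have "\<dots> = norm (\<Sum>i<d. c i * z ^ i)"
    using sum0 by (metis add_eq_0_iff norm_minus_cancel norm_mult norm_power)
  also have "\<dots> \<le> (\<Sum>i<d. norm (c i) * norm z ^ (d - 1))"
    using False by (intro order_trans[OF norm_sum sum_mono])
      (auto simp: norm_mult norm_power intro!: mult_left_mono power_increasing)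
  also have "\<dots> = (\<Sum>i<d. norm (c i)) * norm z ^ (d - 1)" by (simp add: sum_distrib_right)
  also have "\<dots> \<le> abs_sum as * norm z ^ (d - 1)" using S by (intro mult_right_mono) auto
  finally have "norm z * norm z ^ (d - 1) \<le> abs_sum as * norm z ^ (d - 1)" .
  moreover have "norm z ^ (d - 1) > 0" using False by (intro zero_less_power) linarith
  ultimately have "norm z \<le> abs_sum as" by (simp only: mult_le_cancel_right_pos)
  then show ?thesis by simp
qed auto

text \<open>The 2 makes room for the constants 0, 1 and -1, which occur as partners of roots in sums
  of products.\<close>

definition root_size :: "int list \<Rightarrow> nat" where
  "root_size as = length as + abs_sum as + 2"

lemma small_root_ipoly:
  assumes "ipoly as \<noteq> 0" "poly (ipoly as) z = 0"
  shows "small_root (root_size as) z"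
  unfolding small_root_def
proof (intro exI[of _ as] conjI assms ballI)
  fix a assume "a \<in> set as"
  then have "nat \<bar>a\<bar> \<le> abs_sum as"
    unfolding abs_sum_def by (intro member_le_sum_list) auto
  then show "\<bar>a\<bar> \<le> int (root_size as)" by (simp add: root_size_def)
qed (simp add: root_size_def)

lemma small_root_constants:
  assumes "2 \<le> B"
  shows "small_root B 1" "small_root B (- 1)" "small_root B 0"
  unfolding small_root_def
  by (rule exI[of _ "[-1, 1]"] exI[of _ "[1, 1]"] exI[of _ "[0, 1]"], use assms in force)+

text \<open>Four products suffice for the differences of two roots and of their real parts, once
  both are doubled.\<close>

definition root_sep :: "int list \<Rightarrow> nat" where
  "root_sep as = sep_bound (root_size as) 4"

lemma sep_bound_pos: "sep_bound B N > 0"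
  by (simp add: sep_bound_def lead_mult_def)

text \<open>The lexicographic order compares real parts first, so these need a separation of their
  own. It follows from \<open>2 * (Re z - Re w)\<close> being \<open>z + cnj z - w - cnj w\<close>,
  where the conjugates are roots of the same polynomial because its coefficients are real.\<close>

lemma root_separation:
  assumes p: "ipoly as \<noteq> 0" and z: "poly (ipoly as) z = 0" and w: "poly (ipoly as) w = 0"
  shows "z \<noteq> w \<Longrightarrow> 1 \<le> norm (z - w) * (2 * root_sep as)"
    and "Re z \<noteq> Re w \<Longrightarrow> 1 \<le> \<bar>Re z - Re w\<bar> * (2 * root_sep as)"
proof -
  define B where "B = root_size as"
  have small: "small_root B z" "small_root B w" "small_root B (cnj z)" "small_root B (cnj w)"
    "small_root B 1" "small_root B (-1)"
    using small_root_ipoly[OF p] z w small_root_constants[of B]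
    by (simp_all add: B_def poly_ipoly_cnj) (simp_all add: root_size_def)
  define L :: "(complex \<times> complex) list" where "L = [(z, 1), (z, 1), (w, -1), (w, -1)]"
  have L: "length L = 4" "(\<Sum>(a, b)\<leftarrow>L. a * b) = 2 * (z - w)" by (simp_all add: L_def)
  have "2 * (z - w) = 0 \<or> 1 \<le> norm (2 * (z - w)) * sep_bound B 4"
    using sum_products_integral(2)[of L B, unfolded L] small by (auto simp: L_def)
  then show "z \<noteq> w \<Longrightarrow> 1 \<le> norm (z - w) * (2 * root_sep as)"
    unfolding norm_mult by (simp add: root_sep_def B_def)
  define L' :: "(complex \<times> complex) list" where "L' = [(z, 1), (cnj z, 1), (w, -1), (cnj w, -1)]"
  have L': "length L' = 4" "(\<Sum>(a, b)\<leftarrow>L'. a * b) = of_real (2 * (Re z - Re w))"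
    by (simp_all add: L'_def complex_eq_iff)
  have "of_real (2 * (Re z - Re w)) = (0 :: complex) \<or> 1 \<le> norm (of_real (2 * (Re z - Re w)) :: complex) * sep_bound B 4"
    using sum_products_integral(2)[of L' B, unfolded L'] small by (auto simp: L'_def)
  then show "Re z \<noteq> Re w \<Longrightarrow> 1 \<le> \<bar>Re z - Re w\<bar> * (2 * root_sep as)"
    unfolding norm_of_real abs_mult by (simp add: root_sep_def B_def)
qed

section \<open>Locating the roots of an integer polynomial on a rational grid\<close>

definition cplx :: "rat \<times> rat \<Rightarrow> complex" where
  "cplx q = Complex (of_rat (fst q)) (of_rat (snd q))"

definition rat_eval :: "int list \<Rightarrow> rat \<times> rat \<Rightarrow> rat \<times> rat" where
  "rat_eval as q = foldr (\<lambda>a v. (of_int a + (fst q * fst v - snd q * snd v), fst q * snd v + snd q * fst v)) as (0, 0)"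

lemma cplx_rat_eval: "cplx (rat_eval as q) = poly (ipoly as) (cplx q)"
  unfolding rat_eval_def
  by (induction as) (simp_all add: cplx_def complex_eq_iff of_rat_add of_rat_diff of_rat_mult)

text \<open>The residual test that the value at \<open>q\<close> has modulus at most
  \<open>1 / t ^ length as\<close> for positive \<open>t\<close>, squared so that only rational
  numbers are compared. The exponent exceeds the degree, which is what makes a small residual imply
  a near root.\<close>

definition near_root :: "int list \<Rightarrow> nat \<Rightarrow> rat \<times> rat \<Rightarrow> bool" where
  "near_root as t q \<longleftrightarrow>
     ((fst (rat_eval as q))\<^sup>2 + (snd (rat_eval as q))\<^sup>2) * of_nat t ^ (2 * length as) \<le> 1"

lemma near_root_iff: "near_root as t q \<longleftrightarrow> norm (poly (ipoly as) (cplx q)) * real t ^ length as \<le> 1"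
proof -
  let ?v = "rat_eval as q"
  have "near_root as t q \<longleftrightarrow> (of_rat (((fst ?v)\<^sup>2 + (snd ?v)\<^sup>2) * of_nat t ^ (2 * length as)) :: real) \<le> of_rat 1"
    unfolding near_root_def by (simp only: of_rat_less_eq)
  also have "(of_rat (((fst ?v)\<^sup>2 + (snd ?v)\<^sup>2) * of_nat t ^ (2 * length as)) :: real) =
      (norm (cplx ?v) * real t ^ length as)\<^sup>2"
    by (simp add: cplx_def of_rat_mult of_rat_add of_rat_power power_mult_distrib cmod_power2
        power_mult[symmetric] mult.commute)
  also have "\<dots> \<le> of_rat 1 \<longleftrightarrow> norm (cplx ?v) * real t ^ length as \<le> 1"
    using abs_square_le_1[of "norm (cplx ?v) * real t ^ length as"] by simp
  finally show ?thesis by (simp add: cplx_rat_eval)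
qed

text \<open>If all roots were farther than \<open>1 / t\<close> from the point, the factorisation
  with a leading coefficient of modulus at least 1 would give a value of at least
  \<open>(1 / t) ^ degree\<close>, strictly more than \<open>(1 / t) ^ length as\<close>.\<close>

lemma near_root_imp_root:
  assumes p: "ipoly as \<noteq> 0" and t: "2 \<le> t" and q: "near_root as t q"
  shows "\<exists>z. poly (ipoly as) z = 0 \<and> norm (cplx q - z) \<le> 1 / t"
proof (rule ccontr)
  assume far: "\<not> ?thesis"
  obtain rs where rs: "Polynomial.smult (lead_coeff (ipoly as)) (\<Prod>a\<leftarrow>rs. [:- a, 1:]) = ipoly as"
    "length rs = degree (ipoly as)"
    using fundamental_theorem_algebra_factorized[of "ipoly as"] by blast
  have "poly (ipoly as) a = 0" if "a \<in> set rs" for a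
    using that by (subst rs(1)[symmetric]) (auto simp: poly_prod_list prod_list_zero_iff)
  then have far': "1 / t \<le> norm (cplx q - a)" if "a \<in> set rs" for a
    using far that by force
  have prod: "(1 / t) ^ length rs' \<le> (\<Prod>a\<leftarrow>rs'. norm (cplx q - a))" if "set rs' \<subseteq> set rs" for rs'
    using that
  proof (induction rs')
    case (Cons a rs')
    then have "1 / t * (1 / t) ^ length rs' \<le> norm (cplx q - a) * (\<Prod>a\<leftarrow>rs'. norm (cplx q - a))"
      by (intro mult_mono far') auto
    then show ?case by simp
  qed simp
  have "norm (poly (ipoly as) (cplx q)) = norm (lead_coeff (ipoly as)) * norm (poly (\<Prod>a\<leftarrow>rs. [:- a, 1:]) (cplx q))"
    by (subst rs(1)[symmetric]) (simp add: norm_mult)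
  also have "norm (poly (\<Prod>a\<leftarrow>rs. [:- a, 1:]) (cplx q)) = (\<Prod>a\<leftarrow>rs. norm (cplx q - a))"
    by (induction rs) (auto simp: norm_mult left_diff_distrib[symmetric])
  finally have eq: "norm (poly (ipoly as) (cplx q)) = norm (lead_coeff (ipoly as)) * (\<Prod>a\<leftarrow>rs. norm (cplx q - a))" .
  have "0 \<le> (\<Prod>a\<leftarrow>rs. norm (cplx q - a))" by (rule order_trans[OF _ prod]) auto
  then have "1 * (\<Prod>a\<leftarrow>rs. norm (cplx q - a)) \<le> norm (poly (ipoly as) (cplx q))"
    unfolding eq by (intro mult_right_mono norm_lead_coeff_ipoly_ge_1[OF p])
  then have "(\<Prod>a\<leftarrow>rs. norm (cplx q - a)) \<le> norm (poly (ipoly as) (cplx q))" by simp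
  moreover have "(1 / t) ^ degree (ipoly as) \<le> (\<Prod>a\<leftarrow>rs. norm (cplx q - a))"
    using prod[of rs] rs(2) by simp
  moreover have "norm (poly (ipoly as) (cplx q)) \<le> (1 / t) ^ length as"
    using q t by (simp add: near_root_iff field_simps)
  moreover have "(1 / real t) ^ length as < (1 / t) ^ degree (ipoly as)"
    using t degree_ipoly_less[OF p] by (intro power_strict_decreasing) auto
  ultimately show False by linarith
qed

text \<open>The mesh is fine enough for two purposes: the grid point next to a root is within
  \<open>1 / t\<close> of it, and by the Lipschitz estimate on the disc of radius
  \<open>abs_sum as + 3\<close> the value there passes \<open>near_root\<close>. The factor 2 pays
  for the two coordinates.\<close>

definition grid_den :: "int list \<Rightarrow> nat \<Rightarrow> nat" where
  "grid_den as t = 2 * Suc (length as * abs_sum as * (abs_sum as + 3) ^ length as) * t ^ Suc (length as)"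

definition grid_width :: "int list \<Rightarrow> nat \<Rightarrow> nat" where
  "grid_width as t = Suc (2 * (abs_sum as + 2) * grid_den as t)"

text \<open>Quotient and remainder of one index give the two coordinates, so searching the square is
  searching an initial segment of the natural numbers. The square of half-width
  \<open>abs_sum as + 2\<close> contains all roots.\<close>

definition grid_point :: "int list \<Rightarrow> nat \<Rightarrow> nat \<Rightarrow> rat \<times> rat" where
  "grid_point as t n =
    (of_nat (n div grid_width as t) / of_nat (grid_den as t) - of_nat (abs_sum as + 2),
     of_nat (n mod grid_width as t) / of_nat (grid_den as t) - of_nat (abs_sum as + 2))"

lemma grid_coordinate:
  fixes x :: real and R N :: nat
  assumes "\<bar>x\<bar> \<le> R" "0 < N"
  obtains i where "i < Suc (2 * R * N)" "\<bar>of_nat i / of_nat N - of_nat R - x\<bar> \<le> 1 / N"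
proof -
  define i where "i = nat \<lfloor>(x + R) * N\<rfloor>"
  have nn: "0 \<le> (x + R) * N" using assms by (intro mult_nonneg_nonneg) auto
  then have i: "real i \<le> (x + R) * N" "(x + R) * N < real i + 1"
    unfolding i_def by linarith+
  have "(x + R) * N \<le> (real R + real R) * real N" using assms by (intro mult_right_mono) auto
  with i have "real i \<le> real (2 * R * N)" by (simp add: algebra_simps)
  then have "i < Suc (2 * R * N)" by linarith
  moreover have "\<bar>of_nat i / of_nat N - of_nat R - x\<bar> \<le> 1 / N"
  proof -
    have "of_nat i / of_nat N - of_nat R - x = (real i - (x + R) * N) / N"
      using assms(2) by (simp add: field_simps)
    moreover have "\<bar>real i - (x + R) * N\<bar> \<le> 1" using i by linarith
    ultimately show ?thesis using assms(2) by (simp add: divide_right_mono)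
  qed
  ultimately show thesis by (rule that)
qed

lemma grid_covers_roots:
  assumes p: "ipoly as \<noteq> 0" and t: "1 \<le> t" and z: "poly (ipoly as) z = 0"
  shows "\<exists>n < grid_width as t * grid_width as t. near_root as t (grid_point as t n) \<and>
    norm (cplx (grid_point as t n) - z) \<le> 1 / t"
proof -
  define R N M where "R = abs_sum as + 2" and "N = grid_den as t" and "M = grid_width as t"
  define Lip where "Lip = length as * abs_sum as * (abs_sum as + 3) ^ length as"
  have N: "N = 2 * Suc Lip * t ^ Suc (length as)" by (simp add: N_def grid_den_def Lip_def)
  have N0: "N > 0" using t by (simp add: N)
  have zR: "norm z \<le> Suc (abs_sum as)" by (rule root_norm_le[OF p z])
  then have "\<bar>Re z\<bar> \<le> R" "\<bar>Im z\<bar> \<le> R"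
    using abs_Re_le_cmod[of z] abs_Im_le_cmod[of z] by (auto simp: R_def)
  then obtain i j where i: "i < M" "\<bar>of_nat i / of_nat N - of_nat R - Re z\<bar> \<le> 1 / N"
    and j: "j < M" "\<bar>of_nat j / of_nat N - of_nat R - Im z\<bar> \<le> 1 / N"
    using grid_coordinate[OF _ N0] unfolding M_def grid_width_def R_def[symmetric] N_def[symmetric] by metis
  define n where "n = i * M + j"
  have "n div M = i" "n mod M = j" using j(1) by (auto simp: n_def)
  then have pt: "grid_point as t n = (of_nat i / of_nat N - of_nat R, of_nat j / of_nat N - of_nat R)"
    by (simp add: grid_point_def M_def N_def R_def)
  have "norm (cplx (grid_point as t n) - z) \<le> \<bar>of_nat i / of_nat N - of_nat R - Re z\<bar> + \<bar>of_nat j / of_nat N - of_nat R - Im z\<bar>"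
    using cmod_le[of "cplx (grid_point as t n) - z"] by (simp add: pt cplx_def of_rat_diff of_rat_divide)
  then have d: "norm (cplx (grid_point as t n) - z) \<le> 2 / N" using i(2) j(2) by simp
  have "2 * t ^ Suc (length as) \<le> N" unfolding N by simp
  moreover have "t \<le> t ^ Suc (length as)" using t by (intro self_le_power) auto
  ultimately have "2 * t \<le> N" by linarith
  then have N_ge: "2 * real t \<le> real N" by linarith
  then have "2 / N \<le> 1 / t"
    using t N0 by (simp add: field_simps)
  with d have d': "norm (cplx (grid_point as t n) - z) \<le> 1 / t" by linarith
  have "2 / N \<le> 1" using N_ge t N0 by (simp add: field_simps)
  then have "norm (cplx (grid_point as t n)) \<le> real (abs_sum as + 3)"
    using d zR norm_triangle_sub[of "cplx (grid_point as t n)" z] by simp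
  moreover have "norm z \<le> real (abs_sum as + 3)" using zR by simp
  ultimately have "norm (poly (ipoly as) (cplx (grid_point as t n)) - poly (ipoly as) z)
      \<le> length as * abs_sum as * real (abs_sum as + 3) ^ length as * norm (cplx (grid_point as t n) - z)"
    by (intro poly_ipoly_Lipschitz) auto
  also have "\<dots> = real Lip * norm (cplx (grid_point as t n) - z)" by (simp add: Lip_def)
  also have "\<dots> \<le> real Lip * (2 / N)" using d by (intro mult_left_mono) auto
  finally have "norm (poly (ipoly as) (cplx (grid_point as t n))) * t ^ length as \<le> real Lip * (2 / N) * t ^ length as"
    using z by (intro mult_right_mono) auto
  also have "\<dots> \<le> 1"
  proof -
    have "real Lip * 2 * t ^ length as \<le> real (Suc Lip) * 2 * t ^ Suc (length as)"
      using t by (intro mult_mono) (auto simp: mult_le_cancel_right1)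
    also have "\<dots> = N" by (simp add: N algebra_simps)
    finally show ?thesis using N0 by (simp add: field_simps)
  qed
  finally have "near_root as t (grid_point as t n)" by (simp add: near_root_iff)
  moreover have "n < M * M"
  proof -
    have "n < i * M + M" using j by (simp add: n_def)
    also have "\<dots> = Suc i * M" by simp
    also have "\<dots> \<le> M * M" using i by (intro mult_right_mono) auto
    finally show ?thesis .
  qed
  ultimately show ?thesis using d' by (auto simp: M_def)
qed

text \<open>The threshold is chosen for points within \<open>1 / t\<close> of roots: coordinates of
  two points at the same root differ by at most \<open>2 / t\<close>, while unequal coordinates of
  distinct roots will differ by more than \<open>4 / t\<close>, leaving more than
  \<open>2 / t\<close> between the points.\<close>

definition close_pts :: "nat \<Rightarrow> rat \<times> rat \<Rightarrow> rat \<times> rat \<Rightarrow> bool" where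
  "close_pts t p q \<longleftrightarrow> \<bar>fst p - fst q\<bar> * of_nat t \<le> 2 \<and> \<bar>snd p - snd q\<bar> * of_nat t \<le> 2"

definition less_pts :: "nat \<Rightarrow> rat \<times> rat \<Rightarrow> rat \<times> rat \<Rightarrow> bool" where
  "less_pts t p q \<longleftrightarrow> 2 < (fst q - fst p) * of_nat t \<or>
     (\<bar>fst p - fst q\<bar> * of_nat t \<le> 2 \<and> 2 < (snd q - snd p) * of_nat t)"

lemma of_rat_mult_nat_le_2: "(of_rat x :: real) * real t \<le> 2 \<longleftrightarrow> x * of_nat t \<le> 2"
  and of_rat_mult_nat_gt_2: "2 < (of_rat x :: real) * real t \<longleftrightarrow> 2 < x * of_nat t"
proof -
  have "(of_rat x :: real) * real t = of_rat (x * of_nat t)" by (simp add: of_rat_mult)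
  then show "(of_rat x :: real) * real t \<le> 2 \<longleftrightarrow> x * of_nat t \<le> 2"
    "2 < (of_rat x :: real) * real t \<longleftrightarrow> 2 < x * of_nat t"
    by (metis of_rat_less_eq of_rat_numeral_eq, metis of_rat_less of_rat_numeral_eq)
qed

lemma of_rat_abs: "(of_rat \<bar>x\<bar> :: real) = \<bar>of_rat x\<bar>"
  by (simp add: abs_if of_rat_minus)

lemma close_pts_iff: "close_pts t p q \<longleftrightarrow> \<bar>Re (cplx p) - Re (cplx q)\<bar> * real t \<le> 2 \<and> \<bar>Im (cplx p) - Im (cplx q)\<bar> * real t \<le> 2"
  unfolding close_pts_def of_rat_mult_nat_le_2[symmetric] of_rat_abs of_rat_diff cplx_def by simp

lemma less_pts_iff: "less_pts t p q \<longleftrightarrow> 2 < (Re (cplx q) - Re (cplx p)) * real t \<or>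
     (\<bar>Re (cplx p) - Re (cplx q)\<bar> * real t \<le> 2 \<and> 2 < (Im (cplx q) - Im (cplx p)) * real t)"
  unfolding less_pts_def of_rat_mult_nat_le_2[symmetric] of_rat_mult_nat_gt_2[symmetric] of_rat_abs of_rat_diff cplx_def
  by simp

text \<open>Many grid points may lie near one root. The one of least index stands for the root, so
  that counting representatives counts roots.\<close>

definition representative :: "int list \<Rightarrow> nat \<Rightarrow> nat \<Rightarrow> bool" where
  "representative as t n \<longleftrightarrow> near_root as t (grid_point as t n) \<and>
     (\<forall>m<n. near_root as t (grid_point as t m) \<longrightarrow> \<not> close_pts t (grid_point as t m) (grid_point as t n))"

definition grid_rank :: "int list \<Rightarrow> nat \<Rightarrow> nat \<Rightarrow> nat" where
  "grid_rank as t n = length (filter (\<lambda>m. representative as t m \<and>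
     less_pts t (grid_point as t m) (grid_point as t n)) [0..<grid_width as t * grid_width as t])"

text \<open>The default \<open>(0, 0)\<close> matches the default value 0 of
  \<open>alg_of_code\<close> when no root has rank \<open>k\<close>.\<close>

definition root_approx :: "int list \<Rightarrow> nat \<Rightarrow> nat \<Rightarrow> rat \<times> rat" where
  "root_approx as k t = nth_dflt (0, 0) (map (\<lambda>n. grid_point as t n)
     (filter (\<lambda>n. near_root as t (grid_point as t n) \<and> grid_rank as t n = k)
       [0..<grid_width as t * grid_width as t])) 0"

section \<open>Ranks of roots in the lexicographic order\<close>

definition root_rank :: "int list \<Rightarrow> complex \<Rightarrow> nat" where
  "root_rank as z = card {w. poly (ipoly as) w = 0 \<and> lexless w z}"

lemma lexless_total: "z \<noteq> w \<Longrightarrow> lexless z w \<or> lexless w z"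
  by (auto simp: lexless_def complex_eq_iff)

lemma lexless_trans: "lexless z w \<Longrightarrow> lexless w u \<Longrightarrow> lexless z u"
  by (auto simp: lexless_def)

lemma lexless_irrefl: "\<not> lexless z z"
  by (auto simp: lexless_def)

lemma root_rank_strict_mono:
  assumes "ipoly as \<noteq> 0" "poly (ipoly as) z = 0" "lexless z w"
  shows "root_rank as z < root_rank as w"
  unfolding root_rank_def
proof (rule psubset_card_mono)
  show "finite {u. poly (ipoly as) u = 0 \<and> lexless u w}"
    using poly_roots_finite[OF assms(1)] by (rule rev_finite_subset) auto
  show "{w. poly (ipoly as) w = 0 \<and> lexless w z} \<subset> {u. poly (ipoly as) u = 0 \<and> lexless u w}"
    using assms lexless_trans lexless_irrefl by blast
qed

lemma root_rank_inj:
  assumes "ipoly as \<noteq> 0" "poly (ipoly as) z = 0" "poly (ipoly as) w = 0" "root_rank as z = root_rank as w"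
  shows "z = w"
  using lexless_total[of z w] root_rank_strict_mono[OF assms(1,2), of w]
    root_rank_strict_mono[OF assms(1,3), of z] assms(4) by auto

definition alg :: "int list \<Rightarrow> nat \<Rightarrow> complex" where
  "alg as k = (if ipoly as \<noteq> 0 \<and> (\<exists>z. poly (ipoly as) z = 0 \<and> root_rank as z = k)
     then THE z. poly (ipoly as) z = 0 \<and> root_rank as z = k else 0)"

lemma alg_eqI:
  assumes "ipoly as \<noteq> 0" "poly (ipoly as) z = 0" "root_rank as z = k"
  shows "alg as k = z"
proof -
  have "(THE z. poly (ipoly as) z = 0 \<and> root_rank as z = k) = z"
    by (rule the_equality) (use assms root_rank_inj in auto)
  then show ?thesis unfolding alg_def using assms by auto
qed

lemma root_approx_correct:
  assumes p: "ipoly as \<noteq> 0" and t: "9 * root_sep as \<le> t" "2 \<le> t"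
  shows "norm (cplx (root_approx as k t) - alg as k) \<le> 1 / t"
proof -
  define pt where "pt n = cplx (grid_point as t n)" for n
  define good where "good n = near_root as t (grid_point as t n)" for n
  define M where "M = grid_width as t * grid_width as t"
  define root where "root z \<longleftrightarrow> poly (ipoly as) z = 0" for z
  have t0: "real t > 0" using t by simp
  have "\<forall>n. \<exists>z. good n \<longrightarrow> root z \<and> norm (pt n - z) \<le> 1 / t"
    using near_root_imp_root[OF p t(2)] unfolding good_def pt_def root_def by blast
  from choice[OF this] obtain rt where rt: "\<And>n. good n \<Longrightarrow> root (rt n)"
    "\<And>n. good n \<Longrightarrow> norm (pt n - rt n) \<le> 1 / t" by blast
  have re: "\<bar>Re (pt n) - Re (rt n)\<bar> * t \<le> 1" and im: "\<bar>Im (pt n) - Im (rt n)\<bar> * t \<le> 1" if "good n" for n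
  proof -
    have "norm (pt n - rt n) * t \<le> 1" using rt(2)[OF that] t0 by (simp add: field_simps)
    moreover have "\<bar>Re (pt n) - Re (rt n)\<bar> * t \<le> norm (pt n - rt n) * t"
      "\<bar>Im (pt n) - Im (rt n)\<bar> * t \<le> norm (pt n - rt n) * t"
      using abs_Re_le_cmod[of "pt n - rt n"] abs_Im_le_cmod[of "pt n - rt n"]
      by (intro mult_right_mono; simp)+
    ultimately show "\<bar>Re (pt n) - Re (rt n)\<bar> * t \<le> 1" "\<bar>Im (pt n) - Im (rt n)\<bar> * t \<le> 1" by linarith+
  qed
  have tr: "9 * real (root_sep as) \<le> t" using t(1) by linarith
  \<comment> \<open>From \<open>1 <= x * 2 * s\<close> and \<open>9 * s <= t\<close> follows
    \<open>x * t >= 9 / 2\<close>. This is where the factor 9 in the hypothesis comes from.\<close>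
  have sep: "4 < norm (z - w) * t" if "root z" "root w" "z \<noteq> w" for z w
  proof -
    have "1 \<le> norm (z - w) * (2 * real (root_sep as))"
      using root_separation(1)[OF p, of z w] that by (simp add: root_def)
    moreover have "norm (z - w) * (9 * real (root_sep as)) \<le> norm (z - w) * t"
      by (intro mult_left_mono tr) auto
    ultimately show ?thesis by linarith
  qed
  have sepRe: "4 < \<bar>Re z - Re w\<bar> * t" if "root z" "root w" "Re z \<noteq> Re w" for z w
  proof -
    have "1 \<le> \<bar>Re z - Re w\<bar> * (2 * real (root_sep as))"
      using root_separation(2)[OF p, of z w] that by (simp add: root_def)
    moreover have "\<bar>Re z - Re w\<bar> * (9 * real (root_sep as)) \<le> \<bar>Re z - Re w\<bar> * t"
      by (intro mult_left_mono tr) auto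
    ultimately show ?thesis by linarith
  qed
  have sepIm: "4 < \<bar>Im z - Im w\<bar> * t" if "root z" "root w" "Re z = Re w" "Im z \<noteq> Im w" for z w
  proof -
    have "norm (z - w) = \<bar>Im z - Im w\<bar>" using that(3) by (simp add: cmod_def)
    with sep[OF that(1,2)] that(4) show ?thesis by auto
  qed
  have scaled: "\<bar>a * t - b * t\<bar> = \<bar>a - b\<bar> * t" for a b :: real
    using t0 by (simp add: left_diff_distrib[symmetric] abs_mult)
  \<comment> \<open>Each point is off by at most \<open>1 / t\<close>, so close points have roots
    whose coordinates differ by at most \<open>4 / t\<close>, which the separation allows only for
    equal coordinates.\<close>
  have close: "close_pts t (grid_point as t m) (grid_point as t n) \<longleftrightarrow> rt m = rt n" if "good m" "good n" for m n
  proof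
    assume "close_pts t (grid_point as t m) (grid_point as t n)"
    then have "\<bar>Re (pt m) - Re (pt n)\<bar> * t \<le> 2" "\<bar>Im (pt m) - Im (pt n)\<bar> * t \<le> 2"
      by (simp_all add: close_pts_iff pt_def)
    then have "\<bar>Re (rt m) - Re (rt n)\<bar> * t \<le> 4" "\<bar>Im (rt m) - Im (rt n)\<bar> * t \<le> 4"
      using re[OF that(1)] re[OF that(2)] im[OF that(1)] im[OF that(2)]
      unfolding scaled[symmetric] by linarith+
    then show "rt m = rt n"
      using sepRe[OF rt(1)[OF that(1)] rt(1)[OF that(2)]] sepIm[OF rt(1)[OF that(1)] rt(1)[OF that(2)]]
      by (intro complex_eqI) force+
  next
    assume eq: "rt m = rt n"
    show "close_pts t (grid_point as t m) (grid_point as t n)"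
      unfolding close_pts_iff pt_def[symmetric]
      using re[OF that(1)] re[OF that(2)] im[OF that(1)] im[OF that(2)]
      unfolding eq scaled[symmetric] by linarith
  qed
  have scaled': "(a - b) * real t = a * t - b * t" for a b by (rule left_diff_distrib)
  have less: "less_pts t (grid_point as t m) (grid_point as t n) \<longleftrightarrow> lexless (rt m) (rt n)" if "good m" "good n" for m n
  proof -
    note bounds = re[OF that(1)] re[OF that(2)] im[OF that(1)] im[OF that(2)]
    consider "Re (rt m) < Re (rt n)" | "Re (rt m) > Re (rt n)" | "Re (rt m) = Re (rt n)" by linarith
    then show ?thesis
    proof cases
      case 1
      then have "4 < (Re (rt n) - Re (rt m)) * t" using sepRe[OF rt(1)[OF that(1)] rt(1)[OF that(2)]] by simp
      then have "2 < (Re (pt n) - Re (pt m)) * t" using bounds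
        unfolding scaled' scaled[symmetric] by linarith
      with 1 show ?thesis by (simp add: less_pts_iff pt_def[symmetric] lexless_def)
    next
      case 2
      then have "4 < (Re (rt m) - Re (rt n)) * t" using sepRe[OF rt(1)[OF that(1)] rt(1)[OF that(2)]] by simp
      then have "\<not> 2 < (Re (pt n) - Re (pt m)) * t" "\<not> \<bar>Re (pt m) - Re (pt n)\<bar> * t \<le> 2" using bounds
        unfolding scaled' scaled[symmetric] by linarith+
      with 2 show ?thesis by (simp add: less_pts_iff pt_def[symmetric] lexless_def)
    next
      case 3
      then have "Re (rt m) * t = Re (rt n) * t" by simp
      then have ps: "\<not> 2 < (Re (pt n) - Re (pt m)) * t" "\<bar>Re (pt m) - Re (pt n)\<bar> * t \<le> 2" using bounds
        unfolding scaled' scaled[symmetric] by linarith+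
      have "2 < (Im (pt n) - Im (pt m)) * t \<longleftrightarrow> Im (rt m) < Im (rt n)"
      proof
        assume "2 < (Im (pt n) - Im (pt m)) * t"
        then have "0 < (Im (rt n) - Im (rt m)) * t" using bounds
          unfolding scaled' scaled[symmetric] by linarith
        then show "Im (rt m) < Im (rt n)" using t0 by (simp add: zero_less_mult_iff)
      next
        assume "Im (rt m) < Im (rt n)"
        then have "4 < (Im (rt n) - Im (rt m)) * t"
          using sepIm[OF rt(1)[OF that(1)] rt(1)[OF that(2)] 3] by simp
        then show "2 < (Im (pt n) - Im (pt m)) * t" using bounds
          unfolding scaled' scaled[symmetric] by linarith
      qed
      with ps 3 show ?thesis by (simp add: less_pts_iff pt_def[symmetric] lexless_def)
    qed
  qed
  \<comment> \<open>The grid supplies a point within \<open>1 / t\<close> of \<open>z\<close>, and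
    its attached root is within \<open>2 / t\<close> of \<open>z\<close>. Distinct roots are more
    than \<open>4 / t\<close> apart, so that root is \<open>z\<close>.\<close>
  have cover: "\<exists>n<M. good n \<and> rt n = z" if z: "root z" for z
  proof -
    obtain n where n: "n < M" "good n" "norm (pt n - z) \<le> 1 / t"
      using grid_covers_roots[OF p _ z[unfolded root_def], of t] t(2)
      by (auto simp: M_def good_def pt_def)
    have "norm (rt n - z) \<le> 1 / t + 1 / t"
      using rt(2)[OF n(2)] n(3) norm_triangle_ineq[of "rt n - pt n" "pt n - z"]
      by (simp add: norm_minus_commute)
    then have "norm (rt n - z) * t \<le> 2" using t0 by (simp add: field_simps)
    then have "rt n = z" using sep[OF rt(1)[OF n(2)] z] by force
    with n show ?thesis by blast
  qed
  have rank: "grid_rank as t n = root_rank as (rt n)" if n: "good n" for n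
  proof -
    let ?A = "{m. m < M \<and> representative as t m \<and> less_pts t (grid_point as t m) (grid_point as t n)}"
    have rep: "representative as t m \<longleftrightarrow> good m \<and> (\<forall>l<m. good l \<longrightarrow> rt l \<noteq> rt m)" for m
      unfolding representative_def good_def[symmetric] using close by auto
    have A: "?A = {m. m < M \<and> good m \<and> (\<forall>l<m. good l \<longrightarrow> rt l \<noteq> rt m) \<and> lexless (rt m) (rt n)}"
      using less[OF _ n] by (auto simp: rep)
    have "grid_rank as t n = card (set (filter (\<lambda>m. representative as t m \<and>
        less_pts t (grid_point as t m) (grid_point as t n)) [0..<M]))"
      unfolding grid_rank_def M_def by (subst distinct_card) auto
    also have "set (filter (\<lambda>m. representative as t m \<and>
        less_pts t (grid_point as t m) (grid_point as t n)) [0..<M]) = ?A" by auto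
    \<comment> \<open>Each root below \<open>rt n\<close> is hit exactly once, by the least good
      index attached to it.\<close>
    also have "card ?A = card {w. root w \<and> lexless w (rt n)}"
    proof (rule bij_betw_same_card[of rt])
      have "inj_on rt ?A"
      proof (rule inj_onI, rule ccontr)
        fix a b assume ab: "a \<in> ?A" "b \<in> ?A" "rt a = rt b" "a \<noteq> b"
        then show False unfolding A by (cases "a < b") (auto simp: not_less order_le_less)
      qed
      moreover have "rt ` ?A = {w. root w \<and> lexless w (rt n)}"
      proof (intro equalityI subsetI)
        fix w assume w: "w \<in> {w. root w \<and> lexless w (rt n)}"
        define m where "m = (LEAST m. good m \<and> rt m = w)"
        obtain m' where m': "m' < M" "good m' \<and> rt m' = w" using cover w by blast
        have m: "good m \<and> rt m = w" unfolding m_def by (rule LeastI) (rule m'(2))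
        moreover have "m < M" using Least_le[of "\<lambda>m. good m \<and> rt m = w", OF m'(2)] m'(1) by (simp add: m_def)
        moreover have "\<forall>l<m. good l \<longrightarrow> rt l \<noteq> rt m"
        proof (intro allI impI notI)
          fix l assume "l < m" "good l" "rt l = rt m"
          with m not_less_Least[of l "\<lambda>m. good m \<and> rt m = w"] show False by (simp add: m_def)
        qed
        ultimately have "m \<in> ?A" using w by (simp add: A)
        with m show "w \<in> rt ` ?A" by blast
      qed (auto simp: A rt(1))
      ultimately show "bij_betw rt ?A {w. root w \<and> lexless w (rt n)}" by (simp add: bij_betw_def)
    qed
    finally show ?thesis by (simp add: root_rank_def root_def)
  qed
  define ns where "ns = filter (\<lambda>n. near_root as t (grid_point as t n) \<and> grid_rank as t n = k) [0..<M]"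
  have ra: "root_approx as k t = nth_dflt (0, 0) (map (\<lambda>n. grid_point as t n) ns) 0"
    by (simp add: root_approx_def ns_def M_def)
  show ?thesis
  proof (cases ns)
    case Nil
    \<comment> \<open>An empty list of candidates means that no root has rank \<open>k\<close>,
      since the grid covers all roots; both sides then take the default 0.\<close>
    have "\<not> (\<exists>z. root z \<and> root_rank as z = k)"
    proof
      assume "\<exists>z. root z \<and> root_rank as z = k"
      then obtain z where z: "root z" "root_rank as z = k" by blast
      then obtain n where "n < M" "good n" "rt n = z" using cover by blast
      then have "n \<in> set ns" using rank z by (simp add: ns_def good_def)
      with Nil show False by simp
    qed
    then have "alg as k = 0" by (auto simp: alg_def root_def)
    moreover have "root_approx as k t = (0, 0)" by (simp add: ra Nil nth_dflt_def)
    moreover have "cplx (0, 0) = 0" by (simp add: cplx_def complex_eq_iff)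
    ultimately show ?thesis by simp
  next
    case (Cons n ns')
    then have "n \<in> set ns" by simp
    then have n: "good n" "grid_rank as t n = k" by (simp_all add: ns_def good_def)
    have "alg as k = rt n"
      by (rule alg_eqI[OF p]) (use rt(1)[OF n(1)] rank[OF n(1)] n(2) in \<open>simp_all add: root_def\<close>)
    moreover have "cplx (root_approx as k t) = pt n" by (simp add: ra Cons nth_dflt_def pt_def)
    ultimately show ?thesis using rt(2)[OF n(1)] by simp
  qed
qed

lemma alg_root_or_0: "alg as k = 0 \<or> (ipoly as \<noteq> 0 \<and> poly (ipoly as) (alg as k) = 0)"
proof (cases "ipoly as \<noteq> 0 \<and> (\<exists>z. poly (ipoly as) z = 0 \<and> root_rank as z = k)")
  case True
  then obtain z where "poly (ipoly as) z = 0" "root_rank as z = k" by blast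
  with True alg_eqI[of as z k] show ?thesis by auto
next
  case False
  then have "alg as k = 0" unfolding alg_def by (rule if_not_P)
  then show ?thesis ..
qed

lemma small_root_alg: "small_root (root_size as) (alg as k)" "small_root (root_size as) (cnj (alg as k))"
proof (atomize (full), cases "alg as k = 0")
  case True
  moreover have "small_root (root_size as) 0" by (rule small_root_constants) (simp add: root_size_def)
  ultimately show "small_root (root_size as) (alg as k) \<and> small_root (root_size as) (cnj (alg as k))" by simp
next
  case False
  with alg_root_or_0[of as k] have p: "ipoly as \<noteq> 0" and z: "poly (ipoly as) (alg as k) = 0" by blast+
  then have "poly (ipoly as) (cnj (alg as k)) = 0" unfolding poly_ipoly_cnj by simp
  with p z show "small_root (root_size as) (alg as k) \<and> small_root (root_size as) (cnj (alg as k))"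
    by (intro conjI small_root_ipoly)
qed

lemma norm_alg_le: "norm (alg as k) \<le> root_size as"
proof (cases "alg as k = 0")
  case False
  with alg_root_or_0[of as k] have "ipoly as \<noteq> 0" "poly (ipoly as) (alg as k) = 0" by blast+
  then have "norm (alg as k) \<le> Suc (abs_sum as)" by (rule root_norm_le)
  also have "\<dots> \<le> root_size as" by (simp add: root_size_def)
  finally show ?thesis .
qed simp

lemma algebraic_alg: "algebraic (alg as k)"
proof (cases "alg as k = 0")
  case False
  with alg_root_or_0[of as k] have "ipoly as \<noteq> 0" "poly (ipoly as) (alg as k) = 0" by blast+
  moreover have "coeff (ipoly as) i \<in> \<int>" for i unfolding coeff_ipoly by simp
  ultimately show ?thesis by (rule algebraicI[rotated])
qed simp

lemma alg_surj:
  assumes "algebraic z"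
  shows "\<exists>as k. alg as k = z"
proof -
  obtain B where "small_root B z" using algebraic_small_root[OF assms] by blast
  then obtain as where "ipoly as \<noteq> 0" "poly (ipoly as) z = 0" unfolding small_root_def by blast
  then have "alg as (root_rank as z) = z" by (intro alg_eqI refl)
  then show ?thesis by blast
qed

lemma alg_of_code_eq:
  "alg_of_code c = alg (map int_decode (list_decode (fst (prod_decode c)))) (snd (prod_decode c))"
  unfolding alg_of_code_def alg_def root_rank_def case_prod_unfold Let_def map_map o_def ..

section \<open>Deciding sesquilinear identities between coded algebraic numbers\<close>

lemma computable_fact [computable_intros]:
  assumes "computable f"
  shows "computable (\<lambda>x. fact (f x) :: nat)"
proof -
  have "computable (\<lambda>x. rec_nat 1 (\<lambda>m y. Suc m * y) (f x))" by (intro computable_intros assms)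
  moreover have "rec_nat 1 (\<lambda>m y. Suc m * y) n = fact n" for n by (induction n) auto
  ultimately show ?thesis by simp
qed

lemma computable_lead_mult [computable_intros]: "computable f \<Longrightarrow> computable (\<lambda>x. lead_mult (f x))"
  unfolding lead_mult_def by (intro computable_intros)

lemma computable_row_bound [computable_intros]: "computable f \<Longrightarrow> computable (\<lambda>x. row_bound (f x))"
  unfolding row_bound_def by (intro computable_intros)

lemma computable_sep_bound [computable_intros]:
  "computable f \<Longrightarrow> computable g \<Longrightarrow> computable (\<lambda>x. sep_bound (f x) (g x))"
  unfolding sep_bound_def by (intro computable_intros)

lemma computable_abs_sum [computable_intros]: "computable f \<Longrightarrow> computable (\<lambda>x. abs_sum (f x))"
  unfolding abs_sum_def by (intro computable_intros)

lemma computable_root_size [computable_intros]: "computable f \<Longrightarrow> computable (\<lambda>x. root_size (f x))"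
  unfolding root_size_def by (intro computable_intros)

lemma computable_root_sep [computable_intros]: "computable f \<Longrightarrow> computable (\<lambda>x. root_sep (f x))"
  unfolding root_sep_def by (intro computable_intros)

lemma computable_grid_den [computable_intros]:
  "computable f \<Longrightarrow> computable g \<Longrightarrow> computable (\<lambda>x. grid_den (f x) (g x))"
  unfolding grid_den_def by (intro computable_intros)

lemma computable_grid_width [computable_intros]:
  "computable f \<Longrightarrow> computable g \<Longrightarrow> computable (\<lambda>x. grid_width (f x) (g x))"
  unfolding grid_width_def by (intro computable_intros)

lemma computable_grid_point [computable_intros]:
  "computable f \<Longrightarrow> computable g \<Longrightarrow> computable h \<Longrightarrow> computable (\<lambda>x. grid_point (f x) (g x) (h x))"
  unfolding grid_point_def by (intro computable_intros)

lemma computable_rat_eval [computable_intros]: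
  "computable f \<Longrightarrow> computable g \<Longrightarrow> computable (\<lambda>x. rat_eval (f x) (g x))"
  by (rule computable_compose2[where f = rat_eval]) (unfold rat_eval_def, intro computable_intros)

lemma computable_near_root [computable_intros]:
  "computable f \<Longrightarrow> computable g \<Longrightarrow> computable h \<Longrightarrow> computable (\<lambda>x. near_root (f x) (g x) (h x))"
  unfolding near_root_def by (intro computable_intros)

lemma computable_close_pts [computable_intros]:
  "computable f \<Longrightarrow> computable g \<Longrightarrow> computable h \<Longrightarrow> computable (\<lambda>x. close_pts (f x) (g x) (h x))"
  unfolding close_pts_def by (intro computable_intros)

lemma computable_less_pts [computable_intros]:
  "computable f \<Longrightarrow> computable g \<Longrightarrow> computable h \<Longrightarrow> computable (\<lambda>x. less_pts (f x) (g x) (h x))"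
  unfolding less_pts_def by (intro computable_intros)

lemma computable_representative [computable_intros]:
  "computable f \<Longrightarrow> computable g \<Longrightarrow> computable h \<Longrightarrow> computable (\<lambda>x. representative (f x) (g x) (h x))"
  by (rule computable_compose3[where f = representative]) (unfold representative_def, intro computable_intros)

lemma computable_grid_rank [computable_intros]:
  "computable f \<Longrightarrow> computable g \<Longrightarrow> computable h \<Longrightarrow> computable (\<lambda>x. grid_rank (f x) (g x) (h x))"
  by (rule computable_compose3[where f = grid_rank]) (unfold grid_rank_def, intro computable_intros)

lemma computable_root_approx [computable_intros]:
  "computable f \<Longrightarrow> computable g \<Longrightarrow> computable h \<Longrightarrow> computable (\<lambda>x. root_approx (f x) (g x) (h x))"
  by (rule computable_compose3[where f = root_approx]) (unfold root_approx_def, intro computable_intros)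

section \<open>Approximation and zero test for sums of coded products\<close>

definition code_coeffs :: "nat \<Rightarrow> int list" where
  "code_coeffs c = map int_decode (list_decode (fst (prod_decode c)))"

text \<open>The zero polynomial is caught separately, because its code denotes 0 by default while
  every grid point would pass the residual test. Otherwise the precision is raised beyond the root
  separation, as \<open>root_approx_correct\<close> requires.\<close>

definition code_approx :: "nat \<Rightarrow> nat \<Rightarrow> rat \<times> rat" where
  "code_approx c t = (if filter (\<lambda>a. a \<noteq> 0) (code_coeffs c) = [] then (0, 0)
     else root_approx (code_coeffs c) (snd (prod_decode c)) (Suc (Suc t) + 9 * root_sep (code_coeffs c)))"

lemma computable_code_coeffs [computable_intros]: "computable f \<Longrightarrow> computable (\<lambda>x. code_coeffs (f x))"
  unfolding code_coeffs_def by (intro computable_intros)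

lemma computable_code_approx [computable_intros]:
  "computable f \<Longrightarrow> computable g \<Longrightarrow> computable (\<lambda>x. code_approx (f x) (g x))"
  by (rule computable_compose2[where f = code_approx]) (unfold code_approx_def, intro computable_intros)

lemma alg_of_code_alg: "alg_of_code c = alg (code_coeffs c) (snd (prod_decode c))"
  by (simp add: alg_of_code_eq code_coeffs_def)

lemma ipoly_eq_0_iff: "ipoly as = 0 \<longleftrightarrow> (\<forall>a\<in>set as. a = 0)"
  by (induction as) auto

lemma code_approx_correct: "norm (cplx (code_approx c t) - alg_of_code c) \<le> 1 / Suc t"
proof (cases "ipoly (code_coeffs c) = 0")
  case True
  then have "filter (\<lambda>a. a \<noteq> 0) (code_coeffs c) = []" by (auto simp: ipoly_eq_0_iff filter_empty_conv)
  moreover have "alg_of_code c = 0" unfolding alg_of_code_alg alg_def using True by simp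
  moreover have "cplx (0, 0) = 0" by (simp add: cplx_def complex_eq_iff)
  ultimately show ?thesis by (simp add: code_approx_def)
next
  case False
  then have "filter (\<lambda>a. a \<noteq> 0) (code_coeffs c) \<noteq> []" by (auto simp: ipoly_eq_0_iff filter_empty_conv)
  then have eq: "code_approx c t = root_approx (code_coeffs c) (snd (prod_decode c)) (Suc (Suc t) + 9 * root_sep (code_coeffs c))"
    by (simp add: code_approx_def)
  have "norm (cplx (code_approx c t) - alg_of_code c) \<le> 1 / real (Suc (Suc t) + 9 * root_sep (code_coeffs c))"
    unfolding eq alg_of_code_alg by (rule root_approx_correct[OF False]) auto
  also have "\<dots> \<le> 1 / Suc t" by (intro divide_left_mono) auto
  finally show ?thesis .
qed

definition code_size :: "nat \<Rightarrow> nat" where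
  "code_size c = root_size (code_coeffs c)"

lemma computable_code_size [computable_intros]: "computable f \<Longrightarrow> computable (\<lambda>x. code_size (f x))"
  unfolding code_size_def by (intro computable_intros)

definition code_form :: "(nat \<times> nat) list \<Rightarrow> complex" where
  "code_form L = (\<Sum>p\<leftarrow>L. alg_of_code (fst p) * cnj (alg_of_code (snd p)))"

definition code_form_approx :: "(nat \<times> nat) list \<Rightarrow> nat \<Rightarrow> rat \<times> rat" where
  "code_form_approx L t =
    ((\<Sum>p\<leftarrow>L. fst (code_approx (fst p) t) * fst (code_approx (snd p) t) + snd (code_approx (fst p) t) * snd (code_approx (snd p) t)),
     (\<Sum>p\<leftarrow>L. snd (code_approx (fst p) t) * fst (code_approx (snd p) t) - fst (code_approx (fst p) t) * snd (code_approx (snd p) t)))"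

lemma cplx_code_form_approx:
  "cplx (code_form_approx L t) = (\<Sum>p\<leftarrow>L. cplx (code_approx (fst p) t) * cnj (cplx (code_approx (snd p) t)))"
  unfolding code_form_approx_def cplx_def
  by (induction L) (simp_all add: complex_eq_iff of_rat_add of_rat_diff of_rat_mult)

definition list_size :: "(nat \<times> nat) list \<Rightarrow> nat" where
  "list_size L = (\<Sum>p\<leftarrow>L. code_size (fst p) + code_size (snd p))"

lemma code_size_le_list_size:
  assumes "p \<in> set L"
  shows "code_size (fst p) \<le> list_size L" "code_size (snd p) \<le> list_size L"
proof -
  have "code_size (fst p) + code_size (snd p) \<le> list_size L"
    unfolding list_size_def using assms by (intro member_le_sum_list) auto
  then show "code_size (fst p) \<le> list_size L" "code_size (snd p) \<le> list_size L" by auto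
qed

lemma norm_alg_of_code_le: "norm (alg_of_code c) \<le> code_size c"
  unfolding alg_of_code_alg code_size_def by (rule norm_alg_le)

lemma small_root_alg_of_code: "code_size c \<le> B \<Longrightarrow> small_root B (alg_of_code c) \<and> small_root B (cnj (alg_of_code c))"
  unfolding alg_of_code_alg code_size_def using small_root_alg small_root_mono by blast

lemma code_form_approx_error:
  assumes "\<And>p. p \<in> set L \<Longrightarrow> code_size (fst p) \<le> B \<and> code_size (snd p) \<le> B"
  shows "norm (cplx (code_form_approx L t) - code_form L) \<le> length L * (2 * B + 1) / Suc t"
  using assms
proof (induction L)
  case Nil
  then show ?case by (simp add: cplx_code_form_approx code_form_def)
next
  case (Cons p L)
  define a b where "a = alg_of_code (fst p)" and "b = alg_of_code (snd p)"
  define x y where "x = cplx (code_approx (fst p) t)" and "y = cplx (code_approx (snd p) t)"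
  have xa: "norm (x - a) \<le> 1 / Suc t" and yb: "norm (y - b) \<le> 1 / Suc t"
    by (simp_all only: x_def y_def a_def b_def code_approx_correct)
  have a: "norm a \<le> B" and b: "norm b \<le> B"
    using norm_alg_of_code_le[of "fst p"] norm_alg_of_code_le[of "snd p"] Cons.prems[of p]
    by (auto simp: a_def b_def)
  have "norm x \<le> norm a + norm (x - a)" by (metis add_diff_cancel_left' diff_add_cancel norm_triangle_ineq add.commute)
  also have "\<dots> \<le> B + 1"
  proof -
    have "1 / real (Suc t) \<le> 1" by simp
    with a xa show ?thesis by linarith
  qed
  finally have x: "norm x \<le> B + 1" .
  have "x * cnj y - a * cnj b = x * cnj (y - b) + (x - a) * cnj b"
    by (simp add: algebra_simps)
  also have "norm \<dots> \<le> norm x * norm (y - b) + norm (x - a) * norm b"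
    by (rule order_trans[OF norm_triangle_ineq]) (simp only: norm_mult complex_mod_cnj order_refl)
  also have "\<dots> \<le> (B + 1) * (1 / Suc t) + (1 / Suc t) * B"
    using x b xa yb by (intro add_mono mult_mono) auto
  also have "\<dots> = (2 * B + 1) / Suc t" by (simp add: add_divide_distrib[symmetric] del: of_nat_Suc)
  finally have 1: "norm (x * cnj y - a * cnj b) \<le> (2 * B + 1) / Suc t" .
  have "cplx (code_form_approx (p # L) t) - code_form (p # L)
      = (x * cnj y - a * cnj b) + (cplx (code_form_approx L t) - code_form L)"
    by (simp add: cplx_code_form_approx code_form_def x_def y_def a_def b_def)
  also have "norm \<dots> \<le> (2 * B + 1) / Suc t + length L * (2 * B + 1) / Suc t"
    using 1 Cons by (intro order_trans[OF norm_triangle_ineq] add_mono) auto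
  also have "\<dots> = length (p # L) * (2 * B + 1) / Suc t"
    unfolding add_divide_distrib[symmetric] by (simp add: algebra_simps)
  finally show ?case .
qed

definition list_sep :: "(nat \<times> nat) list \<Rightarrow> nat" where
  "list_sep L = sep_bound (list_size L) (length L)"

text \<open>Chosen so that the error estimate, divided by \<open>Suc (list_prec L)\<close> and
  multiplied by \<open>2 * list_sep L\<close>, stays below 1.\<close>

definition list_prec :: "(nat \<times> nat) list \<Rightarrow> nat" where
  "list_prec L = 2 * list_sep L * (length L * (2 * list_size L + 1))"

text \<open>A nonzero value has modulus at least \<open>1 / list_sep L\<close>, and the
  approximation is off by less than half of this. Comparing the squared approximation with the
  squared half therefore decides the matter within the rational numbers.\<close>

lemma code_form_eq_0_iff:
  "code_form L = 0 \<longleftrightarrow>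
   ((fst (code_form_approx L (list_prec L)))\<^sup>2 + (snd (code_form_approx L (list_prec L)))\<^sup>2) * (of_nat (2 * list_sep L))\<^sup>2 < 1"
proof -
  let ?q = "code_form_approx L (list_prec L)" and ?s = "real (list_sep L)"
  have s: "?s > 0" by (simp add: list_sep_def sep_bound_pos)
  have "((fst ?q)\<^sup>2 + (snd ?q)\<^sup>2) * (of_nat (2 * list_sep L))\<^sup>2 < 1 \<longleftrightarrow>
    (of_rat (((fst ?q)\<^sup>2 + (snd ?q)\<^sup>2) * (of_nat (2 * list_sep L))\<^sup>2) :: real) < of_rat 1"
    by (simp only: of_rat_less)
  also have "(of_rat (((fst ?q)\<^sup>2 + (snd ?q)\<^sup>2) * (of_nat (2 * list_sep L))\<^sup>2) :: real) = (norm (cplx ?q) * (2 * ?s))\<^sup>2"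
    by (simp add: cplx_def of_rat_mult of_rat_add of_rat_power power_mult_distrib cmod_power2)
  also have "\<dots> < of_rat 1 \<longleftrightarrow> norm (cplx ?q) * (2 * ?s) < 1"
    using abs_square_less_1[of "norm (cplx ?q) * (2 * ?s)"] by simp
  finally have iff: "((fst ?q)\<^sup>2 + (snd ?q)\<^sup>2) * (of_nat (2 * list_sep L))\<^sup>2 < 1 \<longleftrightarrow> norm (cplx ?q) * (2 * ?s) < 1" .
  have "norm (cplx ?q - code_form L) \<le> length L * (2 * list_size L + 1) / Suc (list_prec L)"
    by (rule code_form_approx_error) (use code_size_le_list_size in auto)
  then have "norm (cplx ?q - code_form L) * (2 * ?s) \<le> real (length L * (2 * list_size L + 1)) / Suc (list_prec L) * (2 * ?s)"
    using s by (intro mult_right_mono) auto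
  also have "\<dots> = real (list_prec L) / Suc (list_prec L)"
    by (simp add: list_prec_def)
  also have "\<dots> < 1" by simp
  finally have err: "norm (cplx ?q - code_form L) * (2 * ?s) < 1" .
  have sep: "code_form L = 0 \<or> 1 \<le> norm (code_form L) * ?s"
  proof -
    define L' where "L' = map (\<lambda>p. (alg_of_code (fst p), cnj (alg_of_code (snd p)))) L"
    have L': "(\<Sum>(a, b)\<leftarrow>L'. a * b) = code_form L" "length L' = length L"
      by (simp_all add: L'_def code_form_def o_def)
    have "small_root (list_size L) a \<and> small_root (list_size L) b" if "(a, b) \<in> set L'" for a b
      using that small_root_alg_of_code code_size_le_list_size by (auto simp: L'_def)
    from sum_products_integral(2)[of L', OF this] show ?thesis
      unfolding L' by (simp add: list_sep_def)
  qed
  show ?thesis unfolding iff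
  proof
    assume "code_form L = 0"
    with err show "norm (cplx ?q) * (2 * ?s) < 1" by simp
  next
    assume q: "norm (cplx ?q) * (2 * ?s) < 1"
    have "norm (code_form L) \<le> norm (cplx ?q) + norm (cplx ?q - code_form L)"
      by (metis add.commute norm_minus_commute norm_triangle_sub)
    then have "norm (code_form L) * (2 * ?s) \<le> (norm (cplx ?q) + norm (cplx ?q - code_form L)) * (2 * ?s)"
      using s by (intro mult_right_mono) auto
    also have "\<dots> < 2" using q err by (simp add: distrib_right)
    finally have "norm (code_form L) * ?s < 1" by simp
    with sep show "code_form L = 0" by auto
  qed
qed

lemma computable_code_form_approx [computable_intros]:
  "computable f \<Longrightarrow> computable g \<Longrightarrow> computable (\<lambda>x. code_form_approx (f x) (g x))"
  by (rule computable_compose2[where f = code_form_approx]) (unfold code_form_approx_def, intro computable_intros)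

lemma computable_list_size [computable_intros]: "computable f \<Longrightarrow> computable (\<lambda>x. list_size (f x))"
  unfolding list_size_def by (intro computable_intros)

lemma computable_list_sep [computable_intros]: "computable f \<Longrightarrow> computable (\<lambda>x. list_sep (f x))"
  unfolding list_sep_def by (intro computable_intros)

lemma computable_list_prec [computable_intros]: "computable f \<Longrightarrow> computable (\<lambda>x. list_prec (f x))"
  unfolding list_prec_def by (intro computable_intros)

lemma computable_code_form_eq_0 [computable_intros]: "computable f \<Longrightarrow> computable (\<lambda>x. code_form (f x) = 0)"
  unfolding code_form_eq_0_iff by (intro computable_intros)

section \<open>Special projections and orthonormal families\<close>

text \<open>Entries are kept as a function of two indices, which reduces the decomposition to
  manipulations of finite sums; \<open>special_projection_iff\<close> translates from and to
  matrices.\<close>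

definition hermitian_idempotent :: "nat \<Rightarrow> (nat \<Rightarrow> nat \<Rightarrow> complex) \<Rightarrow> bool" where
  "hermitian_idempotent N S \<longleftrightarrow> (\<forall>i<N. \<forall>j<N. S j i = cnj (S i j)) \<and>
     (\<forall>i<N. \<forall>j<N. (\<Sum>k<N. S i k * S k j) = S i j)"

definition orthonormal_fam :: "nat \<Rightarrow> nat \<Rightarrow> (nat \<Rightarrow> nat \<Rightarrow> complex) \<Rightarrow> bool" where
  "orthonormal_fam N r v \<longleftrightarrow> (\<forall>a<r. \<forall>b<r. (\<Sum>i<N. v a i * cnj (v b i)) = (if a = b then 1 else 0))"

lemma hermitian_idempotentD:
  assumes "hermitian_idempotent N S" "i < N" "j < N"
  shows "S j i = cnj (S i j)" "(\<Sum>k<N. S i k * S k j) = S i j"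
  using assms unfolding hermitian_idempotent_def by blast+

lemma hermitian_idempotent_cong:
  assumes S: "hermitian_idempotent N S" and eq: "\<And>i j. i < N \<Longrightarrow> j < N \<Longrightarrow> T i j = S i j"
  shows "hermitian_idempotent N T"
  unfolding hermitian_idempotent_def
proof (intro conjI allI impI)
  fix i j assume ij: "i < N" "j < N"
  show "T j i = cnj (T i j)"
    unfolding eq[OF ij] eq[OF ij(2,1)] by (rule hermitian_idempotentD(1)[OF S ij])
  have "(\<Sum>k<N. T i k * T k j) = (\<Sum>k<N. S i k * S k j)"
    using ij by (intro sum.cong refl) (simp add: eq)
  then show "(\<Sum>k<N. T i k * T k j) = T i j"
    unfolding eq[OF ij] hermitian_idempotentD(2)[OF S ij] .
qed

lemma hermitian_idempotent_diag:
  assumes "hermitian_idempotent N S" "i < N"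
  shows "S i i = of_real (\<Sum>k<N. (norm (S i k))\<^sup>2)"
proof -
  have "S i i = (\<Sum>k<N. S i k * S k i)" using hermitian_idempotentD(2)[OF assms(1,2,2)] by (rule sym)
  also have "\<dots> = (\<Sum>k<N. of_real ((norm (S i k))\<^sup>2))"
  proof (intro sum.cong refl)
    fix k assume "k \<in> {..<N}"
    then have "S k i = cnj (S i k)" using hermitian_idempotentD(1)[OF assms] by simp
    then show "S i k * S k i = of_real ((norm (S i k))\<^sup>2)" by (simp only: complex_norm_square)
  qed
  finally show ?thesis by simp
qed

text \<open>A diagonal entry is the squared norm of its row, so a zero on the diagonal empties the
  row.\<close>

lemma hermitian_idempotent_diag_0:
  assumes S: "hermitian_idempotent N S" and "i < N" "j < N" "S i i = 0"
  shows "S i j = 0"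
proof -
  have "of_real (\<Sum>k<N. (norm (S i k))\<^sup>2) = (0 :: complex)"
    using hermitian_idempotent_diag[OF S assms(2)] assms(4) by (simp only:)
  then have "(\<Sum>k<N. (norm (S i k))\<^sup>2) = 0" by (simp only: of_real_eq_0_iff)
  then show ?thesis using assms(3) by (simp add: sum_nonneg_eq_0_iff)
qed

text \<open>One peels off the normalised \<open>j\<close>-th column for some \<open>j\<close> with \<open>S j j \<noteq> 0\<close>; this lowers the trace by one.\<close>

lemma hermitian_idempotent_decompose:
  assumes "hermitian_idempotent N S" "\<And>i j. i < N \<Longrightarrow> j < N \<Longrightarrow> algebraic (S i j)"
    and "Re (\<Sum>i<N. S i i) \<le> real k"
  shows "\<exists>r v. orthonormal_fam N r v \<and> (\<forall>a<r. \<forall>i<N. algebraic (v a i)) \<and>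
    (\<forall>i<N. \<forall>j<N. S i j = (\<Sum>a<r. v a i * cnj (v a j)))"
  using assms
proof (induction k arbitrary: S)
  case 0
  have nn: "0 \<le> Re (S i i)" if "i < N" for i
    by (subst hermitian_idempotent_diag[OF 0(1) that]) (simp only: Re_complex_of_real, intro sum_nonneg, simp)
  moreover have "(\<Sum>i<N. Re (S i i)) = 0"
    using 0(3) nn by (intro antisym sum_nonneg) auto
  ultimately have "Re (S i i) = 0" if "i < N" for i
    using that by (subst (asm) sum_nonneg_eq_0_iff) auto
  then have "S i i = 0" if "i < N" for i
  proof -
    define d where "d = (\<Sum>k<N. (norm (S i k))\<^sup>2)"
    have "S i i = of_real d" unfolding d_def by (rule hermitian_idempotent_diag[OF 0(1) that])
    with \<open>\<And>i. i < N \<Longrightarrow> Re (S i i) = 0\<close>[OF that] show ?thesis by simp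
  qed
  then have "S i j = 0" if "i < N" "j < N" for i j
    using hermitian_idempotent_diag_0[OF 0(1)] that by blast
  then show ?case by (intro exI[of _ 0]) (simp add: orthonormal_fam_def)
next
  case (Suc k)
  show ?case
  proof (cases "\<forall>j<N. S j j = 0")
    case True
    then have "S i j = 0" if "i < N" "j < N" for i j
      using hermitian_idempotent_diag_0[OF Suc.prems(1)] that by blast
    then show ?thesis by (intro exI[of _ 0]) (simp add: orthonormal_fam_def)
  next
    case False
    then obtain j where j: "j < N" "S j j \<noteq> 0" by blast
    have herm: "S b a = cnj (S a b)" if "a < N" "b < N" for a b
      by (rule hermitian_idempotentD(1)[OF Suc.prems(1) that])
    have idem: "(\<Sum>l<N. S a l * S l b) = S a b" if "a < N" "b < N" for a b
      by (rule hermitian_idempotentD(2)[OF Suc.prems(1) that])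
    define s where "s = (\<Sum>l<N. (norm (S j l))\<^sup>2)"
    have Sjj: "S j j = of_real s"
      unfolding s_def by (rule hermitian_idempotent_diag[OF Suc.prems(1) j(1)])
    have "s \<ge> 0" by (simp add: s_def sum_nonneg)
    with j Sjj have s: "s > 0" by (cases "s = 0") auto
    \<comment> \<open>By symmetry and idempotence the squared norm of the \<open>j\<close>-th column
      is \<open>S j j\<close>, so dividing by \<open>q\<close> normalises it; a square root of an
      algebraic number remains algebraic.\<close>
    define q where "q = sqrt s"
    have q: "q * q = s" "q > 0" using s by (simp_all add: q_def)
    define v where "v i = S i j / of_real q" for i
    have cnj_v: "cnj (v i) = S j i / of_real q" if "i < N" for i
      unfolding herm[OF that j(1)] by (simp add: v_def)
    have vv: "v a * cnj (v b) = S a j * S j b / of_real s" if "b < N" for a b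
      by (subst cnj_v[OF that]) (simp add: v_def q(1)[symmetric])
    have norm_v: "(\<Sum>i<N. v i * cnj (v i)) = 1"
    proof -
      have "(\<Sum>i<N. v i * cnj (v i)) = (\<Sum>i<N. S j i * S i j) / of_real s"
        by (simp add: vv sum_divide_distrib mult.commute)
      then show ?thesis using s by (simp add: idem j Sjj)
    qed
    define T where "T a b = S a b - v a * cnj (v b)" for a b
    have T_eq: "T a b = S a b - S a j * S j b / of_real s" if "b < N" for a b
      by (simp add: T_def vv that)
    have T: "hermitian_idempotent N T"
      unfolding hermitian_idempotent_def
    proof (intro conjI allI impI)
      fix a b assume ab: "a < N" "b < N"
      show "T b a = cnj (T a b)" unfolding T_def herm[OF ab] by (simp add: mult.commute)
      have "(\<Sum>l<N. T a l * T l b) = (\<Sum>l<N. S a l * S l b - (S a l * S l j) * (S j b / of_real s)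
          - (S a j / of_real s) * (S j l * S l b) + (S a j * S j b / (of_real s * of_real s)) * (S j l * S l j))"
        using ab by (intro sum.cong refl) (simp add: T_eq algebra_simps)
      also have "\<dots> = S a b - S a j * (S j b / of_real s) - (S a j / of_real s) * S j b
          + (S a j * S j b / (of_real s * of_real s)) * S j j"
        using ab j by (simp add: sum.distrib sum_subtractf sum_distrib_left[symmetric] sum_distrib_right[symmetric] idem
            del: times_divide_eq_left times_divide_eq_right)
      also have "\<dots> = T a b" using ab s by (simp add: T_eq Sjj field_simps)
      finally show "(\<Sum>l<N. T a l * T l b) = T a b" .
    qed
    have q_alg: "algebraic (of_real q :: complex)"
    proof -
      have "algebraic (of_real s :: complex)" using Suc.prems(2)[OF j(1) j(1)] by (simp add: Sjj)
      then show ?thesis unfolding q_def by (simp add: algebraic_sqrt)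
    qed
    have v_alg: "algebraic (v i)" if "i < N" for i
      unfolding v_def using Suc.prems(2)[OF that j(1)] q_alg by (rule algebraic_divide)
    have T_alg: "algebraic (T a b)" if "a < N" "b < N" for a b
      unfolding T_def using Suc.prems(2) v_alg that by (intro algebraic_diff algebraic_mult) auto
    have "(\<Sum>i<N. T i i) = (\<Sum>i<N. S i i) - 1"
      by (simp add: T_def sum_subtractf norm_v)
    \<comment> \<open>The induction runs on a bound for the trace, since the trace is seen to be an
      integer only once the decomposition is there.\<close>
    then have "Re (\<Sum>i<N. T i i) \<le> real k" using Suc.prems(3) by simp
    from Suc.IH[OF T T_alg this] obtain r u where u: "orthonormal_fam N r u"
      "\<forall>a<r. \<forall>i<N. algebraic (u a i)" "\<forall>i<N. \<forall>j<N. T i j = (\<Sum>a<r. u a i * cnj (u a j))" by blast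
    have Tv: "(\<Sum>b<N. T a b * v b) = 0" if "a < N" for a
    proof -
      have "(\<Sum>b<N. T a b * v b) = (\<Sum>b<N. S a b * S b j - (S a j / of_real s) * (S j b * S b j)) / of_real q"
        using that by (subst sum_divide_distrib) (intro sum.cong refl, simp add: T_eq v_def field_simps)
      also have "\<dots> = (S a j - (S a j / of_real s) * S j j) / of_real q"
        using that j by (simp add: sum_subtractf sum_distrib_left[symmetric] idem del: times_divide_eq_left)
      finally show ?thesis using s by (simp add: Sjj)
    qed
    \<comment> \<open>The remainder \<open>T\<close> annihilates \<open>v\<close>, and the squared
      moduli of the inner products \<open>z a\<close> add up to the quadratic form of
      \<open>T\<close> at \<open>v\<close>, which is 0. Hence \<open>v\<close> is orthogonal to the
      whole family obtained for \<open>T\<close>.\<close>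
    define z where "z a = (\<Sum>i<N. u a i * cnj (v i))" for a
    have "of_real (\<Sum>a<r. (norm (z a))\<^sup>2) = (\<Sum>a<r. z a * cnj (z a))"
      unfolding of_real_sum complex_norm_square ..
    also have "\<dots> = (\<Sum>a<r. \<Sum>i<N. \<Sum>b<N. cnj (v i) * (u a i * cnj (u a b) * v b))"
      by (intro sum.cong refl)
        (simp only: z_def cnj_sum complex_cnj_mult complex_cnj_cnj sum_product, intro sum.cong refl, simp)
    also have "\<dots> = (\<Sum>i<N. \<Sum>b<N. \<Sum>a<r. cnj (v i) * (u a i * cnj (u a b) * v b))"
      by (subst sum.swap, rule sum.cong[OF refl], rule sum.swap)
    also have "\<dots> = (\<Sum>i<N. cnj (v i) * (\<Sum>b<N. T i b * v b))"
      using u(3) by (intro sum.cong refl) (simp add: sum_distrib_left sum_distrib_right)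
    also have "\<dots> = 0" by (simp add: Tv)
    finally have "(\<Sum>a<r. (norm (z a))\<^sup>2) = 0" by (simp only: of_real_eq_0_iff)
    then have z0: "z a = 0" if "a < r" for a using that by (simp add: sum_nonneg_eq_0_iff)
    have z0': "(\<Sum>i<N. v i * cnj (u a i)) = 0" if "a < r" for a
    proof -
      have "(\<Sum>i<N. v i * cnj (u a i)) = cnj (z a)" by (simp add: z_def mult.commute)
      then show ?thesis using z0[OF that] by simp
    qed
    define w where "w a = (case a of 0 \<Rightarrow> v | Suc a' \<Rightarrow> u a')" for a
    show ?thesis
    proof (intro exI[of _ "Suc r"] exI[of _ w] conjI allI impI)
      show "orthonormal_fam N (Suc r) w"
        unfolding orthonormal_fam_def
      proof (intro allI impI)
        fix a b assume "a < Suc r" "b < Suc r"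
        then show "(\<Sum>i<N. w a i * cnj (w b i)) = (if a = b then 1 else 0)"
          using norm_v z0 z0' u(1) by (cases a; cases b) (simp_all add: w_def z_def orthonormal_fam_def)
      qed
      show "algebraic (w a i)" if "a < Suc r" "i < N" for a i
        using that u(2) v_alg by (cases a) (simp_all add: w_def)
      show "S a b = (\<Sum>c<Suc r. w c a * cnj (w c b))" if "a < N" "b < N" for a b
      proof -
        have "S a b = v a * cnj (v b) + T a b" by (simp add: T_def)
        also have "T a b = (\<Sum>c<r. u c a * cnj (u c b))" using u(3) that by simp
        finally show ?thesis by (simp add: sum.lessThan_Suc_shift w_def del: sum.lessThan_Suc)
      qed
    qed
  qed
qed

lemma orthonormal_fam_projection:
  assumes "orthonormal_fam N r v"
  defines "S \<equiv> \<lambda>i j. \<Sum>a<r. v a i * cnj (v a j)"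
  shows "hermitian_idempotent N S" "(\<Sum>i<N. S i i) = of_nat r"
proof -
  have orth: "(\<Sum>k<N. v b k * cnj (v a k)) = (if a = b then 1 else 0)" if "a < r" "b < r" for a b
    using assms(1) that by (auto simp: orthonormal_fam_def)
  show "hermitian_idempotent N S"
    unfolding hermitian_idempotent_def
  proof (intro conjI allI impI)
    fix i j
    show "S j i = cnj (S i j)" by (simp add: S_def mult.commute)
    have "(\<Sum>k<N. S i k * S k j) = (\<Sum>k<N. \<Sum>a<r. \<Sum>b<r. v a i * cnj (v b j) * (v b k * cnj (v a k)))"
      by (intro sum.cong refl) (simp only: S_def sum_product, intro sum.cong refl, simp)
    also have "\<dots> = (\<Sum>a<r. \<Sum>b<r. \<Sum>k<N. v a i * cnj (v b j) * (v b k * cnj (v a k)))"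
      by (subst sum.swap, rule sum.cong[OF refl], rule sum.swap)
    also have "\<dots> = (\<Sum>a<r. \<Sum>b<r. v a i * cnj (v b j) * (if a = b then 1 else 0))"
      by (intro sum.cong refl) (simp add: sum_distrib_left[symmetric] orth)
    also have "\<dots> = S i j" by (simp add: S_def if_distrib[of "\<lambda>x. _ * x"] sum.delta cong: if_cong)
    finally show "(\<Sum>k<N. S i k * S k j) = S i j" .
  qed
  have "(\<Sum>i<N. S i i) = (\<Sum>a<r. \<Sum>i<N. v a i * cnj (v a i))"
    unfolding S_def by (rule sum.swap)
  then show "(\<Sum>i<N. S i i) = of_nat r" by (simp add: orth)
qed

lemma mat_adjoint_index:
  assumes "A \<in> carrier_mat n n" "i < n" "j < n"
  shows "mat_adjoint A $$ (i, j) = cnj (A $$ (j, i))"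
  using assms by (simp add: mat_adjoint_def mat_of_rows_index)

lemma special_projection_iff:
  assumes "S \<in> carrier_mat (2 ^ n) (2 ^ n)"
  shows "special_projection n S \<longleftrightarrow> hermitian_idempotent (2 ^ n) (\<lambda>i j. S $$ (i, j)) \<and>
    (\<forall>i<2 ^ n. \<forall>j<2 ^ n. algebraic (S $$ (i, j)))"
proof -
  let ?N = "2 ^ n :: nat"
  have "mat_adjoint S = S \<longleftrightarrow> (\<forall>i<?N. \<forall>j<?N. S $$ (j, i) = cnj (S $$ (i, j)))"
  proof
    assume "mat_adjoint S = S"
    then show "\<forall>i<?N. \<forall>j<?N. S $$ (j, i) = cnj (S $$ (i, j))"
      using mat_adjoint_index[OF assms, symmetric] by simp
  next
    assume *: "\<forall>i<?N. \<forall>j<?N. S $$ (j, i) = cnj (S $$ (i, j))"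
    show "mat_adjoint S = S"
    proof (rule eq_matI)
      fix i j assume "i < dim_row S" "j < dim_col S"
      then have "i < ?N" "j < ?N" using assms by auto
      then show "mat_adjoint S $$ (i, j) = S $$ (i, j)"
        using *[rule_format, of j i] mat_adjoint_index[OF assms] by simp
    qed (use assms in \<open>auto simp: mat_adjoint_def\<close>)
  qed
  moreover have "(S * S) $$ (i, j) = (\<Sum>k<?N. S $$ (i, k) * S $$ (k, j))" if "i < ?N" "j < ?N" for i j
    using assms that by (simp add: scalar_prod_def lessThan_atLeast0)
  then have "S * S = S \<longleftrightarrow> (\<forall>i<?N. \<forall>j<?N. (\<Sum>k<?N. S $$ (i, k) * S $$ (k, j)) = S $$ (i, j))"
    using assms by (auto simp: mat_eq_iff)
  ultimately show ?thesis
    unfolding special_projection_def hermitian_idempotent_def using assms by blast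
qed

section \<open>Coded orthonormal families\<close>

lemma alg_of_code_surj:
  assumes "algebraic z"
  shows "\<exists>c. alg_of_code c = z"
proof -
  obtain as k where "alg as k = z" using alg_surj[OF assms] by blast
  then have "alg_of_code (prod_encode (list_encode (map int_encode as), k)) = z"
    by (simp add: alg_of_code_eq o_def)
  then show ?thesis by blast
qed

text \<open>A choice of code with no claim of computability. Inside functions that must be
  computable it is applied only to 1 and -1, where it is a fixed number; all other uses are in
  proofs of existence.\<close>

definition alg_code :: "complex \<Rightarrow> nat" where
  "alg_code z = (SOME c. alg_of_code c = z)"

lemma alg_of_code_alg_code: "algebraic z \<Longrightarrow> alg_of_code (alg_code z) = z"
  unfolding alg_code_def by (rule someI_ex) (rule alg_of_code_surj)

lemma algebraic_1_minus_1: "algebraic (1 :: complex)" "algebraic (- 1 :: complex)"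
  by (rule rat_imp_algebraic, simp)+

lemma alg_of_code_constants [simp]: "alg_of_code (alg_code 1) = 1" "alg_of_code (alg_code (- 1)) = - 1"
  by (rule alg_of_code_alg_code, rule algebraic_1_minus_1)+

lemma algebraic_alg_of_code: "algebraic (alg_of_code c)"
  unfolding alg_of_code_alg by (rule algebraic_alg)

definition code_vec :: "nat list \<Rightarrow> complex vec" where
  "code_vec us = vec_of_list (map alg_of_code us)"

definition code_vecs :: "nat \<Rightarrow> nat list list" where
  "code_vecs c = map list_decode (list_decode c)"

lemma fset_of_code_eq: "fset_of_code c = code_vec ` set (code_vecs c)"
  by (auto simp: fset_of_code_def code_vec_def code_vecs_def simp del: vec_of_list_map)

lemma computable_code_vecs [computable_intros]: "computable f \<Longrightarrow> computable (\<lambda>x. code_vecs (f x))"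
  unfolding code_vecs_def by (intro computable_intros)

lemma dim_code_vec [simp]: "dim_vec (code_vec us) = length us"
  by (simp add: code_vec_def)

lemma code_vec_index: "i < length us \<Longrightarrow> code_vec us $ i = alg_of_code (us ! i)"
  by (simp add: code_vec_def vec_of_list_index del: vec_of_list_map)

lemma code_vec_carrier: "code_vec us \<in> carrier_vec n \<longleftrightarrow> length us = n"
  unfolding carrier_vec_def mem_Collect_eq dim_code_vec ..

lemma cscalar_prod_sum:
  fixes v w :: "complex vec"
  shows "dim_vec w = n \<Longrightarrow> v \<bullet>c w = (\<Sum>i<n. v $ i * cnj (w $ i))"
  by (simp add: scalar_prod_def lessThan_atLeast0)

lemma code_form_append: "code_form (L @ L') = code_form L + code_form L'"
  by (simp add: code_form_def)

lemma code_form_zip: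
  assumes "length us = length vs"
  shows "code_form (zip us vs) = code_vec us \<bullet>c code_vec vs"
proof -
  have "code_form (zip us vs) = (\<Sum>i<length us. alg_of_code (us ! i) * cnj (alg_of_code (vs ! i)))"
    using assms by (simp add: code_form_def sum_list_sum_nth lessThan_atLeast0)
  also have "\<dots> = code_vec us \<bullet>c code_vec vs"
    using assms by (subst cscalar_prod_sum[where n = "length us"]) (auto simp: code_vec_index)
  finally show ?thesis .
qed

lemma computable_zip [computable_intros]:
  assumes "computable f" "computable g"
  shows "computable (\<lambda>x. zip (f x) (g x) :: (nat \<times> nat) list)"
proof -
  have "computable (\<lambda>x. map (\<lambda>i. (nth_dflt 0 (f x) i, nth_dflt 0 (g x) i))
      [0..<if length (f x) \<le> length (g x) then length (f x) else length (g x)])"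
    by (intro computable_intros assms computable_compose[OF assms(1)] computable_compose[OF assms(2)])
  moreover have "map (\<lambda>i. (nth_dflt 0 us i, nth_dflt 0 vs i)) [0..<if length us \<le> length vs then length us else length vs] = zip us vs"
    for us vs :: "nat list"
    by (rule nth_equalityI) (auto simp: min_def split: if_splits)
  ultimately show ?thesis by simp
qed

text \<open>Different codes may denote the same number, so equality of entries is the vanishing of a
  two-term form: the difference of the entries.\<close>

definition same_vec :: "nat list \<Rightarrow> nat list \<Rightarrow> bool" where
  "same_vec us vs \<longleftrightarrow> length us = length vs \<and>
     (\<forall>i<length us. code_form [(nth_dflt 0 us i, alg_code 1), (nth_dflt 0 vs i, alg_code (- 1))] = 0)"

lemma same_vec_iff: "same_vec us vs \<longleftrightarrow> code_vec us = code_vec vs"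
proof -
  have "code_form [(nth_dflt 0 us i, alg_code 1), (nth_dflt 0 vs i, alg_code (- 1))] = 0 \<longleftrightarrow>
      code_vec us $ i = code_vec vs $ i" if "length us = length vs" "i < length us" for i
    using that by (simp add: code_form_def code_vec_index)
  then show ?thesis
    unfolding same_vec_def vec_eq_iff by auto
qed

lemma computable_same_vec [computable_intros]:
  "computable f \<Longrightarrow> computable g \<Longrightarrow> computable (\<lambda>x. same_vec (f x) (g x))"
  by (rule computable_compose2[where f = same_vec]) (unfold same_vec_def, intro computable_intros)

text \<open>The appended pair contributes -1, turning the requirement of inner product 1 into a zero
  test. It is triggered by equality of the vectors and not of the indices, because the list may
  repeat a vector of the set it describes.\<close>

definition code_orthonormal :: "nat \<Rightarrow> nat list list \<Rightarrow> bool" where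
  "code_orthonormal n cs \<longleftrightarrow> (\<forall>a<length cs. length (nth_dflt [] cs a) = 2 ^ n) \<and>
     (\<forall>a<length cs. \<forall>b<length cs. code_form (zip (nth_dflt [] cs a) (nth_dflt [] cs b) @
        (if same_vec (nth_dflt [] cs a) (nth_dflt [] cs b) then [(alg_code (- 1), alg_code 1)] else [])) = 0)"

lemma computable_code_orthonormal [computable_intros]:
  "computable f \<Longrightarrow> computable g \<Longrightarrow> computable (\<lambda>x. code_orthonormal (f x) (g x))"
  by (rule computable_compose2[where f = code_orthonormal]) (unfold code_orthonormal_def, intro computable_intros)

lemma code_orthonormal_iff: "code_orthonormal n cs \<longleftrightarrow> orthonormal_alg n (code_vec ` set cs)"
proof -
  have 1: "(\<forall>a<length cs. length (nth_dflt [] cs a) = 2 ^ n) \<longleftrightarrow> code_vec ` set cs \<subseteq> carrier_vec (2 ^ n)"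
    by (auto simp: image_subset_iff code_vec_carrier all_set_conv_all_nth)
  have 2: "code_form (zip us vs @ (if same_vec us vs then [(alg_code (- 1), alg_code 1)] else [])) = 0 \<longleftrightarrow>
      code_vec us \<bullet>c code_vec vs = (if code_vec us = code_vec vs then 1 else 0)"
    if "length us = length vs" for us vs
    using that by (simp add: code_form_append code_form_zip same_vec_iff) (simp add: code_form_def)
  have 3: "(\<forall>v\<in>code_vec ` set cs. \<forall>i<dim_vec v. algebraic (v $ i))"
    by (auto simp: code_vec_index algebraic_alg_of_code)
  have "code_orthonormal n cs \<longleftrightarrow> code_vec ` set cs \<subseteq> carrier_vec (2 ^ n) \<and>
     (\<forall>us\<in>set cs. \<forall>vs\<in>set cs. code_form (zip us vs @
        (if same_vec us vs then [(alg_code (- 1), alg_code 1)] else [])) = 0)"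
    unfolding code_orthonormal_def 1 all_set_conv_all_nth by simp
  also have "\<dots> \<longleftrightarrow> orthonormal_alg n (code_vec ` set cs)"
  proof (cases "code_vec ` set cs \<subseteq> carrier_vec (2 ^ n)")
    case True
    then have "length us = length vs" if "us \<in> set cs" "vs \<in> set cs" for us vs
      using that by (auto simp: image_subset_iff code_vec_carrier)
    then have "(\<forall>us\<in>set cs. \<forall>vs\<in>set cs. code_form (zip us vs @
        (if same_vec us vs then [(alg_code (- 1), alg_code 1)] else [])) = 0) \<longleftrightarrow>
        (\<forall>us\<in>set cs. \<forall>vs\<in>set cs. code_vec us \<bullet>c code_vec vs = (if code_vec us = code_vec vs then 1 else 0))"
      by (intro ball_cong refl 2)
    also have "\<dots> \<longleftrightarrow> (\<forall>v\<in>code_vec ` set cs. \<forall>w\<in>code_vec ` set cs. v \<bullet>c w = (if v = w then 1 else 0))"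
      by (simp only: ball_simps)
    also have "\<dots> \<longleftrightarrow> orthonormal_alg n (code_vec ` set cs)"
      unfolding orthonormal_alg_def
      by (rule iffI, intro conjI True 3, assumption, elim conjE, assumption)
    finally show ?thesis by (simp only: True simp_thms)
  qed (simp only: orthonormal_alg_def simp_thms)
  finally show ?thesis .
qed

lemma orthonormal_algD:
  fixes F :: "complex vec set" and v :: "complex vec"
  assumes "orthonormal_alg n F" "v \<in> F"
  shows "v \<in> carrier_vec (2 ^ n)" "\<And>i. i < 2 ^ n \<Longrightarrow> algebraic (v $ i)"
    "w \<in> F \<Longrightarrow> v \<bullet>c w = (if v = w then 1 else 0)"
proof -
  note D = assms(1)[unfolded orthonormal_alg_def]
  show v: "v \<in> carrier_vec (2 ^ n)" by (rule subsetD[OF conjunct1[OF D] assms(2)])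
  show "\<And>i. i < 2 ^ n \<Longrightarrow> algebraic (v $ i)"
    using bspec[OF conjunct1[OF conjunct2[OF D]] assms(2)] carrier_vecD[OF v] by simp
  show "v \<bullet>c w = (if v = w then 1 else 0)" if "w \<in> F"
    by (rule bspec[OF bspec[OF conjunct2[OF conjunct2[OF D]] assms(2)] that])
qed

definition code_entry :: "nat \<Rightarrow> nat \<Rightarrow> nat \<Rightarrow> nat" where
  "code_entry e i j = nth_dflt 0 (list_decode (nth_dflt 0 (list_decode e) i)) j"

lemma smat_of_code_eq: "smat_of_code (prod_encode (n, e)) =
  (n, mat (2 ^ n) (2 ^ n) (\<lambda>(i, j). alg_of_code (code_entry e i j)))"
  by (simp add: smat_of_code_def code_entry_def lookup0_def nth_dflt_def)

lemma computable_code_entry [computable_intros]: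
  "computable f \<Longrightarrow> computable g \<Longrightarrow> computable h \<Longrightarrow> computable (\<lambda>x. code_entry (f x) (g x) (h x))"
  unfolding code_entry_def by (intro computable_intros)

text \<open>\<open>code_frame n cs e\<close>: the vectors coded by \<open>cs\<close> form an orthonormal family without repetitions in
  dimension \<open>2 ^ n\<close>, and \<open>e\<close> codes the orthogonal projection onto its span.\<close>

definition code_frame :: "nat \<Rightarrow> nat list list \<Rightarrow> nat \<Rightarrow> bool" where
  "code_frame n cs e \<longleftrightarrow> code_orthonormal n cs \<and>
     (\<forall>a<length cs. \<forall>b<length cs. same_vec (nth_dflt [] cs a) (nth_dflt [] cs b) \<longrightarrow> a = b) \<and>
     (\<forall>i<2 ^ n. \<forall>j<2 ^ n. code_form (map (\<lambda>us. (nth_dflt 0 us i, nth_dflt 0 us j)) cs @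
        [(code_entry e i j, alg_code (- 1))]) = 0)"

lemma computable_code_frame [computable_intros]:
  "computable f \<Longrightarrow> computable g \<Longrightarrow> computable h \<Longrightarrow> computable (\<lambda>x. code_frame (f x) (g x) (h x))"
  by (rule computable_compose3[where f = code_frame]) (unfold code_frame_def, intro computable_intros)

lemma code_frame_iff:
  "code_frame n cs e \<longleftrightarrow> orthonormal_alg n (code_vec ` set cs) \<and> inj_on (\<lambda>a. code_vec (cs ! a)) {..<length cs} \<and>
    (\<forall>i<2 ^ n. \<forall>j<2 ^ n. alg_of_code (code_entry e i j) =
       (\<Sum>a<length cs. code_vec (cs ! a) $ i * cnj (code_vec (cs ! a) $ j)))"
proof -
  have "code_form (map (\<lambda>us. (nth_dflt 0 us i, nth_dflt 0 us j)) cs @ [(code_entry e i j, alg_code (- 1))]) = 0 \<longleftrightarrow>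
     alg_of_code (code_entry e i j) = (\<Sum>a<length cs. code_vec (cs ! a) $ i * cnj (code_vec (cs ! a) $ j))"
    if ij: "i < 2 ^ n" "j < 2 ^ n" and orth: "orthonormal_alg n (code_vec ` set cs)" for i j
  proof -
    have len: "length (cs ! a) = 2 ^ n" if "a < length cs" for a
      using orthonormal_algD(1)[OF orth, of "code_vec (cs ! a)"] that by (simp add: code_vec_carrier)
    have "code_form (map (\<lambda>us. (nth_dflt 0 us i, nth_dflt 0 us j)) cs)
        = (\<Sum>a<length cs. alg_of_code (nth_dflt 0 (cs ! a) i) * cnj (alg_of_code (nth_dflt 0 (cs ! a) j)))"
      by (simp add: code_form_def sum_list_sum_nth lessThan_atLeast0)
    also have "\<dots> = (\<Sum>a<length cs. code_vec (cs ! a) $ i * cnj (code_vec (cs ! a) $ j))"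
      using ij len by (intro sum.cong refl) (simp add: code_vec_index)
    finally have "code_form (map (\<lambda>us. (nth_dflt 0 us i, nth_dflt 0 us j)) cs)
        = (\<Sum>a<length cs. code_vec (cs ! a) $ i * cnj (code_vec (cs ! a) $ j))" .
    then have "code_form (map (\<lambda>us. (nth_dflt 0 us i, nth_dflt 0 us j)) cs @ [(code_entry e i j, alg_code (- 1))])
        = (\<Sum>a<length cs. code_vec (cs ! a) $ i * cnj (code_vec (cs ! a) $ j)) - alg_of_code (code_entry e i j)"
      unfolding code_form_append by (simp add: code_form_def)
    then show ?thesis by auto
  qed
  moreover have "(\<forall>a<length cs. \<forall>b<length cs. same_vec (nth_dflt [] cs a) (nth_dflt [] cs b) \<longrightarrow> a = b)
      \<longleftrightarrow> inj_on (\<lambda>a. code_vec (cs ! a)) {..<length cs}"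
    by (auto simp: inj_on_def same_vec_iff)
  ultimately show ?thesis
    unfolding code_frame_def code_orthonormal_iff by auto
qed

lemma code_frame_sum:
  assumes "code_frame n cs e"
  shows "(\<Sum>v\<in>code_vec ` set cs. f v) = (\<Sum>a<length cs. f (code_vec (cs ! a)))"
    and "card (code_vec ` set cs) = length cs"
proof -
  have inj: "inj_on (\<lambda>a. code_vec (cs ! a)) {..<length cs}"
    using assms by (simp add: code_frame_iff)
  have img: "code_vec ` set cs = (\<lambda>a. code_vec (cs ! a)) ` {..<length cs}"
    by (auto simp: set_conv_nth image_iff)
  show "(\<Sum>v\<in>code_vec ` set cs. f v) = (\<Sum>a<length cs. f (code_vec (cs ! a)))"
    unfolding img by (simp add: sum.reindex[OF inj])
  show "card (code_vec ` set cs) = length cs"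
    unfolding img by (simp add: card_image[OF inj])
qed

lemma code_frame_correct:
  assumes fr: "code_frame n cs e"
  defines "S \<equiv> smat_of_code (prod_encode (n, e))"
  shows "fst S = n" "special_projection n (snd S)" "tau_meas S = length cs / 2 ^ n"
    "\<rho> n \<in> carrier_mat (2 ^ n) (2 ^ n) \<Longrightarrow>
      rho_meas \<rho> S = Re (\<Sum>v\<in>code_vec ` set cs. (\<rho> n *\<^sub>v v) \<bullet>c v)"
proof -
  let ?N = "2 ^ n :: nat"
  define v where "v a i = code_vec (cs ! a) $ i" for a i
  have S: "S = (n, mat ?N ?N (\<lambda>(i, j). alg_of_code (code_entry e i j)))"
    unfolding S_def by (rule smat_of_code_eq)
  then show fst: "fst S = n" by simp
  have carr: "snd S \<in> carrier_mat ?N ?N" by (simp add: S)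
  have entry: "snd S $$ (i, j) = (\<Sum>a<length cs. v a i * cnj (v a j))" if "i < ?N" "j < ?N" for i j
    using fr that unfolding code_frame_iff by (simp add: S v_def)
  have orth: "orthonormal_alg n (code_vec ` set cs)" and inj: "inj_on (\<lambda>a. code_vec (cs ! a)) {..<length cs}"
    using fr unfolding code_frame_iff by auto
  have dim: "dim_vec (code_vec (cs ! a)) = ?N" if "a < length cs" for a
    using orthonormal_algD(1)[OF orth, of "code_vec (cs ! a)"] that by (simp add: code_vec_carrier)
  have fam: "orthonormal_fam ?N (length cs) v"
    unfolding orthonormal_fam_def
  proof (intro allI impI)
    fix a b assume ab: "a < length cs" "b < length cs"
    have "(\<Sum>i<?N. v a i * cnj (v b i)) = code_vec (cs ! a) \<bullet>c code_vec (cs ! b)"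
      unfolding v_def using dim[OF ab(2)] by (simp add: cscalar_prod_sum)
    also have "\<dots> = (if code_vec (cs ! a) = code_vec (cs ! b) then 1 else 0)"
      by (rule orthonormal_algD(3)[OF orth]) (use ab in auto)
    also have "code_vec (cs ! a) = code_vec (cs ! b) \<longleftrightarrow> a = b"
      using inj ab by (auto simp: inj_on_def)
    finally show "(\<Sum>i<?N. v a i * cnj (v b i)) = (if a = b then 1 else 0)" .
  qed
  note P = orthonormal_fam_projection[OF fam]
  show "special_projection n (snd S)"
    unfolding special_projection_iff[OF carr]
  proof (intro conjI allI impI)
    show "hermitian_idempotent ?N (\<lambda>i j. snd S $$ (i, j))"
      using P(1) by (rule hermitian_idempotent_cong) (rule entry)
    show "algebraic (snd S $$ (i, j))" if "i < ?N" "j < ?N" for i j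
      using that by (simp add: S algebraic_alg_of_code)
  qed
  have "mtrace (snd S) = (\<Sum>i<?N. \<Sum>a<length cs. v a i * cnj (v a i))"
    using carr by (simp add: mtrace_def entry)
  also have "\<dots> = of_nat (length cs)" by (rule P(2))
  finally show "tau_meas S = length cs / 2 ^ n" by (simp add: tau_meas_def fst)
  assume \<rho>: "\<rho> n \<in> carrier_mat ?N ?N"
  have "mtrace (\<rho> n * snd S) = (\<Sum>i<?N. \<Sum>k<?N. \<rho> n $$ (i, k) * snd S $$ (k, i))"
    using \<rho> carr by (simp add: mtrace_def scalar_prod_def lessThan_atLeast0)
  also have "\<dots> = (\<Sum>i<?N. \<Sum>k<?N. \<Sum>a<length cs. \<rho> n $$ (i, k) * (v a k * cnj (v a i)))"
    by (intro sum.cong refl) (simp add: entry sum_distrib_left)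
  also have "\<dots> = (\<Sum>i<?N. \<Sum>a<length cs. \<Sum>k<?N. \<rho> n $$ (i, k) * (v a k * cnj (v a i)))"
    by (intro sum.cong refl sum.swap)
  also have "\<dots> = (\<Sum>a<length cs. \<Sum>i<?N. \<Sum>k<?N. \<rho> n $$ (i, k) * (v a k * cnj (v a i)))"
    by (rule sum.swap)
  also have "\<dots> = (\<Sum>a<length cs. (\<rho> n *\<^sub>v code_vec (cs ! a)) \<bullet>c code_vec (cs ! a))"
  proof (intro sum.cong refl)
    fix a assume "a \<in> {..<length cs}"
    then have d: "length (cs ! a) = ?N" using dim[of a] by simp
    have "(\<rho> n *\<^sub>v code_vec (cs ! a)) \<bullet>c code_vec (cs ! a) = (\<Sum>i<?N. (\<rho> n *\<^sub>v code_vec (cs ! a)) $ i * cnj (v a i))"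
      using d by (simp add: cscalar_prod_sum v_def)
    also have "\<dots> = (\<Sum>i<?N. (\<Sum>k<?N. \<rho> n $$ (i, k) * v a k) * cnj (v a i))"
      using \<rho> d by (intro sum.cong refl) (simp add: scalar_prod_def lessThan_atLeast0 v_def)
    also have "\<dots> = (\<Sum>i<?N. \<Sum>k<?N. \<rho> n $$ (i, k) * (v a k * cnj (v a i)))"
      by (simp add: sum_distrib_right mult.assoc)
    finally show "(\<Sum>i<?N. \<Sum>k<?N. \<rho> n $$ (i, k) * (v a k * cnj (v a i))) =
      (\<rho> n *\<^sub>v code_vec (cs ! a)) \<bullet>c code_vec (cs ! a)" by (rule sym)
  qed
  also have "\<dots> = (\<Sum>v\<in>code_vec ` set cs. (\<rho> n *\<^sub>v v) \<bullet>c v)"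
    by (rule code_frame_sum(1)[OF fr, symmetric])
  finally show "rho_meas \<rho> S = Re (\<Sum>v\<in>code_vec ` set cs. (\<rho> n *\<^sub>v v) \<bullet>c v)"
    by (simp add: rho_meas_def fst)
qed

text \<open>Guarantees that the search for a frame of a given matrix code \<open>e\<close> ends; the
  frame itself is later selected by that search.\<close>

lemma special_projection_has_frame:
  assumes sp: "special_projection n (snd (smat_of_code (prod_encode (n, e))))"
  shows "\<exists>cs. code_frame n cs e"
proof -
  let ?N = "2 ^ n :: nat"
  define S where "S i j = alg_of_code (code_entry e i j)" for i j
  have carr: "snd (smat_of_code (prod_encode (n, e))) \<in> carrier_mat ?N ?N"
    by (simp add: smat_of_code_eq)
  have "hermitian_idempotent ?N (\<lambda>i j. snd (smat_of_code (prod_encode (n, e))) $$ (i, j))"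
    using sp unfolding special_projection_iff[OF carr] by blast
  then have S: "hermitian_idempotent ?N S"
    by (rule hermitian_idempotent_cong) (simp add: smat_of_code_eq S_def)
  obtain k :: nat where "Re (\<Sum>i<?N. S i i) \<le> real k" using real_arch_simple by blast
  from hermitian_idempotent_decompose[OF S _ this]
  obtain r v where v: "orthonormal_fam ?N r v" "\<forall>a<r. \<forall>i<?N. algebraic (v a i)"
    "\<forall>i<?N. \<forall>j<?N. S i j = (\<Sum>a<r. v a i * cnj (v a j))"
    by (auto simp: S_def algebraic_alg_of_code)
  define cs where "cs = map (\<lambda>a. map (\<lambda>i. alg_code (v a i)) [0..<?N]) [0..<r]"
  have len: "length cs = r" "\<And>a. a < r \<Longrightarrow> length (cs ! a) = ?N" by (simp_all add: cs_def)
  have idx: "code_vec (cs ! a) $ i = v a i" if "a < r" "i < ?N" for a i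
    using that v(2) len by (simp add: code_vec_index) (simp add: cs_def alg_of_code_alg_code)
  have ip: "code_vec (cs ! a) \<bullet>c code_vec (cs ! b) = (if a = b then 1 else 0)" if "a < r" "b < r" for a b
  proof -
    have "code_vec (cs ! a) \<bullet>c code_vec (cs ! b) = (\<Sum>i<?N. v a i * cnj (v b i))"
      using that len by (simp add: cscalar_prod_sum idx)
    then show ?thesis using v(1) that by (simp add: orthonormal_fam_def)
  qed
  have inj: "a = b" if "a < r" "b < r" "code_vec (cs ! a) = code_vec (cs ! b)" for a b
    using ip[OF that(1,2)] ip[OF that(2,2)] that(3) by (auto split: if_splits)
  have "orthonormal_alg n (code_vec ` set cs)"
    unfolding orthonormal_alg_def
  proof (intro conjI ballI)
    show "code_vec ` set cs \<subseteq> carrier_vec (2 ^ n)"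
      by (auto simp: code_vec_carrier cs_def)
    show "\<forall>i<dim_vec w. algebraic (w $ i)" if "w \<in> code_vec ` set cs" for w
      using that by (auto simp: code_vec_index algebraic_alg_of_code)
    fix w x assume "w \<in> code_vec ` set cs" "x \<in> code_vec ` set cs"
    then obtain a b where "a < r" "b < r" "w = code_vec (cs ! a)" "x = code_vec (cs ! b)"
      by (auto simp: in_set_conv_nth len)
    then show "w \<bullet>c x = (if w = x then 1 else 0)" using ip inj by auto
  qed
  moreover have "inj_on (\<lambda>a. code_vec (cs ! a)) {..<length cs}"
    using inj by (auto simp: inj_on_def len)
  ultimately have "code_frame n cs e"
    unfolding code_frame_iff using v(3) by (simp add: idx len S_def[symmetric])
  then show ?thesis by blast
qed

text \<open>One code is kept for each vector of the set, so the length of the new list is the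
  cardinality of the set. The entries of the projection are algebraic by closure and therefore have
  codes.\<close>

lemma orthonormal_has_frame:
  assumes orth: "orthonormal_alg n (code_vec ` set cs)"
  shows "\<exists>cs' e. code_frame n cs' e \<and> code_vec ` set cs' = code_vec ` set cs"
proof -
  let ?N = "2 ^ n :: nat"
  obtain vs where vs: "set vs = code_vec ` set cs" "distinct vs"
    using finite_distinct_list[of "code_vec ` set cs", OF finite_imageI[OF finite_set]]
    by (elim exE conjE)
  have "\<forall>v. \<exists>us. v \<in> set vs \<longrightarrow> us \<in> set cs \<and> code_vec us = v" unfolding vs(1) by blast
  from choice[OF this] obtain g where g: "\<And>v. v \<in> set vs \<Longrightarrow> code_vec (g v) = v" by blast
  define cs' where "cs' = map g vs"
  have idx: "code_vec (cs' ! a) = vs ! a" if "a < length vs" for a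
    using that g by (simp add: cs'_def)
  have len: "length cs' = length vs" by (simp add: cs'_def)
  have img: "code_vec ` set cs' = code_vec ` set cs"
  proof -
    have "code_vec ` set cs' = (\<lambda>v. code_vec (g v)) ` set vs" by (simp add: cs'_def image_image)
    also have "\<dots> = (\<lambda>v. v) ` set vs" by (rule image_cong[OF refl g])
    finally show ?thesis using vs(1) by simp
  qed
  define T where "T i j = (\<Sum>a<length cs'. code_vec (cs' ! a) $ i * cnj (code_vec (cs' ! a) $ j))" for i j
  define e where "e = list_encode (map (\<lambda>i. list_encode (map (\<lambda>j. alg_code (T i j)) [0..<?N])) [0..<?N])"
  have T_alg: "algebraic (T i j)" if "i < ?N" "j < ?N" for i j
  proof -
    have "algebraic (\<Sum>(a, b)\<leftarrow>map (\<lambda>v. (v $ i, cnj (v $ j))) vs. a * b)"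
    proof (rule algebraic_sum_list_products)
      fix a b assume "(a, b) \<in> set (map (\<lambda>v. (v $ i, cnj (v $ j))) vs)"
      then obtain v where v: "v \<in> set vs" "a = v $ i" "b = cnj (v $ j)" by auto
      then have "algebraic (v $ i)" "algebraic (v $ j)"
        using orthonormal_algD(2)[OF orth, of v] that vs(1) by blast+
      then show "algebraic a \<and> algebraic b" using v by simp
    qed
    also have "(\<Sum>(a, b)\<leftarrow>map (\<lambda>v. (v $ i, cnj (v $ j))) vs. a * b) = (\<Sum>a<length vs. vs ! a $ i * cnj (vs ! a $ j))"
      by (simp add: o_def sum_list_sum_nth lessThan_atLeast0)
    also have "\<dots> = T i j"
      unfolding T_def len by (intro sum.cong refl) (simp only: idx lessThan_iff)
    finally show ?thesis .
  qed
  have "alg_of_code (code_entry e i j) = T i j" if "i < ?N" "j < ?N" for i j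
    using that T_alg by (simp add: e_def code_entry_def alg_of_code_alg_code)
  moreover have "inj_on (\<lambda>a. code_vec (cs' ! a)) {..<length cs'}"
    using vs(2) by (auto simp: inj_on_def idx len nth_eq_iff_index_eq)
  ultimately have "code_frame n cs' e"
    unfolding code_frame_iff img T_def[symmetric] using orth by simp
  with img show ?thesis by blast
qed

text \<open>Ties a frame found by search to the set put out by a machine, so that both have the same
  cardinality and the same quadratic sum against a density matrix.\<close>

definition same_set :: "nat list list \<Rightarrow> nat list list \<Rightarrow> bool" where
  "same_set cs ds \<longleftrightarrow> (\<forall>a<length cs. \<exists>b<length ds. same_vec (nth_dflt [] cs a) (nth_dflt [] ds b)) \<and>
     (\<forall>b<length ds. \<exists>a<length cs. same_vec (nth_dflt [] cs a) (nth_dflt [] ds b))"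

lemma computable_same_set [computable_intros]:
  "computable f \<Longrightarrow> computable g \<Longrightarrow> computable (\<lambda>x. same_set (f x) (g x))"
  by (rule computable_compose2[where f = same_set]) (unfold same_set_def, intro computable_intros)

lemma bex_set_conv_nth: "(\<exists>x\<in>set xs. P x) \<longleftrightarrow> (\<exists>i<length xs. P (xs ! i))"
  unfolding Bex_def in_set_conv_nth by blast

lemma same_set_iff: "same_set cs ds \<longleftrightarrow> code_vec ` set cs = code_vec ` set ds"
proof -
  have "same_set cs ds \<longleftrightarrow> (\<forall>us\<in>set cs. \<exists>vs\<in>set ds. code_vec us = code_vec vs) \<and>
      (\<forall>vs\<in>set ds. \<exists>us\<in>set cs. code_vec us = code_vec vs)"
    unfolding same_set_def same_vec_iff all_set_conv_all_nth by (simp add: bex_set_conv_nth cong: conj_cong)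
  also have "\<dots> \<longleftrightarrow> code_vec ` set cs = code_vec ` set ds"
  proof
    assume *: "(\<forall>us\<in>set cs. \<exists>vs\<in>set ds. code_vec us = code_vec vs) \<and> (\<forall>vs\<in>set ds. \<exists>us\<in>set cs. code_vec us = code_vec vs)"
    show "code_vec ` set cs = code_vec ` set ds"
    proof (intro equalityI image_subsetI)
      fix us assume "us \<in> set cs"
      with * obtain vs where "vs \<in> set ds" "code_vec us = code_vec vs" by blast
      then show "code_vec us \<in> code_vec ` set ds" by simp
    next
      fix vs assume "vs \<in> set ds"
      with * obtain us where "us \<in> set cs" "code_vec us = code_vec vs" by blast
      then show "code_vec vs \<in> code_vec ` set cs" by (metis imageI)
    qed
  next
    assume *: "code_vec ` set cs = code_vec ` set ds"
    show "(\<forall>us\<in>set cs. \<exists>vs\<in>set ds. code_vec us = code_vec vs) \<and> (\<forall>vs\<in>set ds. \<exists>us\<in>set cs. code_vec us = code_vec vs)"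
    proof (intro conjI ballI)
      fix us assume "us \<in> set cs"
      then have "code_vec us \<in> code_vec ` set ds" unfolding *[symmetric] by (rule imageI)
      then show "\<exists>vs\<in>set ds. code_vec us = code_vec vs" by (rule imageE) (rule bexI)
    next
      fix vs assume "vs \<in> set ds"
      then have "code_vec vs \<in> code_vec ` set cs" unfolding * by (rule imageI)
      then obtain us where "us \<in> set cs" "code_vec vs = code_vec us" by (rule imageE)
      then show "\<exists>us\<in>set cs. code_vec us = code_vec vs" by (intro bexI[of _ us]) simp_all
    qed
  qed
  finally show ?thesis .
qed

section \<open>Computable series\<close>

lemma computable_real_iff:
  "computable_real x \<longleftrightarrow> (\<exists>q :: nat \<Rightarrow> rat. computable q \<and> (\<forall>k. \<bar>x - of_rat (q k)\<bar> \<le> (1/2) ^ k))"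
proof
  assume "computable_real x"
  then obtain g where g: "computable_fun g" "\<forall>k. \<bar>x - rat_of_code (g k)\<bar> \<le> (1/2) ^ k"
    unfolding computable_real_def by blast
  define q where "q k = Rat.Fract (int_decode (fst (prod_decode (g k)))) (int (Suc (snd (prod_decode (g k)))))" for k
  have "computable g" using g(1) by (simp add: computable_nat_iff)
  then have "computable q"
    unfolding q_def by (intro computable_intros)
  moreover have "of_rat (q k) = rat_of_code (g k)" for k
    by (simp add: q_def rat_of_code_def of_rat_rat case_prod_unfold)
  ultimately show "\<exists>q :: nat \<Rightarrow> rat. computable q \<and> (\<forall>k. \<bar>x - of_rat (q k)\<bar> \<le> (1/2) ^ k)"
    using g(2) by (intro exI[of _ q]) simp
next
  assume "\<exists>q :: nat \<Rightarrow> rat. computable q \<and> (\<forall>k. \<bar>x - of_rat (q k)\<bar> \<le> (1/2) ^ k)"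
  then obtain q :: "nat \<Rightarrow> rat" where q: "computable q" "\<forall>k. \<bar>x - of_rat (q k)\<bar> \<le> (1/2) ^ k" by blast
  define g where "g k = enc (fst (quotient_of (q k)), nat (snd (quotient_of (q k))) - 1)" for k
  have "computable g" unfolding g_def by (intro computable_enc computable_intros q(1))
  then have "computable_fun g" by (simp add: computable_nat_iff)
  moreover have "rat_of_code (g k) = of_rat (q k)" for k
  proof -
    define a b where "a = fst (quotient_of (q k))" and "b = snd (quotient_of (q k))"
    have b: "b > 0" unfolding b_def by (rule snd_quotient_of_pos)
    have "rat_of_code (g k) = of_int a / real (Suc (nat b - 1))"
      by (simp add: g_def rat_of_code_def enc_prod_def enc_int_def a_def b_def)
    also have "real (Suc (nat b - 1)) = of_int b" using b by simp
    also have "of_int a / of_int b = (of_rat (Rat.Fract a b) :: real)" using b by (simp add: of_rat_rat)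
    also have "Rat.Fract a b = q k" unfolding a_def b_def by (rule Fract_quotient_of)
    finally show ?thesis .
  qed
  ultimately show "computable_real x"
    unfolding computable_real_def using q(2) by (intro exI[of _ g]) simp
qed

text \<open>Partial sums of nonnegative terms increase to the sum, so one can wait until they come
  close to a rational approximation of it; with rational terms the comparison is decidable. The
  modulus bounds every single later term as well.\<close>

lemma computable_tail_modulus:
  fixes b :: "nat \<Rightarrow> real" and q :: "nat \<Rightarrow> rat"
  assumes q: "computable q" "\<And>m. b m = of_rat (q m)" and nn: "\<And>m. 0 \<le> b m"
    and sum: "summable b" "computable_real (suminf b)"
  shows "\<exists>M. computable M \<and> (\<forall>k. suminf b - (\<Sum>m<M k. b m) \<le> (1/2) ^ k)"
proof -
  obtain p :: "nat \<Rightarrow> rat" where p: "computable p" "\<forall>k. \<bar>suminf b - of_rat (p k)\<bar> \<le> (1/2) ^ k"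
    using sum(2) unfolding computable_real_iff by blast
  \<comment> \<open>The approximation error \<open>(1/2) ^ (k + 2)\<close> and the tolerance
    \<open>(1/2) ^ (k + 1)\<close> add up to less than \<open>(1/2) ^ k\<close>, while the tolerance
    still exceeds the error enough for some \<open>M\<close> to pass.\<close>
  define P where "P k M \<longleftrightarrow> p (k + 2) - (\<Sum>m<M. q m) \<le> (1/2) ^ (k + 1)" for k M
  have cP: "computable (\<lambda>z. P (fst z) (snd z))"
    unfolding P_def
    by (intro computable_intros computable_compose[OF p(1)] computable_compose[OF q(1)])
  have P_iff: "P k M \<longleftrightarrow> of_rat (p (k + 2)) - (\<Sum>m<M. b m) \<le> (1/2) ^ (k + 1)" for k M
  proof -
    have "P k M \<longleftrightarrow> (of_rat (p (k + 2) - (\<Sum>m<M. q m)) :: real) \<le> of_rat ((1/2) ^ (k + 1))"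
      unfolding P_def of_rat_less_eq ..
    then show ?thesis by (simp add: of_rat_diff of_rat_sum of_rat_power of_rat_mult of_rat_divide q(2))
  qed
  have ex: "\<exists>M. P k M" for k
  proof -
    have "(\<lambda>M. \<Sum>m<M. b m) \<longlonglongrightarrow> suminf b" using sum(1) by (rule summable_LIMSEQ)
    then have "eventually (\<lambda>M. suminf b - (1/2) ^ (k + 2) < (\<Sum>m<M. b m)) sequentially"
      by (rule order_tendstoD) simp
    then obtain M where "suminf b - (1/2) ^ (k + 2) < (\<Sum>m<M. b m)"
      by (auto simp: eventually_sequentially)
    moreover have "of_rat (p (k + 2)) - suminf b \<le> (1/2) ^ (k + 2)"
      using p(2)[rule_format, of "k + 2"] by linarith
    ultimately have "P k M" unfolding P_iff by simp
    then show ?thesis by blast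
  qed
  obtain M where M: "computable M" "\<forall>k. P k (M k)"
    using computable_choice[of P, OF cP ex] by blast
  have "suminf b - (\<Sum>m<M k. b m) \<le> (1/2) ^ k" for k
  proof -
    have "of_rat (p (k + 2)) - (\<Sum>m<M k. b m) \<le> (1/2) ^ (k + 1)" using M(2) unfolding P_iff by simp
    moreover have "suminf b - of_rat (p (k + 2)) \<le> (1/2) ^ (k + 2)"
      using p(2)[rule_format, of "k + 2"] by linarith
    ultimately have "suminf b - (\<Sum>m<M k. b m) \<le> (1/2) ^ (k + 1) + (1/2) ^ (k + 2)" by linarith
    also have "\<dots> \<le> (1/2) ^ k" by simp
    finally show ?thesis .
  qed
  with M(1) show ?thesis by blast
qed

text \<open>The tail of \<open>a\<close> is at most \<open>2 ^ c\<close> times the tail of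
  \<open>b\<close>, so the modulus of \<open>b\<close> shifted by \<open>c\<close> serves for
  \<open>a\<close>, and partial sums of \<open>a\<close> taken there approximate its sum.\<close>

lemma computable_real_dominated_series:
  fixes a b :: "nat \<Rightarrow> real" and qa qb :: "nat \<Rightarrow> rat"
  assumes qa: "computable qa" "\<And>m. a m = of_rat (qa m)" and qb: "computable qb" "\<And>m. b m = of_rat (qb m)"
    and le: "\<And>m. 0 \<le> a m" "\<And>m. a m \<le> 2 ^ c * b m"
    and sum: "summable b" "computable_real (suminf b)"
  shows "summable a" "computable_real (suminf a)"
proof -
  have nn: "0 \<le> b m" for m
    using le[of m] by (meson order_trans zero_le_mult_iff zero_less_numeral zero_less_power less_le_not_le)
  show sa: "summable a"
    by (rule summable_comparison_test'[of "\<lambda>m. 2 ^ c * b m" 0]) (use le sum(1) in auto)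
  obtain M where M: "computable M" "\<forall>k. suminf b - (\<Sum>m<M k. b m) \<le> (1/2) ^ k"
    using computable_tail_modulus[OF qb nn sum] by blast
  define r where "r k = (\<Sum>m<M (k + c). qa m)" for k
  have "computable r"
    unfolding r_def
    by (intro computable_intros computable_compose[OF qa(1)] computable_compose[OF M(1)])
  moreover have "\<bar>suminf a - of_rat (r k)\<bar> \<le> (1/2) ^ k" for k
  proof -
    let ?M = "M (k + c)"
    have "suminf a - (\<Sum>m<?M. a m) = (\<Sum>m. a (m + ?M))"
      using suminf_minus_initial_segment[OF sa, of ?M] by simp
    also have "\<dots> \<le> (\<Sum>m. 2 ^ c * b (m + ?M))"
      using le sa sum(1) by (intro suminf_le summable_mult summable_ignore_initial_segment) auto
    also have "\<dots> = 2 ^ c * (\<Sum>m. b (m + ?M))"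
      using sum(1) by (intro suminf_mult summable_ignore_initial_segment)
    also have "(\<Sum>m. b (m + ?M)) = suminf b - (\<Sum>m<?M. b m)"
      using suminf_minus_initial_segment[OF sum(1), of ?M] by simp
    also have "2 ^ c * (suminf b - (\<Sum>m<?M. b m)) \<le> 2 ^ c * (1/2) ^ (k + c)"
      using M(2) by (intro mult_left_mono) auto
    also have "\<dots> = (1/2) ^ k" by (simp add: power_add power_one_over)
    finally have "suminf a - (\<Sum>m<?M. a m) \<le> (1/2) ^ k" .
    moreover have "(\<Sum>m<?M. a m) \<le> suminf a" using le(1) sa by (intro sum_le_suminf) auto
    moreover have "of_rat (r k) = (\<Sum>m<?M. a m)" by (simp add: r_def of_rat_sum qa(2))
    ultimately show ?thesis by simp
  qed
  ultimately show "computable_real (suminf a)"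
    unfolding computable_real_iff by (intro exI[of _ r]) simp
qed

section \<open>Prefix-free machines\<close>

definition prefix_free :: "bool list set \<Rightarrow> bool" where
  "prefix_free A \<longleftrightarrow> (\<forall>\<sigma> u. \<sigma> \<in> A \<longrightarrow> \<sigma> @ u \<in> A \<longrightarrow> u = [])"

text \<open>Split by the first bit: both halves are prefix-free with shorter words, and each counts
  with weight one half. A set containing the empty word contains nothing else.\<close>

lemma Kraft_inequality_bounded:
  assumes "finite A" "prefix_free A" "\<And>\<sigma>. \<sigma> \<in> A \<Longrightarrow> length \<sigma> \<le> n"
  shows "(\<Sum>\<sigma>\<in>A. (1/2) ^ length \<sigma> :: real) \<le> 1"
  using assms
proof (induction n arbitrary: A)
  case 0
  then have "A \<subseteq> {[]}" by auto
  then have "A = {} \<or> A = {[]}" by blast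
  then show ?case by auto
next
  case (Suc n)
  show ?case
  proof (cases "[] \<in> A")
    case True
    have "\<sigma> = []" if "\<sigma> \<in> A" for \<sigma>
      using Suc.prems(2)[unfolded prefix_free_def, rule_format, of "[]" \<sigma>] True that by simp
    with True have "A = {[]}" by blast
    then show ?thesis by simp
  next
    case False
    define B where "B b = {\<sigma>. b # \<sigma> \<in> A}" for b
    have A: "A = Cons True ` B True \<union> Cons False ` B False"
    proof (intro equalityI subsetI)
      fix \<sigma> assume "\<sigma> \<in> A"
      then show "\<sigma> \<in> Cons True ` B True \<union> Cons False ` B False"
        using False by (cases \<sigma>; cases "hd \<sigma>") (auto simp: B_def)
    qed (auto simp: B_def)
    have fin: "finite (B b)" for b
    proof -
      have "Cons b ` B b \<subseteq> A" by (auto simp: B_def)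
      then have "finite (Cons b ` B b)" using Suc.prems(1) by (rule finite_subset)
      then show ?thesis by (rule finite_imageD) (simp add: inj_on_def)
    qed
    have IH: "(\<Sum>\<sigma>\<in>B b. (1/2) ^ length \<sigma> :: real) \<le> 1" for b
    proof (rule Suc.IH[OF fin])
      show "prefix_free (B b)"
        unfolding prefix_free_def
      proof (intro allI impI)
        fix \<sigma> u assume "\<sigma> \<in> B b" "\<sigma> @ u \<in> B b"
        then show "u = []"
          using Suc.prems(2)[unfolded prefix_free_def, rule_format, of "b # \<sigma>" u] by (simp add: B_def)
      qed
      show "length \<sigma> \<le> n" if "\<sigma> \<in> B b" for \<sigma>
        using Suc.prems(3)[of "b # \<sigma>"] that by (simp add: B_def)
    qed
    have half: "(\<Sum>\<sigma>\<in>Cons b ` B b. (1/2) ^ length \<sigma> :: real) = 1/2 * (\<Sum>\<sigma>\<in>B b. (1/2) ^ length \<sigma>)" for b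
      by (subst sum.reindex) (auto simp: inj_on_def sum_distrib_left)
    have "(\<Sum>\<sigma>\<in>A. (1/2) ^ length \<sigma> :: real) = (\<Sum>\<sigma>\<in>Cons True ` B True. (1/2) ^ length \<sigma>) + (\<Sum>\<sigma>\<in>Cons False ` B False. (1/2) ^ length \<sigma>)"
      unfolding A by (intro sum.union_disjoint) (auto simp: fin)
    also have "\<dots> \<le> 1" unfolding half using IH[of True] IH[of False] by linarith
    finally show ?thesis .
  qed
qed

lemma Kraft_summable:
  assumes "prefix_free A"
  shows "(\<lambda>\<sigma>. (1/2) ^ length \<sigma> :: real) summable_on A"
proof (rule nonneg_bdd_above_summable_on)
  have "(\<Sum>\<sigma>\<in>F. (1/2) ^ length \<sigma> :: real) \<le> 1" if "F \<subseteq> A" "finite F" for F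
  proof (rule Kraft_inequality_bounded[OF that(2), of "Max (length ` F)"])
    show "prefix_free F" using assms that(1) unfolding prefix_free_def by blast
    show "\<And>\<sigma>. \<sigma> \<in> F \<Longrightarrow> length \<sigma> \<le> Max (length ` F)" using that(2) by simp
  qed
  then show "bdd_above (sum (\<lambda>\<sigma>. (1/2) ^ length \<sigma> :: real) ` {F. F \<subseteq> A \<and> finite F})"
    by (intro bdd_aboveI[of _ 1]) auto
qed simp

text \<open>Turns the unordered sum defining the domain measure into a series over indices, padded
  by zeros, to which the results on computable series apply.\<close>

lemma sums_infsum_bij_betw:
  fixes f :: "'b \<Rightarrow> real" and g :: "nat \<Rightarrow> 'b"
  assumes g: "bij_betw g {m. P m} B" and f: "f summable_on B"
  shows "(\<lambda>m. if P m then f (g m) else 0) sums infsum f B"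
proof (rule has_sum_imp_sums)
  have "((\<lambda>m. f (g m)) has_sum infsum f B) {m. P m}"
    using has_sum_infsum[OF f] has_sum_reindex_bij_betw[OF g] by blast
  then show "((\<lambda>m. if P m then f (g m) else 0) has_sum infsum f B) UNIV"
    by (subst has_sum_cong_neutral[where g = "\<lambda>m. f (g m)" and T = "{m. P m}"]) auto
qed

lemma bits_code_eq_enc: "bits_code \<sigma> = enc \<sigma>"
  unfolding bits_code_def enc_list_def by (simp add: enc_bool_def[abs_def])

text \<open>Divergence outside \<open>D\<close> is produced by minimising a function that ignores
  the search variable: the search ends at 0 or never. Composition demands that all arguments be
  defined, and the projection then returns the value of \<open>h\<close>.\<close>

lemma partial_computable_machine_restrict:
  assumes D: "computable D" and h: "computable h"
  shows "partial_computable_machine (\<lambda>\<sigma>. if D \<sigma> then Some (h \<sigma>) else None)"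
proof -
  have "computable (\<lambda>\<sigma>. if D \<sigma> then 0 else 1 :: nat)" by (intro computable_intros D)
  then obtain d where d: "computable_fun d" "\<forall>\<sigma>. d (enc \<sigma>) = enc (if D \<sigma> then 0 else 1 :: nat)"
    unfolding computable_def by blast
  obtain k where k: "computable_fun k" "\<forall>\<sigma>. k (enc \<sigma>) = enc (h \<sigma>)"
    using h unfolding computable_def by blast
  have "total_rec 2 (\<lambda>xs. d (xs ! 1))"
    by (intro computable_fun_total_rec[OF d(1)] total_rec_nth) simp
  then obtain rd where rd: "computes 2 rd (\<lambda>xs. d (xs ! 1))" unfolding total_rec_def by blast
  obtain rk where rk: "\<forall>x y. evalr rk [x] y \<longleftrightarrow> k x = y" using k(1) unfolding computable_fun_def by blast
  have Mn: "evalr (Mn rd) [x] n \<longleftrightarrow> d x = 0 \<and> n = 0" for x n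
  proof -
    have "evalr rd [m, x] y \<longleftrightarrow> y = d x" for m y using rd by (simp add: computes_def)
    then show ?thesis by (auto simp: evalr_Mn)
  qed
  have C: "evalr (Comp (Proj 0) [rk, Mn rd]) [x] y \<longleftrightarrow> k x = y \<and> d x = 0" for x y
  proof
    assume "evalr (Comp (Proj 0) [rk, Mn rd]) [x] y"
    then obtain ys where ys: "length [rk, Mn rd] = length ys"
      "\<forall>i<length [rk, Mn rd]. evalr ([rk, Mn rd] ! i) [x] (ys ! i)" "evalr (Proj 0) ys y"
      unfolding evalr_Comp by blast
    from ys(2)[rule_format, of 0] ys(2)[rule_format, of 1] ys(3) rk Mn
    show "k x = y \<and> d x = 0" by (auto simp: evalr_Proj)
  next
    assume *: "k x = y \<and> d x = 0"
    show "evalr (Comp (Proj 0) [rk, Mn rd]) [x] y"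
      unfolding evalr_Comp
      by (intro exI[of _ "[y, 0]"]) (use * rk Mn in \<open>auto simp: evalr_Proj less_Suc_eq\<close>)
  qed
  show ?thesis
    unfolding partial_computable_machine_def
  proof (intro exI[of _ "Comp (Proj 0) [rk, Mn rd]"] allI)
    fix \<sigma> y
    show "evalr (Comp (Proj 0) [rk, Mn rd]) [bits_code \<sigma>] y \<longleftrightarrow> (if D \<sigma> then Some (h \<sigma>) else None) = Some y"
      unfolding C bits_code_eq_enc using d(2)[rule_format, of \<sigma>] k(2)[rule_format, of \<sigma>] by simp
  qed
qed

text \<open>The first bit is the most significant, so the extensions of a word by \<open>k\<close>
  bits occupy an interval of \<open>2 ^ k\<close> consecutive values.\<close>

definition bin_val :: "bool list \<Rightarrow> nat" where
  "bin_val \<sigma> = foldl (\<lambda>a b. 2 * a + (if b then 1 else 0)) 0 \<sigma>"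

lemma bin_val_Nil [simp]: "bin_val [] = 0"
  by (simp add: bin_val_def)

lemma bin_val_snoc [simp]: "bin_val (\<sigma> @ [b]) = 2 * bin_val \<sigma> + (if b then 1 else 0)"
  by (simp add: bin_val_def)

lemma bin_val_append: "bin_val (\<sigma> @ u) = bin_val \<sigma> * 2 ^ length u + bin_val u"
proof (induction u rule: rev_induct)
  case (snoc b u)
  have "bin_val (\<sigma> @ u @ [b]) = bin_val ((\<sigma> @ u) @ [b])" by simp
  also have "\<dots> = 2 * bin_val (\<sigma> @ u) + (if b then 1 else 0)" by (rule bin_val_snoc)
  finally show ?case using snoc by simp
qed simp

lemma bin_val_less: "bin_val \<sigma> < 2 ^ length \<sigma>"
  by (induction \<sigma> rule: rev_induct) auto

lemma bin_val_surj: "x < 2 ^ l \<Longrightarrow> \<exists>\<sigma>. length \<sigma> = l \<and> bin_val \<sigma> = x"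
proof (induction l arbitrary: x)
  case (Suc l)
  then have "x div 2 < 2 ^ l" by auto
  with Suc.IH obtain \<sigma> where "length \<sigma> = l" "bin_val \<sigma> = x div 2" by blast
  then show ?case by (intro exI[of _ "\<sigma> @ [odd x]"]) auto
qed simp

lemma bin_val_inj: "length \<sigma> = length \<tau> \<Longrightarrow> bin_val \<sigma> = bin_val \<tau> \<Longrightarrow> \<sigma> = \<tau>"
proof (induction \<sigma> arbitrary: \<tau> rule: rev_induct)
  case (snoc b \<sigma>)
  then obtain \<tau>' c where \<tau>: "\<tau> = \<tau>' @ [c]" by (cases \<tau> rule: rev_cases) auto
  with snoc.prems have eq: "2 * bin_val \<sigma> + (if b then 1 else 0) = 2 * bin_val \<tau>' + (if c then 1 else 0)" by simp
  then have "b = c" by (cases b; cases c) (simp_all, presburger+)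
  with eq snoc.IH[of \<tau>'] snoc.prems(1) \<tau> show ?case by simp
qed simp

text \<open>Words of length \<open>l\<close> are handed out, in increasing order, immediately after the intervals occupied
  by all shorter words; this is possible because the moduli \<open>M\<close> make the set of requests of each
  length computable.\<close>

lemma Kraft_machine:
  fixes act :: "nat \<Rightarrow> bool" and len out M :: "nat \<Rightarrow> nat"
  assumes comp: "computable act" "computable len" "computable out" "computable M"
    and M: "\<And>m. act m \<Longrightarrow> m < M (len m)"
    and sum: "summable (\<lambda>m. if act m then (1/2) ^ len m else 0 :: real)"
      "(\<Sum>m. if act m then (1/2) ^ len m else 0 :: real) \<le> 1"
  shows "\<exists>C g. prefix_free_machine C \<and> bij_betw g (dom C) {m. act m} \<and>
    (\<forall>\<sigma>\<in>dom C. length \<sigma> = len (g \<sigma>) \<and> C \<sigma> = Some (out (g \<sigma>)))"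
proof -
  define lst where "lst l = filter (\<lambda>m. act m \<and> len m = l) [0..<M l]" for l
  define N where "N l = length (lst l)" for l
  \<comment> \<open>\<open>A l\<close> counts the words of length \<open>l\<close> extending a word
    handed out at a smaller length. They fill an initial segment of values, so \<open>A l\<close> is
    the first free one; passing to the next length doubles what is occupied.\<close>
  define A where "A l = rec_nat 0 (\<lambda>l y. 2 * (y + N l)) l" for l
  have A_simps: "A 0 = 0" "A (Suc l) = 2 * (A l + N l)" for l by (simp_all add: A_def)
  have set_lst: "set (lst l) = {m. act m \<and> len m = l}" for l
    using M by (auto simp: lst_def)
  have dist: "distinct (lst l)" for l by (simp add: lst_def)
  define w where "w m = (if act m then (1/2) ^ len m else 0 :: real)" for m
  \<comment> \<open>The fraction of words of length \<open>l\<close> that are occupied equals the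
    weight of all requests up to that length. With total weight at most 1 there is always
    room.\<close>
  have X: "finite {m. act m \<and> len m \<le> l} \<and> real (A l + N l) * (1/2) ^ l = (\<Sum>m | act m \<and> len m \<le> l. w m)" for l
  proof (induction l)
    case 0
    have "{m. act m \<and> len m \<le> 0} = set (lst 0)" by (simp add: set_lst)
    moreover have "(\<Sum>m\<in>set (lst 0). w m) = (\<Sum>m\<in>set (lst 0). 1)"
      by (intro sum.cong) (auto simp: set_lst w_def)
    ultimately show ?case by (simp add: A_simps N_def distinct_card[OF dist])
  next
    case (Suc l)
    have eq: "{m. act m \<and> len m \<le> Suc l} = {m. act m \<and> len m \<le> l} \<union> set (lst (Suc l))"
      by (auto simp: set_lst le_Suc_eq)
    have "(\<Sum>m | act m \<and> len m \<le> Suc l. w m) = (\<Sum>m | act m \<and> len m \<le> l. w m) + (\<Sum>m\<in>set (lst (Suc l)). w m)"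
      unfolding eq by (intro sum.union_disjoint finite_set) (use Suc in blast, auto simp: set_lst)
    also have "(\<Sum>m\<in>set (lst (Suc l)). w m) = (\<Sum>m\<in>set (lst (Suc l)). (1/2) ^ Suc l)"
      by (intro sum.cong) (auto simp: set_lst w_def)
    also have "\<dots> = real (N (Suc l)) * (1/2) ^ Suc l"
      by (simp add: N_def distinct_card[OF dist])
    also have "(\<Sum>m | act m \<and> len m \<le> l. w m) = real (A (Suc l)) * (1/2) ^ Suc l"
      using Suc by (simp add: A_simps algebra_simps)
    finally have "real (A (Suc l) + N (Suc l)) * (1/2) ^ Suc l = (\<Sum>m | act m \<and> len m \<le> Suc l. w m)"
      by (simp add: algebra_simps)
    moreover have "finite {m. act m \<and> len m \<le> Suc l}" unfolding eq using Suc by simp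
    ultimately show ?case by blast
  qed
  have room: "A l + N l \<le> 2 ^ l" for l
  proof -
    have "real (A l + N l) * (1/2) ^ l = (\<Sum>m | act m \<and> len m \<le> l. w m)" using X by blast
    also have "\<dots> \<le> suminf w"
      using X sum(1) by (intro sum_le_suminf) (auto simp: w_def[abs_def])
    also have "\<dots> \<le> 1" using sum(2) by (simp add: w_def[abs_def])
    finally have "real (A l + N l) \<le> 2 ^ l" by (simp add: power_one_over field_simps)
    then have "real (A l + N l) \<le> real (2 ^ l)" by simp
    then show ?thesis by (simp only: of_nat_le_iff)
  qed
  \<comment> \<open>All extensions of occupied words of length \<open>l\<close> stay below the first
    free value at any later length, which gives prefix-freeness.\<close>
  have A_grow: "(A l + N l) * 2 ^ Suc k \<le> A (l + Suc k)" for l k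
  proof (induction k)
    case 0
    show ?case by (simp add: A_simps)
  next
    case (Suc k)
    have "A (l + Suc (Suc k)) = 2 * (A (l + Suc k) + N (l + Suc k))" using A_simps(2)[of "l + Suc k"] by simp
    with Suc show ?case by simp
  qed
  define D where "D \<sigma> \<longleftrightarrow> A (length \<sigma>) \<le> bin_val \<sigma> \<and> bin_val \<sigma> < A (length \<sigma>) + N (length \<sigma>)" for \<sigma>
  define g where "g \<sigma> = nth_dflt 0 (lst (length \<sigma>)) (bin_val \<sigma> - A (length \<sigma>))" for \<sigma>
  define C where "C \<sigma> = (if D \<sigma> then Some (out (g \<sigma>)) else None)" for \<sigma>
  have dom: "dom C = {\<sigma>. D \<sigma>}" by (auto simp: C_def split: if_splits)
  have "computable lst"
    unfolding lst_def
    by (intro computable_intros computable_compose[OF comp(1)] computable_compose[OF comp(2)] comp(4))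
  note c_lst = computable_compose[OF this]
  have "computable N" unfolding N_def by (intro computable_intros c_lst)
  note c_N = computable_compose[OF this]
  have "computable A" unfolding A_def by (intro computable_intros c_N)
  note c_A = computable_compose[OF this]
  have c_val: "computable bin_val"
    unfolding bin_val_def by (intro computable_intros)
  have c_D: "computable D"
    unfolding D_def by (intro computable_intros c_A c_N computable_compose[OF c_val])
  have c_g: "computable g"
    unfolding g_def by (intro computable_intros c_A c_lst computable_compose[OF c_val])
  have gD: "g \<sigma> \<in> set (lst (length \<sigma>))" if "D \<sigma>" for \<sigma>
    using that unfolding g_def D_def N_def by (simp add: less_diff_conv2)
  have "prefix_free_machine C"
    unfolding prefix_free_machine_def
  proof (intro conjI allI impI)
    show "partial_computable_machine C"
      unfolding C_def[abs_def]
      by (rule partial_computable_machine_restrict[OF c_D computable_compose[OF comp(3) c_g]])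
    fix \<sigma> \<tau> u assume st: "\<sigma> \<in> dom C" "\<tau> \<in> dom C" and \<tau>: "\<tau> = \<sigma> @ u"
    show "u = []"
    proof (rule ccontr)
      assume "u \<noteq> []"
      then obtain k where k: "length u = Suc k" by (cases u) auto
      have "bin_val \<tau> < bin_val \<sigma> * 2 ^ length u + 2 ^ length u"
        unfolding \<tau> bin_val_append using bin_val_less[of u] by simp
      also have "\<dots> = Suc (bin_val \<sigma>) * 2 ^ length u" by simp
      also have "\<dots> \<le> (A (length \<sigma>) + N (length \<sigma>)) * 2 ^ length u"
        using st(1) unfolding dom D_def by (intro mult_right_mono) auto
      also have "\<dots> \<le> A (length \<tau>)" using A_grow[of "length \<sigma>" k] by (simp add: \<tau> k)
      also have "\<dots> \<le> bin_val \<tau>" using st(2) unfolding dom D_def by simp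
      finally show False by simp
    qed
  qed
  moreover have "bij_betw g (dom C) {m. act m}"
    unfolding bij_betw_def
  proof
    show "inj_on g (dom C)"
    proof (rule inj_onI)
      fix \<sigma> \<tau> assume st: "\<sigma> \<in> dom C" "\<tau> \<in> dom C" and eq: "g \<sigma> = g \<tau>"
      then have DD: "D \<sigma>" "D \<tau>" by (simp_all add: dom)
      have l: "length \<sigma> = length \<tau>" using gD[OF DD(1)] gD[OF DD(2)] eq by (simp add: set_lst)
      have b: "bin_val \<sigma> - A (length \<sigma>) < length (lst (length \<sigma>))" "bin_val \<tau> - A (length \<sigma>) < length (lst (length \<sigma>))"
        using DD l by (auto simp: D_def N_def less_diff_conv2)
      have "lst (length \<sigma>) ! (bin_val \<sigma> - A (length \<sigma>)) = lst (length \<sigma>) ! (bin_val \<tau> - A (length \<sigma>))"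
        using eq b unfolding g_def l[symmetric] by simp
      then have "bin_val \<sigma> - A (length \<sigma>) = bin_val \<tau> - A (length \<sigma>)"
        using nth_eq_iff_index_eq[OF dist b] by simp
      then have "bin_val \<sigma> = bin_val \<tau>" using DD unfolding D_def l by linarith
      with l show "\<sigma> = \<tau>" by (rule bin_val_inj)
    qed
    show "g ` dom C = {m. act m}"
    proof (intro equalityI subsetI)
      fix m assume "m \<in> g ` dom C"
      then obtain \<sigma> where "m = g \<sigma>" "D \<sigma>" unfolding dom by blast
      then show "m \<in> {m. act m}" using gD[of \<sigma>] by (simp add: set_lst)
    next
      fix m assume "m \<in> {m. act m}"
      then have "m \<in> set (lst (len m))" by (simp add: set_lst)
      then obtain i where i: "i < N (len m)" "lst (len m) ! i = m"
        unfolding in_set_conv_nth N_def by blast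
      have "A (len m) + i < 2 ^ len m" using room[of "len m"] i(1) by simp
      then obtain \<sigma> where \<sigma>: "length \<sigma> = len m" "bin_val \<sigma> = A (len m) + i" using bin_val_surj by blast
      have "D \<sigma>" using i(1) by (simp add: D_def \<sigma>)
      moreover have "g \<sigma> = m" using i by (simp add: g_def \<sigma> N_def)
      ultimately show "m \<in> g ` dom C" unfolding dom by (intro image_eqI[of _ _ \<sigma>]) simp_all
    qed
  qed
  moreover have "length \<sigma> = len (g \<sigma>) \<and> C \<sigma> = Some (out (g \<sigma>))" if "\<sigma> \<in> dom C" for \<sigma>
    using that gD[of \<sigma>] by (simp add: dom set_lst C_def)
  ultimately show ?thesis by (intro exI[of _ C] exI[of _ g]) blast
qed

section \<open>From a failed test to a machine\<close>

lemma code_vecs_surj: "\<exists>c. code_vecs c = cs"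
  by (intro exI[of _ "list_encode (map list_encode cs)"]) (simp add: code_vecs_def o_def)

lemma state_carrier: "is_state \<rho> \<Longrightarrow> \<rho> n \<in> carrier_mat (2 ^ n) (2 ^ n)"
  by (simp add: is_state_def density_mat_def)

lemma prefix_free_dom: "prefix_free_machine C \<Longrightarrow> prefix_free (dom C)"
  unfolding prefix_free_machine_def prefix_free_def by blast

lemma log2_le_of_le_power: "0 < r \<Longrightarrow> real r \<le> 2 ^ k \<Longrightarrow> log 2 (real r) \<le> real k"
  by (subst log_le_iff) (simp_all add: powr_realpow)

lemma QK_le:
  assumes "C \<sigma> = Some c" "orthonormal_alg n (fset_of_code c)"
    "Re (\<Sum>v\<in>fset_of_code c. (\<tau> *\<^sub>v v) \<bullet>c v) > \<epsilon>"
  shows "QK C \<epsilon> n \<tau> \<le> ereal (real (length \<sigma>) + log 2 (real (card (fset_of_code c))))"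
  unfolding QK_def by (rule Inf_lower) (use assms in blast)

lemma machine_of_failed_test:
  assumes st: "is_state \<rho>" and S: "quantum_schnorr_test S" and eps: "\<epsilon> > 0" and fails: "fails_at_level \<rho> S \<epsilon>"
  shows "\<exists>C (d::nat). cm_machine C \<and> (\<forall>n0. \<exists>n\<ge>n0. QK C \<epsilon> n (\<rho> n) \<le> ereal (real n + real d))"
proof -
  from S obtain gS where gS: "computable_fun gS" "\<And>m. S m = smat_of_code (gS m)"
    and sp: "\<And>m. special_projection (fst (S m)) (snd (S m))"
    and sm: "summable (\<lambda>m. tau_meas (S m))" and cr: "computable_real (\<Sum>m. tau_meas (S m))"
    unfolding quantum_schnorr_test_def strong_solovay_test_def computable_proj_seq_def by blast
  have cgS: "computable gS" using gS(1) by (simp add: computable_nat_iff)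
  define n e where "n m = fst (prod_decode (gS m))" and "e m = snd (prod_decode (gS m))" for m
  have cn: "computable n" and ce: "computable e"
    unfolding n_def e_def by (intro computable_intros cgS)+
  have Sm: "S m = smat_of_code (prod_encode (n m, e m))" for m by (simp add: gS(2) n_def e_def)
  have ex: "\<exists>c. code_frame (n m) (code_vecs c) (e m)" for m
  proof -
    have "fst (S m) = n m" by (simp add: Sm smat_of_code_eq)
    then have "special_projection (n m) (snd (smat_of_code (prod_encode (n m, e m))))"
      using sp[of m] Sm[of m] by simp
    then obtain cs where "code_frame (n m) cs (e m)" using special_projection_has_frame by blast
    moreover obtain c where "code_vecs c = cs" using code_vecs_surj by blast
    ultimately show ?thesis by blast
  qed
  have "computable (\<lambda>p. code_frame (n (fst p)) (code_vecs (snd p)) (e (fst p)))"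
    by (intro computable_intros computable_compose[OF cn] computable_compose[OF ce])
  from computable_choice[of "\<lambda>m c. code_frame (n m) (code_vecs c) (e m)", OF this ex]
  obtain F where cF: "computable F" and F: "\<And>m. code_frame (n m) (code_vecs (F m)) (e m)" by blast
  define r where "r m = length (code_vecs (F m))" for m
  have c_r: "computable r" unfolding r_def by (intro computable_intros cF)
  define t where "t m = real (r m) / 2 ^ n m" for m
  have tau: "tau_meas (S m) = t m" for m
    unfolding t_def r_def Sm by (rule code_frame_correct(3)[OF F])
  have t_sum: "summable t" and t_real: "computable_real (suminf t)" using sm cr by (simp_all add: tau)
  have t_nn: "0 \<le> t m" for m by (simp add: t_def)
  define qt where "qt m = (of_nat (r m) / of_nat (2 ^ n m) :: rat)" for m
  have c_qt: "computable qt" unfolding qt_def by (intro computable_intros c_r cn)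
  have qt: "t m = of_rat (qt m)" for m by (simp add: t_def qt_def of_rat_divide of_rat_power)
  \<comment> \<open>A power of 2 above the total weight: lengthening every word by \<open>d0\<close>
    brings the Kraft sum down to at most 1.\<close>
  obtain d0 :: nat where d0: "suminf t \<le> 2 ^ d0"
  proof -
    obtain d0 :: nat where "suminf t \<le> real d0" using real_arch_simple by blast
    also have "real d0 \<le> 2 ^ d0" by (simp add: of_nat_less_two_power less_imp_le)
    finally show thesis by (rule that)
  qed
  \<comment> \<open>A zero projection would need an infinite word and makes no request. It also
    never exceeds a positive level, as is seen in \<open>bound\<close>.\<close>
  define act where "act m \<longleftrightarrow> 0 < r m" for m
  \<comment> \<open>This is \<open>- log 2 (t m)\<close> rounded up and cut off at 0; the second
    disjunct ends the search for the zero projection.\<close>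
  define l0 where "l0 m = (LEAST l. 2 ^ n m \<le> 2 ^ l * r m \<or> r m = 0)" for m
  have l0_ex: "\<exists>l. 2 ^ n m \<le> 2 ^ l * r m \<or> r m = 0" for m by (rule exI[of _ "n m"]) auto
  have c_l0: "computable l0"
    unfolding l0_def
    by (rule computable_Least[OF _ l0_ex])
      (intro computable_intros computable_compose[OF cn] computable_compose[OF c_r])
  have l0_le: "2 ^ n m \<le> 2 ^ l0 m * r m" if "act m" for m
    using LeastI_ex[OF l0_ex[of m]] that unfolding l0_def[symmetric] act_def by simp
  have l0_min: "2 ^ l * r m < 2 ^ n m" if "l < l0 m" for l m
    using not_less_Least[of l "\<lambda>l. 2 ^ n m \<le> 2 ^ l * r m \<or> r m = 0"] that unfolding l0_def[symmetric] by simp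
  have t_ge: "(1/2) ^ l0 m \<le> t m" if "act m" for m
  proof -
    have "real (2 ^ n m) \<le> real (2 ^ l0 m * r m)" using l0_le[OF that] by (simp only: of_nat_le_iff)
    then show ?thesis by (simp add: t_def power_one_over field_simps)
  qed
  define len where "len m = l0 m + d0" for m
  have c_act: "computable act" unfolding act_def by (intro computable_intros c_r)
  have c_len: "computable len" unfolding len_def by (intro computable_intros c_l0)
  define w where "w m = (if act m then (1/2) ^ len m else 0 :: real)" for m
  have w_le: "w m \<le> (1/2) ^ d0 * t m" for m
    using t_ge[of m] t_nn[of m] by (auto simp: w_def len_def power_add mult_right_mono)
  have w_le_t: "w m \<le> 2 ^ 0 * t m" for m
  proof -
    have "(1/2) ^ d0 * t m \<le> 1 * t m" by (intro mult_right_mono power_le_one t_nn) auto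
    with w_le[of m] show ?thesis by simp
  qed
  define qw where "qw m = (if act m then (1/2) ^ len m else 0 :: rat)" for m
  have c_qw: "computable qw" unfolding qw_def by (intro computable_intros c_act c_len)
  have qw: "w m = of_rat (qw m)" for m by (simp add: w_def qw_def of_rat_power of_rat_divide)
  have w_nn: "0 \<le> w m" for m by (simp add: w_def)
  note w_sum = computable_real_dominated_series[OF c_qw qw c_qt qt w_nn w_le_t t_sum t_real]
  have "suminf w \<le> (\<Sum>m. (1/2) ^ d0 * t m)"
    using w_le w_sum(1) t_sum by (intro suminf_le summable_mult) auto
  also have "\<dots> = (1/2) ^ d0 * suminf t" using t_sum by (rule suminf_mult)
  also have "\<dots> \<le> (1/2) ^ d0 * 2 ^ d0" using d0 by (intro mult_left_mono) auto
  also have "\<dots> = 1" by (simp add: power_one_over)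
  finally have w1: "suminf w \<le> 1" .
  obtain M' where M': "computable M'" "\<forall>k. suminf t - (\<Sum>m<M' k. t m) \<le> (1/2) ^ k"
    using computable_tail_modulus[OF c_qt qt t_nn t_sum t_real] by blast
  \<comment> \<open>An index from \<open>M l\<close> on has \<open>t m\<close> at most
    \<open>(1/2) ^ Suc l\<close>, whereas a request of length \<open>l\<close> comes with
    \<open>t m\<close> at least \<open>(1/2) ^ l\<close>. So the requests of each length can be
    listed completely.\<close>
  define M where "M l = M' (Suc l)" for l
  have cM: "computable M" unfolding M_def by (intro computable_compose[OF M'(1)] computable_intros)
  have M: "m < M (len m)" if "act m" for m
  proof (rule ccontr)
    assume "\<not> m < M (len m)"
    then have "(\<Sum>i<M (len m). t i) + t m \<le> (\<Sum>i<Suc m. t i)"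
      using t_nn by (simp add: sum_mono2)
    also have "\<dots> \<le> suminf t" using t_nn t_sum by (intro sum_le_suminf) auto
    finally have "t m \<le> (1/2) ^ Suc (len m)" using M'(2)[rule_format, of "Suc (len m)"] by (simp add: M_def)
    moreover have "(1/2 :: real) ^ Suc (len m) < (1/2) ^ l0 m"
      by (intro power_strict_decreasing) (auto simp: len_def)
    ultimately show False using t_ge[OF that] by linarith
  qed
  obtain C g where C: "prefix_free_machine C" and g: "bij_betw g (dom C) {m. act m}"
    and Cg: "\<And>\<sigma>. \<sigma> \<in> dom C \<Longrightarrow> length \<sigma> = len (g \<sigma>) \<and> C \<sigma> = Some (F (g \<sigma>))"
    using Kraft_machine[OF c_act c_len cF cM M] w_sum(1) w1 unfolding w_def[abs_def] by blast
  define h where "h = inv_into (dom C) g"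
  have h: "bij_betw h {m. act m} (dom C)" unfolding h_def by (rule bij_betw_inv_into[OF g])
  have h_dom: "h m \<in> dom C" and gh: "g (h m) = m" if "act m" for m
  proof -
    show "h m \<in> dom C" using bij_betwE[OF h] that by blast
    show "g (h m) = m" unfolding h_def using that by (intro bij_betw_inv_into_right[OF g]) simp
  qed
  have len_h: "length (h m) = len m" and C_h: "C (h m) = Some (F m)" if "act m" for m
    using Cg[OF h_dom[OF that]] gh[OF that] by simp_all
  have "(\<lambda>m. if act m then (1/2) ^ length (h m) else 0) sums domain_measure C"
    unfolding domain_measure_def
    by (rule sums_infsum_bij_betw[OF h Kraft_summable[OF prefix_free_dom[OF C]]])
  also have "(\<lambda>m. if act m then (1/2) ^ length (h m) else 0) = w"
    by (auto simp: w_def len_h)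
  finally have "domain_measure C = suminf w" by (simp add: sums_iff)
  then have cm: "cm_machine C" using C w_sum(2) by (simp add: cm_machine_def)
  \<comment> \<open>One \<open>d0\<close> is the shift in \<open>len\<close>. The other occurs when
    \<open>l0 m = 0\<close>, where \<open>t m\<close> is only bounded by the total weight. The 1 is
    the loss by rounding, from minimality of \<open>l0 m\<close> at its predecessor.\<close>
  have bound: "QK C \<epsilon> (n m) (\<rho> (n m)) \<le> ereal (real (n m) + real (2 * d0 + 1)) \<and> act m"
    if big: "rho_meas \<rho> (S m) > \<epsilon>" for m
  proof -
    have fs: "fset_of_code (F m) = code_vec ` set (code_vecs (F m))" by (rule fset_of_code_eq)
    have "rho_meas \<rho> (S m) = Re (\<Sum>v\<in>fset_of_code (F m). (\<rho> (n m) *\<^sub>v v) \<bullet>c v)"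
      unfolding Sm fs by (rule code_frame_correct(4)[where \<rho> = \<rho>, OF F]) (rule state_carrier[OF st])
    with big have R: "Re (\<Sum>v\<in>fset_of_code (F m). (\<rho> (n m) *\<^sub>v v) \<bullet>c v) > \<epsilon>" by simp
    have act: "act m"
    proof (rule ccontr)
      assume "\<not> act m"
      then have "fset_of_code (F m) = {}" by (simp add: act_def r_def fs)
      with R eps show False by simp
    qed
    have orth: "orthonormal_alg (n m) (fset_of_code (F m))"
      using F[of m] unfolding code_frame_iff fs by blast
    have card: "card (fset_of_code (F m)) = r m"
      unfolding fs r_def by (rule code_frame_sum(2)[OF F])
    have "log 2 (real (r m)) + real (l0 m) \<le> real (n m) + real d0 + 1"
    proof (cases "l0 m")
      case 0
      have "t m \<le> (\<Sum>i<Suc m. t i)" using t_nn by (simp add: sum_nonneg)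
      also have "\<dots> \<le> suminf t" using t_nn t_sum by (intro sum_le_suminf) auto
      finally have "t m \<le> 2 ^ d0" using d0 by linarith
      then have "real (r m) \<le> 2 ^ (n m + d0)" by (simp add: t_def field_simps power_add)
      then have "log 2 (real (r m)) \<le> real (n m + d0)" using act by (intro log2_le_of_le_power) (simp_all add: act_def)
      with 0 show ?thesis by simp
    next
      case (Suc l)
      then have "2 ^ l * r m < 2 ^ n m" by (intro l0_min) simp
      then have "real (2 ^ l * r m) \<le> real (2 ^ n m)" by (simp only: of_nat_le_iff)
      then have "log 2 (real (2 ^ l * r m)) \<le> real (n m)" using act by (intro log2_le_of_le_power) (simp_all add: act_def)
      also have "log 2 (real (2 ^ l * r m)) = real l + log 2 (real (r m))"
        using act by (simp add: log_mult act_def log_nat_power)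
      finally show ?thesis using Suc by simp
    qed
    then have "real (length (h m)) + log 2 (real (card (fset_of_code (F m)))) \<le> real (n m) + real (2 * d0 + 1)"
      unfolding len_h[OF act] card by (simp add: len_def)
    with QK_le[of C, OF C_h[OF act] orth R] show ?thesis
      using act by (meson ereal_less_eq(3) order_trans)
  qed
  have "\<exists>k\<ge>n0. QK C \<epsilon> k (\<rho> k) \<le> ereal (real k + real (2 * d0 + 1))" for n0
  proof -
    \<comment> \<open>A nonzero projection in dimension \<open>2 ^ n\<close> has weight at least
      \<open>(1/2) ^ n\<close>, and the weights tend to 0; failures at late indices therefore happen
      at large \<open>n\<close>.\<close>
    have "t \<longlonglongrightarrow> 0" using t_sum by (rule summable_LIMSEQ_zero)
    then have "eventually (\<lambda>m. t m < (1/2) ^ n0) sequentially" by (rule order_tendstoD) simp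
    then obtain m0 where m0: "\<And>m. m \<ge> m0 \<Longrightarrow> t m < (1/2) ^ n0" by (auto simp: eventually_sequentially)
    obtain m where m: "m \<ge> m0" "rho_meas \<rho> (S m) > \<epsilon>"
      using fails unfolding fails_at_level_def infinite_nat_iff_unbounded_le by blast
    from bound[OF m(2)] have act: "act m" and Q: "QK C \<epsilon> (n m) (\<rho> (n m)) \<le> ereal (real (n m) + real (2 * d0 + 1))" by auto
    have "(1/2) ^ n m \<le> t m" using act by (simp add: t_def act_def power_one_over divide_right_mono)
    also have "\<dots> < (1/2) ^ n0" using m0[OF m(1)] .
    finally have "n0 < n m" by (simp add: power_strict_decreasing_iff)
    with Q show ?thesis by (intro exI[of _ "n m"]) simp
  qed
  with cm show ?thesis by blast
qed

section \<open>From a machine to a failed test\<close>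

text \<open>Not every number codes a word, so words are enumerated as lists of natural numbers with
  entries at most 1; for these the code agrees with \<open>bits_code\<close>.\<close>

definition bit_list :: "nat list \<Rightarrow> bool" where
  "bit_list l \<longleftrightarrow> (\<forall>i<length l. nth_dflt 0 l i \<le> 1)"

lemma computable_bit_list: "computable bit_list"
  unfolding bit_list_def by (intro computable_intros)

lemma bits_code_of_bit_list:
  assumes "bit_list (list_decode s)"
  shows "bits_code (map (\<lambda>x. x = 1) (list_decode s)) = s"
proof -
  have "map (\<lambda>b. if b then 1 else 0) (map (\<lambda>x. x = 1) (list_decode s)) = list_decode s"
    using assms by (intro nth_equalityI) (auto simp: bit_list_def le_Suc_eq)
  then show ?thesis unfolding bits_code_def by simp
qed

lemma bit_list_bits_code:
  "bit_list (list_decode (bits_code \<sigma>))" "map (\<lambda>x. x = 1) (list_decode (bits_code \<sigma>)) = \<sigma>"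
proof -
  show "bit_list (list_decode (bits_code \<sigma>))" by (simp add: bits_code_def bit_list_def)
  have "map (\<lambda>x. x = 1) (map (\<lambda>b. if b then 1 else 0 :: nat) \<sigma>) = \<sigma>" by (induction \<sigma>) auto
  then show "map (\<lambda>x. x = 1) (list_decode (bits_code \<sigma>)) = \<sigma>"
    unfolding bits_code_def list_encode_inverse .
qed

text \<open>The padding of the test: indices that yield no usable family are assigned the zero
  projection in dimension 1, whose weight is 0. Code 0 stands for the zero polynomial and thus for
  the number 0.\<close>

lemma code_frame_empty: "code_frame 0 [] 0"
proof -
  have "alg_of_code 0 = 0"
  proof -
    have "prod_decode 0 = (0, 0)" by (simp add: prod_decode_def prod_decode_aux.simps)
    then have "code_coeffs 0 = []" by (simp add: code_coeffs_def)
    then show ?thesis unfolding alg_of_code_alg alg_def by simp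
  qed
  then show ?thesis
    unfolding code_frame_iff by (simp add: orthonormal_alg_def code_entry_def nth_dflt_def)
qed

text \<open>An index codes a word, an output and a witness for the evaluation, and validity of such
  a triple is decidable. This makes the active indices a decidable set although the domain is only
  enumerable.\<close>

lemma machine_enumeration:
  assumes C: "prefix_free_machine C"
  shows "\<exists>act l y. computable act \<and> computable l \<and> computable y \<and>
    bij_betw (\<lambda>m. map (\<lambda>x. x = 1) (l m :: nat list)) {m :: nat. act m} (dom C) \<and>
    (\<forall>m. act m \<longrightarrow> C (map (\<lambda>x. x = 1) (l m)) = Some (y m :: nat))"
proof -
  from C obtain f where f: "\<And>\<sigma> y. evalr f [bits_code \<sigma>] y \<longleftrightarrow> C \<sigma> = Some y"
    unfolding prefix_free_machine_def partial_computable_machine_def by blast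
  obtain R :: "(nat list \<times> nat) \<times> nat \<Rightarrow> bool" where R: "computable R"
    "\<forall>p. evalr f (fst p) (snd p) \<longleftrightarrow> (\<exists>w. R (p, w))"
    using semidecidable_evalr[of f] unfolding semidecidable_def by blast
  define s y w where "s m = fst (prod_decode m)" and "y m = fst (prod_decode (snd (prod_decode m)))"
    and "w m = snd (prod_decode (snd (prod_decode m)))" for m
  have cs: "computable s" and cy: "computable y" and cw: "computable w"
    unfolding s_def y_def w_def by (intro computable_intros)+
  define ok where "ok m \<longleftrightarrow> bit_list (list_decode (s m)) \<and> R (([s m], y m), w m)" for m
  have c_ok: "computable ok"
    unfolding ok_def
    by (intro computable_conj computable_compose[OF computable_bit_list] computable_compose[OF R(1)]
        computable_intros cs cy cw)
  \<comment> \<open>Keeping only the first valid triple of each word makes the enumeration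
    injective, so that no weight is counted twice.\<close>
  define act where "act m \<longleftrightarrow> ok m \<and> (\<forall>k<m. ok k \<longrightarrow> s k \<noteq> s m)" for m
  have c_act: "computable act"
    unfolding act_def by (intro computable_intros c_ok computable_compose[OF c_ok] computable_compose[OF cs])
  define l where "l m = list_decode (s m)" for m
  have cl: "computable l" unfolding l_def by (intro computable_intros cs)
  define \<sigma> where "\<sigma> m = map (\<lambda>x. x = 1) (l m)" for m
  have code: "bits_code (\<sigma> m) = s m" if "ok m" for m
    unfolding \<sigma>_def l_def using that by (intro bits_code_of_bit_list) (simp add: ok_def)
  have C_ok: "C (\<sigma> m) = Some (y m)" if "ok m" for m
  proof -
    have "evalr f [s m] (y m)" using that R(2)[rule_format, of "([s m], y m)"] by (auto simp: ok_def)
    then show ?thesis using f[of "\<sigma> m" "y m"] by (simp add: code[OF that])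
  qed
  have "bij_betw \<sigma> {m. act m} (dom C)"
    unfolding bij_betw_def
  proof
    show "inj_on \<sigma> {m. act m}"
    proof (rule inj_onI)
      fix a b assume ab: "a \<in> {m. act m}" "b \<in> {m. act m}" and eq: "\<sigma> a = \<sigma> b"
      then have okab: "ok a" "ok b" by (simp_all add: act_def)
      have "s a = s b" using code[OF okab(1)] code[OF okab(2)] eq by simp
      with ab okab show "a = b" by (cases a b rule: linorder_cases) (auto simp: act_def)
    qed
    show "\<sigma> ` {m. act m} = dom C"
    proof (intro equalityI subsetI)
      fix x assume "x \<in> \<sigma> ` {m. act m}"
      then obtain m where "x = \<sigma> m" "ok m" by (auto simp: act_def)
      then show "x \<in> dom C" using C_ok by blast
    next
      fix x assume "x \<in> dom C"
      then obtain z where "C x = Some z" by blast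
      then have "evalr f [bits_code x] z" using f by simp
      then obtain v where v: "R (([bits_code x], z), v)" using R(2)[rule_format, of "([bits_code x], z)"] by auto
      define m' where "m' = prod_encode (bits_code x, prod_encode (z, v))"
      have m': "ok m' \<and> s m' = bits_code x"
        using v by (simp add: ok_def m'_def s_def y_def w_def bit_list_bits_code)
      define m where "m = (LEAST m. ok m \<and> s m = bits_code x)"
      have m: "ok m \<and> s m = bits_code x" unfolding m_def by (rule LeastI) (rule m')
      have "act m"
        unfolding act_def
      proof (intro conjI allI impI notI)
        fix k assume "k < m" "ok k" "s k = s m"
        with m not_less_Least[of k "\<lambda>m. ok m \<and> s m = bits_code x"] show False by (simp add: m_def)
      qed (use m in blast)
      moreover have "\<sigma> m = x"
      proof -
        have "s m = bits_code x" using m by blast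
        then show ?thesis unfolding \<sigma>_def l_def by (simp only: bit_list_bits_code(2))
      qed
      ultimately show "x \<in> \<sigma> ` {m. act m}" by blast
    qed
  qed
  then have "bij_betw (\<lambda>m. map (\<lambda>x. x = 1) (l m)) {m. act m} (dom C)" by (simp add: \<sigma>_def[abs_def])
  moreover have "\<forall>m. act m \<longrightarrow> C (map (\<lambda>x. x = 1) (l m)) = Some (y m)"
    using C_ok by (simp add: act_def \<sigma>_def)
  ultimately show ?thesis using c_act cl cy by blast
qed

lemma failed_test_of_machine:
  fixes d :: nat
  assumes st: "is_state \<rho>" and C: "cm_machine C" and eps: "\<epsilon> > 0"
    and small: "\<And>n0. \<exists>n\<ge>n0. QK C \<epsilon> n (\<rho> n) \<le> ereal (real n + real d)"
  shows "\<exists>S. quantum_schnorr_test S \<and> fails_at_level \<rho> S \<epsilon>"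
proof -
  have pf: "prefix_free_machine C" and cr: "computable_real (domain_measure C)"
    using C by (simp_all add: cm_machine_def)
  obtain act l y where c_act: "computable act" and cl: "computable l" and cy: "computable y"
    and bij: "bij_betw (\<lambda>m. map (\<lambda>x. x = 1) (l m :: nat list)) {m :: nat. act m} (dom C)"
    and Cy: "\<And>m. act m \<Longrightarrow> C (map (\<lambda>x. x = 1) (l m)) = Some (y m :: nat)"
    using machine_enumeration[OF pf] by blast
  define b where "b m = (if act m then (1/2) ^ length (l m) else 0 :: real)" for m
  define qb where "qb m = (if act m then (1/2) ^ length (l m) else 0 :: rat)" for m
  have c_qb: "computable qb" unfolding qb_def by (intro computable_intros c_act cl)
  have qb: "b m = of_rat (qb m)" for m by (simp add: b_def qb_def of_rat_power of_rat_divide)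
  have "b sums domain_measure C"
    using sums_infsum_bij_betw[OF bij Kraft_summable[OF prefix_free_dom[OF pf]]]
    unfolding domain_measure_def b_def[abs_def] length_map .
  then have b_sum: "summable b" and b_real: "computable_real (suminf b)" using cr by (simp_all add: sums_iff)
  define vs where "vs m = code_vecs (y m)" for m
  have c_vs: "computable vs" unfolding vs_def by (intro computable_intros cy)
  \<comment> \<open>Output codes carry no dimension; it is read off the length of the first vector.
    If that length is not a power of 2, \<open>code_orthonormal\<close> rejects the family.\<close>
  define n where "n m = (LEAST n. length (nth_dflt [] (vs m) 0) \<le> 2 ^ n)" for m
  have cn: "computable n"
    unfolding n_def
  proof (rule computable_Least)
    show "computable (\<lambda>p. length (nth_dflt [] (vs (fst p)) 0) \<le> 2 ^ snd p)"
      by (intro computable_intros computable_compose[OF c_vs])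
    show "\<exists>k. length (nth_dflt [] (vs m) 0) \<le> 2 ^ k" for m
      by (rule exI[of _ "length (nth_dflt [] (vs m) 0)"]) (simp add: less_imp_le)
  qed
  define orth where "orth m \<longleftrightarrow> act m \<and> vs m \<noteq> [] \<and> code_orthonormal (n m) (vs m)" for m
  have c_orth: "computable orth" unfolding orth_def by (intro computable_intros c_act c_vs cn)
  \<comment> \<open>The premise \<open>orth m\<close> makes every index have a witness, so the
    search is total.\<close>
  define P where "P m z \<longleftrightarrow> (orth m \<longrightarrow> code_frame (n m) (code_vecs (fst (prod_decode z))) (snd (prod_decode z))
     \<and> same_set (code_vecs (fst (prod_decode z))) (vs m))" for m z
  have cP: "computable (\<lambda>p. P (fst p) (snd p))"
    unfolding P_def by (intro computable_intros computable_compose[OF c_orth] computable_compose[OF cn] computable_compose[OF c_vs])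
  have exP: "\<exists>z. P m z" for m
  proof (cases "orth m")
    case True
    then have "orthonormal_alg (n m) (code_vec ` set (vs m))" by (simp add: orth_def code_orthonormal_iff)
    from orthonormal_has_frame[OF this] obtain cs e where "code_frame (n m) cs e" "code_vec ` set cs = code_vec ` set (vs m)" by blast
    moreover obtain c where "code_vecs c = cs" using code_vecs_surj by blast
    ultimately have "P m (prod_encode (c, e))" by (simp add: P_def same_set_iff)
    then show ?thesis by blast
  qed (simp add: P_def)
  obtain z where cz: "computable z" and z: "\<And>m. P m (z m)"
    using computable_choice[of P, OF cP exP] by blast
  define cs where "cs m = code_vecs (fst (prod_decode (z m)))" for m
  have c_cs: "computable cs" unfolding cs_def by (intro computable_intros cz)
  \<comment> \<open>The condition \<open>|pi| + log |F| < n + d + 1\<close> after exponentiation,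
    hence decidable. It also says that the weight of the projection is below
    \<open>2 ^ (d + 1)\<close> times that of the word, the domination used for the sum.\<close>
  define good where "good m \<longleftrightarrow> orth m \<and> length (cs m) * 2 ^ length (l m) < 2 ^ (n m + d + 1)" for m
  have c_good: "computable good" unfolding good_def by (intro computable_intros c_orth c_cs cl cn)
  define N where "N m = (if good m then n m else 0)" for m
  define E where "E m = (if good m then snd (prod_decode (z m)) else 0)" for m
  define D where "D m = (if good m then cs m else [])" for m
  have c_N: "computable N" and c_E: "computable E" and c_D: "computable D"
    unfolding N_def E_def D_def by (intro computable_intros c_good cn cz c_cs)+
  have frame: "code_frame (N m) (D m) (E m)" for m
    using z[of m] code_frame_empty by (auto simp: N_def D_def E_def good_def P_def cs_def)
  define S where "S m = smat_of_code (prod_encode (N m, E m))" for m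
  note F = code_frame_correct[OF frame]
  define a where "a m = real (length (D m)) / 2 ^ N m" for m
  define qa where "qa m = (of_nat (length (D m)) / of_nat (2 ^ N m) :: rat)" for m
  have c_qa: "computable qa" unfolding qa_def by (intro computable_intros c_D c_N)
  have qa: "a m = of_rat (qa m)" for m by (simp add: a_def qa_def of_rat_divide of_rat_power)
  have a_nn: "0 \<le> a m" for m by (simp add: a_def)
  have a_le: "a m \<le> 2 ^ (d + 1) * b m" for m
  proof (cases "good m")
    case True
    then have "length (cs m) * 2 ^ length (l m) \<le> 2 ^ (n m + d + 1)" and act: "act m"
      by (simp_all add: good_def orth_def)
    then have "real (length (cs m) * 2 ^ length (l m)) \<le> real (2 ^ (n m + d + 1))" by (simp only: of_nat_le_iff)
    then show ?thesis using True act
      by (simp add: a_def b_def D_def N_def power_add power_one_over field_simps)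
  next
    case False
    then show ?thesis by (simp add: a_def D_def b_def)
  qed
  note a_sum = computable_real_dominated_series[OF c_qa qa c_qb qb a_nn a_le b_sum b_real]
  have tau: "tau_meas (S m) = a m" for m unfolding S_def a_def by (rule F(3))
  have "computable_proj_seq S"
    unfolding computable_proj_seq_def
  proof (intro conjI allI exI[of _ "\<lambda>m. prod_encode (N m, E m)"])
    have "computable (\<lambda>m. enc (N m, E m))" by (intro computable_enc computable_intros c_N c_E)
    then show "computable_fun (\<lambda>m. prod_encode (N m, E m))"
      by (simp add: computable_nat_iff enc_prod_def)
    show "special_projection (fst (S m)) (snd (S m))" for m
      unfolding S_def F(1) by (rule F(2))
  qed (simp add: S_def)
  then have "quantum_schnorr_test S"
    unfolding quantum_schnorr_test_def strong_solovay_test_def using a_sum by (simp add: tau)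
  moreover have "fails_at_level \<rho> S \<epsilon>"
    unfolding fails_at_level_def
  proof
    assume fin: "finite {m. rho_meas \<rho> (S m) > \<epsilon>}"
    \<comment> \<open>\<open>n0\<close> exceeds the dimension exponents of all failures, so any
      violation of the complexity bound from \<open>n0\<close> on must produce a further
      failure.\<close>
    define n0 where "n0 = Suc (Max (insert 0 (N ` {m. rho_meas \<rho> (S m) > \<epsilon>})))"
    have below: "N m < n0" if "rho_meas \<rho> (S m) > \<epsilon>" for m
      unfolding n0_def less_Suc_eq_le using fin that by (intro Max_ge) auto
    obtain k where k: "k \<ge> n0" "QK C \<epsilon> k (\<rho> k) \<le> ereal (real k + real d)" using small by blast
    \<comment> \<open>Passing to a strict bound lets the infimum be replaced by one actual program
      below it.\<close>
    have "ereal (real k + real d) < ereal (real k + real d + 1)" by simp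
    with k(2) have "QK C \<epsilon> k (\<rho> k) < ereal (real k + real d + 1)" by (rule order_le_less_trans)
    then obtain \<pi> c where \<pi>: "C \<pi> = Some c" "orthonormal_alg k (fset_of_code c)"
      "Re (\<Sum>v\<in>fset_of_code c. (\<rho> k *\<^sub>v v) \<bullet>c v) > \<epsilon>"
      "real (length \<pi>) + log 2 (real (card (fset_of_code c))) < real k + real d + 1"
      unfolding QK_def Inf_less_iff by auto
    have "\<pi> \<in> dom C" using \<pi>(1) by (rule domI)
    then have "\<pi> \<in> (\<lambda>m. map (\<lambda>x. x = 1) (l m)) ` {m. act m}"
      unfolding bij_betw_imp_surj_on[OF bij] .
    then obtain m where m: "act m" "map (\<lambda>x. x = 1) (l m) = \<pi>" by (elim imageE CollectE) simp
    then have ym: "y m = c" using Cy[OF m(1)] \<pi>(1) by simp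
    have len: "length (l m) = length \<pi>" using m(2) by (metis length_map)
    have fs: "fset_of_code c = code_vec ` set (vs m)" by (simp add: vs_def ym fset_of_code_eq)
    \<comment> \<open>The empty family has sum 0 and cannot exceed a positive level, so a first
      vector exists from which to read the dimension.\<close>
    have ne: "vs m \<noteq> []"
    proof
      assume "vs m = []"
      then show False using \<pi>(3) eps by (simp add: fs)
    qed
    have "code_vec (vs m ! 0) \<in> carrier_vec (2 ^ k)"
      using orthonormal_algD(1)[OF \<pi>(2), of "code_vec (vs m ! 0)"] ne by (simp add: fs)
    then have "length (nth_dflt [] (vs m) 0) = 2 ^ k" using ne by (simp add: code_vec_carrier)
    then have nk: "n m = k"
      unfolding n_def by (intro Least_equality) simp_all
    have om: "orth m" using m(1) ne \<pi>(2) by (simp add: orth_def nk code_orthonormal_iff fs)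
    then have fr: "code_frame k (cs m) (snd (prod_decode (z m)))" and same: "code_vec ` set (cs m) = fset_of_code c"
      using z[of m] by (simp_all add: P_def cs_def nk same_set_iff fs)
    have card: "card (fset_of_code c) = length (cs m)"
      unfolding same[symmetric] by (rule code_frame_sum(2)[OF fr])
    have r0: "0 < length (cs m)"
    proof (rule ccontr)
      assume "\<not> 0 < length (cs m)"
      then have "fset_of_code c = {}" using same by simp
      then show False using \<pi>(3) eps by simp
    qed
    have "length (cs m) * 2 ^ length (l m) < 2 ^ (n m + d + 1)"
    proof -
      have "real (length (cs m) * 2 ^ length (l m)) = 2 powr (real (length \<pi>) + log 2 (real (length (cs m))))"
        using r0 by (simp add: powr_add powr_realpow len)
      also have "\<dots> < 2 powr (real k + real d + 1)" using \<pi>(4) by (simp add: card)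
      also have "\<dots> = real (2 ^ (n m + d + 1))"
        by (simp add: nk powr_add powr_realpow power_add)
      finally show ?thesis by (simp only: of_nat_less_iff)
    qed
    with om have g: "good m" by (simp add: good_def)
    then have ND: "N m = k" "D m = cs m" by (simp_all add: N_def D_def nk)
    have "rho_meas \<rho> (S m) = Re (\<Sum>v\<in>code_vec ` set (D m). (\<rho> (N m) *\<^sub>v v) \<bullet>c v)"
      unfolding S_def by (rule code_frame_correct(4)[where \<rho> = \<rho>, OF frame]) (rule state_carrier[OF st])
    also have "\<dots> = Re (\<Sum>v\<in>fset_of_code c. (\<rho> k *\<^sub>v v) \<bullet>c v)" by (simp add: ND same)
    finally have "rho_meas \<rho> (S m) > \<epsilon>" using \<pi>(3) by simp
    from below[OF this] k(1) ND(1) show False by simp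
  qed
  ultimately show ?thesis by blast
qed

theorem mainTheorem16:
  fixes \<rho> :: "nat \<Rightarrow> complex mat"
  assumes "is_state \<rho>"
  shows "q_schnorr_random \<rho> \<longleftrightarrow>
    (\<forall>C \<epsilon> (d::nat). cm_machine C \<and> \<epsilon> > 0 \<longrightarrow>
       (\<exists>n0. \<forall>n\<ge>n0. QK C \<epsilon> n (\<rho> n) > ereal (real n + real d)))"
proof
  assume rnd: "q_schnorr_random \<rho>"
  show "\<forall>C \<epsilon> (d::nat). cm_machine C \<and> \<epsilon> > 0 \<longrightarrow>
       (\<exists>n0. \<forall>n\<ge>n0. QK C \<epsilon> n (\<rho> n) > ereal (real n + real d))"
  proof (intro allI impI, rule ccontr)
    fix C \<epsilon> and d :: nat
    assume C: "cm_machine C \<and> \<epsilon> > 0"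
      and "\<not> (\<exists>n0. \<forall>n\<ge>n0. QK C \<epsilon> n (\<rho> n) > ereal (real n + real d))"
    then have "\<exists>n\<ge>n0. QK C \<epsilon> n (\<rho> n) \<le> ereal (real n + real d)" for n0
      by (auto simp: not_less)
    from failed_test_of_machine[OF assms conjunct1[OF C] conjunct2[OF C] this]
    obtain S where "quantum_schnorr_test S" "fails_at_level \<rho> S \<epsilon>" by blast
    with rnd C show False unfolding q_schnorr_random_def passes_test_def by blast
  qed
next
  assume machines: "\<forall>C \<epsilon> (d::nat). cm_machine C \<and> \<epsilon> > 0 \<longrightarrow>
       (\<exists>n0. \<forall>n\<ge>n0. QK C \<epsilon> n (\<rho> n) > ereal (real n + real d))"
  show "q_schnorr_random \<rho>"
    unfolding q_schnorr_random_def passes_test_def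
  proof (intro allI impI notI, elim exE conjE)
    fix S \<epsilon>
    assume "quantum_schnorr_test S" "\<epsilon> > 0" "fails_at_level \<rho> S \<epsilon>"
    from machine_of_failed_test[OF assms this] obtain C and d :: nat
      where C: "cm_machine C" "\<forall>n0. \<exists>n\<ge>n0. QK C \<epsilon> n (\<rho> n) \<le> ereal (real n + real d)" by blast
    from machines C(1) \<open>\<epsilon> > 0\<close> obtain n0 where "\<forall>n\<ge>n0. QK C \<epsilon> n (\<rho> n) > ereal (real n + real d)" by blast
    moreover from C(2) obtain n where "n \<ge> n0" "QK C \<epsilon> n (\<rho> n) \<le> ereal (real n + real d)" by blast
    ultimately show False by (auto simp: not_less[symmetric])
  qed
qed

end
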